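(* Let $B=\{\mathbf x^{\beta_1},\dots,\mathbf x^{\beta_r}\}\subset\mathbb C[\mathbf x]_{r-1}$ be a monomial set that is closed under division, and assume that $B$ is a regular basis. Let $\mu$ be the set of coordinates $\{\mu_{\beta_i,\beta_j+e_k}: 1\le i,j\le r,\ |\beta_j|<|\beta_i|,\ 1\le k\le n\}$. There exist a subset $\bar\mu\subset\mu$ with $|\bar\mu|=\gamma$ and rational functions $q_{\beta_j,\alpha}(\bar\mu)\in\mathbb Q(\bar\mu)$ for $j=1,\dots,r$ and $|\alpha|<r$, such that the (rational) map $\Phi:\mathbb C^\gamma\to\mathrm{Hilb}_B$ defined by $$\Phi:\ \bar\mu\mapsto\big(q_{\beta_j,\alpha}(\bar\mu)\big)_{j=1,\dots,r,\ |\alpha|<r}$$ (a point of $\mathrm{Hilb}_B$ being given by its affine coordinates $\mu_{\beta_j,\alpha}$) parametrizes a dense subset of $\mathrm{Hilb}^{reg}_{\mathbf h}$.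
   Context: Let $\mathbf x=(x_1,\dots,x_n)$, $\mathfrak m=(x_1,\dots,x_n)$, $\mathbf d=(d_1,\dots,d_n)$, and $e_1,\dots,e_n$ the standard basis of $\mathbb N^n$. $\mathbb C[\mathbf x]_t$, $\mathbb C[\mathbf d]_t$ denote polynomials of degree $\le t$. Elements of $\mathbb C[\mathbf d]$ act as functionals on $\mathbb C[\mathbf x]$ by $\mathbf d^\beta(p)=\partial^{|\beta|}p/\partial\mathbf x^\beta(0)$. For $\mathcal D\subset\mathbb C[\mathbf d]$, $\mathcal D^\perp=\{p\in\mathbb C[\mathbf x]:\Lambda(p)=0\ \forall\Lambda\in\mathcal D\}$ and $\mathcal D_t=\mathcal D\cap\mathbb C[\mathbf d]_t$. The monomials of $B$ are ordered by increasing degree, $\beta_1=0$, $E=\{\beta_1,\dots,\beta_r\}$. Closed under division: $\beta\in E$ with $k$-th entry positive implies $\beta-e_k\in E$. $B_t$ (resp. $B_{[t]}$): monomials of $B$ of degree $\le t$ (resp. $=t$); $r_t=|B_t|$, $h_t=|B_{[t]}|$, $o=\deg B$, $\mathbf h=(h_0,\dots,h_o)$, $\mathbf h_t=(h_0,\dots,h_t)$. $\mathrm{Gr}_m(V)$ is the Grassmannian of $m$-dimensional subspaces of $V$. $\mathrm{Hilb}_m\subset\mathrm{Gr}_m(\mathbb C[\mathbf d]_{m-1})$ is the set of $\mathcal D$ stable under all derivations $\partial_{d_k}$. $\mathrm{Hilb}_{B_t}$ is the set of $\mathcal D\in\mathrm{Hilb}_{r_t}$ such that $B_s$ is a basis of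 $\mathbb C[\mathbf x]/(\mathcal D^\perp+\mathfrak m^{s+1})$ for $s=0,\dots,t$; $\mathrm{Hilb}_B:=\mathrm{Hilb}_{B_o}$. For $\mathcal D\in\mathrm{Hilb}_B$ let $\Lambda_1,\dots,\Lambda_r$ be the basis of $\mathcal D$ dual to $B$ (i.e. $\Lambda_i(\mathbf x^{\beta_j})=\delta_{ij}$), $\Lambda_i=\sum_{|\alpha|<r}\mu_{\beta_i,\alpha}\mathbf d^\alpha/\alpha!$; the $\mu_{\beta_i,\alpha}$ are the affine coordinates of $\mathcal D$ in $\mathrm{Hilb}_B$ (and similarly for $B_t$); by convention $\mu_{\beta_i,\beta_j+e_k}=0$ if $|\beta_j|\ge|\beta_i|$. $H_t(\mathcal D_{t-1})$, for $\mathcal D_{t-1}\in\mathrm{Hilb}_{B_{t-1}}$ with coordinates $\mu_{\beta_i,\alpha}$, is the coefficient matrix of the homogeneous linear system in the variables $\nu_j^k$ ($1\le j\le r_{t-1}$, $1\le k\le n$): (1) $\sum_{j:|\beta_s|<|\beta_j|<t}\big(\nu_j^k\mu_{\beta_j,\beta_s+e_l}-\nu_j^l\mu_{\beta_j,\beta_s+e_k}\big)=0$ for $1\le s\le r_{t-1}$, $1\le k<l\le n$; (2) $\nu_j^k=0$ if $\beta_j+e_k=\beta_l$ for some $1\le l\le r_{t-1}$. The varieties $\mathrm{Hilb}^{reg}_{\mathbf h_t}$ are defined inductively: $\mathrm{Hilb}^{reg}_{\mathbf h_0}=\{\mathrm{span}(1)\}$. Let $W_t$ be the set of pairs $(\mathcal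 D_{t-1},\mathcal E_t)$ with $\mathcal E_t\in\mathrm{Gr}_{r_t}(\mathbb C[\mathbf d]_t)$, $\mathcal D_{t-1}\subset\mathcal E_t$, $\partial_{d_k}\mathcal E_t\subset\mathcal D_{t-1}$ for all $k$. There is a dense open subset of the irreducible variety $\mathrm{Hilb}^{reg}_{\mathbf h_{t-1}}$ on which the space $\{\Lambda\in\mathbb C[\mathbf d]_t:\partial_{d_k}\Lambda\in\mathcal D_{t-1}\ \forall k\}$ has minimal dimension; $W_{t,reg}$ is the irreducible component of $W_t$ mapping onto $\mathrm{Hilb}^{reg}_{\mathbf h_{t-1}}$, i.e. the Zariski closure of the part of $W_t$ lying over this open subset, and $\mathrm{Hilb}^{reg}_{\mathbf h_t}$ is the projection of $W_{t,reg}$ to $\mathrm{Gr}_{r_t}(\mathbb C[\mathbf d]_t)$. $\mathrm{Hilb}^{reg}_{\mathbf h}:=\mathrm{Hilb}^{reg}_{\mathbf h_o}$. Let $\rho_t$ be the generic (maximal) rank of $H_t(\mathcal D_{t-1})$ for $\mathcal D_{t-1}\in\mathrm{Hilb}^{reg}_{\mathbf h_{t-1}}\cap\mathrm{Hilb}_{B_{t-1}}$. $\mathcal D_t$ is regular for $B_t$ if $\dim\mathcal D_t=r_t$, $\mathrm{rank}\,H_t(\mathcal D_{t-1})=\rho_t$, and $\mathcal D_t\in\mathrm{Hilb}_{B_t}$ (i.e. the relevant Plücker coordinates of $\mathcal D_t$ at the monomials of $B$ in each degree do not vanish). Let $U_t$ be the set of $\mathcal D_t\in\mathrm{Hilb}^{reg}_{\mathbf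 h_t}$ that are regular for $B_t$ (open in $\mathrm{Hilb}^{reg}_{\mathbf h_t}$). $B$ is a regular basis if $U_t\ne\emptyset$ (equivalently $\overline{U_t}=\mathrm{Hilb}^{reg}_{\mathbf h_t}$) for $t=1,\dots,o$. $\gamma=\sum_{t=0}^o\gamma_{[t]}$, where $\gamma_{[0]}=0$ and, for $t\ge1$, $\gamma_{[t]}=\dim\mathrm{Gr}_{h_t}(\ker H_t(\mathcal D_{t-1}))$ for generic $\mathcal D_{t-1}\in U_{t-1}$ (with $\mathrm{rank}\,H_t(\mathcal D_{t-1})=\rho_t$; $U_0=\mathrm{Hilb}^{reg}_{\mathbf h_0}$). *)

theory Defs
  imports
    "HOL-Library.Poly_Mapping"
    "HOL-Analysis.Abstract_Topology"
    "Jordan_Normal_Form.Determinant"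
begin

section \<open>Polynomials\<close>

type_synonym 'n expo = "'n \<Rightarrow>\<^sub>0 nat"

type_synonym ('v, 'a) mpol = "'v expo \<Rightarrow>\<^sub>0 'a"

text \<open>
  The \<open>n\<close> variables are indexed by a finite linearly ordered type \<^typ>\<open>'n\<close>. Both rings
  \<open>\<complex>[x]\<close> and \<open>\<complex>[d]\<close> are represented by the type \<^typ>\<open>('n, complex) mpol\<close>.
\<close>

abbreviation lookup where "lookup \<equiv> Poly_Mapping.lookup"
abbreviation keys where "keys \<equiv> Poly_Mapping.keys"

abbreviation unit_expo :: "'n \<Rightarrow> 'n expo"
  where "unit_expo k \<equiv> Poly_Mapping.single k 1"

definition mdeg :: "'v expo \<Rightarrow> nat"
  where "mdeg \<alpha> = (\<Sum>k\<in>keys \<alpha>. lookup \<alpha> k)"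

definition mfact :: "'v expo \<Rightarrow> nat"
  where "mfact \<alpha> = (\<Prod>k\<in>keys \<alpha>. fact (lookup \<alpha> k))"

definition mvars :: "('v, 'a::zero) mpol \<Rightarrow> 'v set"
  where "mvars p = (\<Union>\<alpha>\<in>keys p. keys \<alpha>)"

definition meval :: "('v \<Rightarrow> 'a) \<Rightarrow> ('v, 'a::comm_semiring_1) mpol \<Rightarrow> 'a"
  where "meval c p = (\<Sum>\<alpha>\<in>keys p. lookup p \<alpha> * (\<Prod>v\<in>keys \<alpha>. c v ^ lookup \<alpha> v))"

definition monomial :: "'v expo \<Rightarrow> ('v, complex) mpol"
  where "monomial \<alpha> = Poly_Mapping.single \<alpha> 1"

definition polys_le :: "nat \<Rightarrow> ('v, complex) mpol set"
  where "polys_le t = {p. \<forall>\<alpha>\<in>keys p. mdeg \<alpha> \<le> t}"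

definition pdiff :: "'v \<Rightarrow> ('v, complex) mpol \<Rightarrow> ('v, complex) mpol"
  where "pdiff k p =
    (\<Sum>\<alpha>\<in>keys p. Poly_Mapping.single (\<alpha> - unit_expo k) (lookup p \<alpha> * of_nat (lookup \<alpha> k)))"

definition pdiffs :: "('n::{finite,linorder}) expo \<Rightarrow> ('n, complex) mpol \<Rightarrow> ('n, complex) mpol"
  where "pdiffs \<beta> p = fold (\<lambda>k. pdiff k ^^ lookup \<beta> k) (sorted_list_of_set UNIV) p"

text \<open>The action of \<open>\<complex>[d]\<close> on \<open>\<complex>[x]\<close>: \<open>d\<^sup>\<beta>\<close> sends \<open>p\<close> to the value of
  \<open>\<partial>\<^sup>\<beta> p\<close> at the origin.\<close>

definition dual_apply :: "('n::{finite,linorder}, complex) mpol \<Rightarrow> ('n, complex) mpol \<Rightarrow> complex"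
  where "dual_apply \<Lambda> p = (\<Sum>\<beta>\<in>keys \<Lambda>. lookup \<Lambda> \<beta> * meval (\<lambda>_. 0) (pdiffs \<beta> p))"

definition perp :: "('n::{finite,linorder}, complex) mpol set \<Rightarrow> ('n, complex) mpol set"
  where "perp D = {p. \<forall>\<Lambda>\<in>D. dual_apply \<Lambda> p = 0}"


section \<open>Linear algebra and ideals\<close>

definition pscale :: "complex \<Rightarrow> ('a \<Rightarrow>\<^sub>0 complex) \<Rightarrow> ('a \<Rightarrow>\<^sub>0 complex)"
  where "pscale c p = Poly_Mapping.map ((*) c) p"

lemma lookup_pscale: "lookup (pscale c p) a = c * lookup p a"
  by (simp add: pscale_def Poly_Mapping.map.rep_eq when_def)

global_interpretation pm: vector_space "pscale :: complex \<Rightarrow> ('a \<Rightarrow>\<^sub>0 complex) \<Rightarrow> ('a \<Rightarrow>\<^sub>0 complex)"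
  by unfold_locales (auto intro!: poly_mapping_eqI simp: lookup_pscale lookup_add algebra_simps)

text \<open>\<open>A\<close> is a basis of the quotient of the whole space by \<open>W\<close>: every class is a linear
  combination of the classes of \<open>A\<close> with unique coefficients.\<close>

definition quotient_basis :: "('a \<Rightarrow>\<^sub>0 complex) set \<Rightarrow> ('a \<Rightarrow>\<^sub>0 complex) set \<Rightarrow> bool"
  where "quotient_basis A W \<longleftrightarrow>
    (\<forall>p. \<exists>!c. (\<forall>b. b \<notin> A \<longrightarrow> c b = 0) \<and> p - (\<Sum>b\<in>A. pscale (c b) b) \<in> W)"

definition ideal_gen :: "('v, complex) mpol set \<Rightarrow> ('v, complex) mpol set"
  where "ideal_gen S = module.span (*) S"

definition max_ideal :: "('v, complex) mpol set"
  where "max_ideal = ideal_gen (range (\<lambda>k. monomial (unit_expo k)))"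

primrec max_ideal_power :: "nat \<Rightarrow> ('v, complex) mpol set"
  where
    "max_ideal_power 0 = UNIV"
  | "max_ideal_power (Suc s) = ideal_gen {a * b | a b. a \<in> max_ideal \<and> b \<in> max_ideal_power s}"


section \<open>Grassmannians and their Zariski topology\<close>

definition Grass :: "nat \<Rightarrow> ('a \<Rightarrow>\<^sub>0 complex) set \<Rightarrow> ('a \<Rightarrow>\<^sub>0 complex) set set"
  where "Grass m V = {D. pm.subspace D \<and> D \<subseteq> V \<and> pm.dim D = m}"

text \<open>The dimension of the variety \<open>Grass m V\<close>, which is covered by affine charts isomorphic to
  the space of \<open>m \<times> (dim V - m)\<close> matrices.\<close>

definition Grass_dim :: "nat \<Rightarrow> ('a \<Rightarrow>\<^sub>0 complex) set \<Rightarrow> nat"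
  where "Grass_dim m V = m * (pm.dim V - m)"

definition basis_list :: "('a \<Rightarrow>\<^sub>0 complex) set \<Rightarrow> ('a \<Rightarrow>\<^sub>0 complex) list \<Rightarrow> bool"
  where "basis_list D bs \<longleftrightarrow> distinct bs \<and> pm.independent (set bs) \<and> pm.span (set bs) = D"

definition pluecker :: "('a \<Rightarrow>\<^sub>0 complex) list \<Rightarrow> 'a list \<Rightarrow> complex"
  where "pluecker bs as = det (mat (length bs) (length bs) (\<lambda>(i, j). lookup (bs ! i) (as ! j)))"

definition homogeneous :: "('v, complex) mpol \<Rightarrow> bool"
  where "homogeneous f \<longleftrightarrow> (\<exists>d. \<forall>m\<in>keys f. mdeg m = d)"

definition bihomogeneous :: "('v + 'w, complex) mpol \<Rightarrow> bool"
  where "bihomogeneous f \<longleftrightarrow>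
    (\<exists>d e. \<forall>m\<in>keys f.
       (\<Sum>v\<in>keys m \<inter> range Inl. lookup m v) = d \<and> (\<Sum>v\<in>keys m \<inter> range Inr. lookup m v) = e)"

text \<open>The topologies induced by the Pluecker embeddings: the basic open sets are the
  non-vanishing loci of the homogeneous (on a product: bihomogeneous) polynomials in the Pluecker
  coordinates. By homogeneity non-vanishing does not depend on the bases.\<close>

definition zariski_Grass :: "nat \<Rightarrow> ('a \<Rightarrow>\<^sub>0 complex) set \<Rightarrow> ('a \<Rightarrow>\<^sub>0 complex) set topology"
  where "zariski_Grass m V = topology_generated_by
    {{D \<in> Grass m V. \<exists>bs. basis_list D bs \<and> meval (pluecker bs) f \<noteq> 0} | f.
       homogeneous f \<and> mvars f \<subseteq> {as. length as = m}}"

definition zariski_Grass_prod ::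
    "nat \<Rightarrow> ('a \<Rightarrow>\<^sub>0 complex) set \<Rightarrow> nat \<Rightarrow> ('a \<Rightarrow>\<^sub>0 complex) set
      \<Rightarrow> (('a \<Rightarrow>\<^sub>0 complex) set \<times> ('a \<Rightarrow>\<^sub>0 complex) set) topology"
  where "zariski_Grass_prod m V m' V' = topology_generated_by
    {{(D, D') \<in> Grass m V \<times> Grass m' V'. \<exists>bs bs'. basis_list D bs \<and> basis_list D' bs' \<and>
         meval (case_sum (pluecker bs) (pluecker bs')) f \<noteq> 0} | f.
       bihomogeneous f \<and>
       mvars f \<subseteq> Inl ` {as. length as = m} \<union> Inr ` {as. length as = m'}}"


section \<open>Punctual Hilbert schemes\<close>

text \<open>A monomial set \<open>B\<close> is given by its set \<open>E\<close> of exponents, and the elements of \<open>E\<close>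
  themselves serve as the indices \<open>i\<close> of \<open>\<beta>\<^sub>i\<close>.\<close>

definition closed_under_division :: "'n expo set \<Rightarrow> bool"
  where "closed_under_division E \<longleftrightarrow>
    (\<forall>\<beta>\<in>E. \<forall>k. 0 < lookup \<beta> k \<longrightarrow> \<beta> - unit_expo k \<in> E)"

definition upto_deg :: "'n expo set \<Rightarrow> nat \<Rightarrow> 'n expo set"
  where "upto_deg E t = {\<beta> \<in> E. mdeg \<beta> \<le> t}"

definition hfun :: "'n expo set \<Rightarrow> nat \<Rightarrow> nat"
  where "hfun E t = card {\<beta> \<in> E. mdeg \<beta> = t}"

definition top_deg :: "'n expo set \<Rightarrow> nat"
  where "top_deg E = Max (mdeg ` E)"

definition Hilb :: "nat \<Rightarrow> ('n, complex) mpol set set"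
  where "Hilb m = {D \<in> Grass m (polys_le (m - 1)). \<forall>k. pdiff k ` D \<subseteq> D}"

text \<open>\<open>Hilb_B E t\<close> is \<open>Hilb\<close> with subscript \<open>B\<^sub>t\<close>.\<close>

definition Hilb_B :: "('n::{finite,linorder}) expo set \<Rightarrow> nat \<Rightarrow> ('n, complex) mpol set set"
  where "Hilb_B E t = {D \<in> Hilb (card (upto_deg E t)). \<forall>s\<le>t.
    quotient_basis (monomial ` upto_deg E s)
      {p + q | p q. p \<in> perp D \<and> q \<in> max_ideal_power (Suc s)}}"

definition dual_elem ::
    "('n::{finite,linorder}) expo set \<Rightarrow> ('n, complex) mpol set \<Rightarrow> 'n expo \<Rightarrow> ('n, complex) mpol"
  where "dual_elem E D \<beta> = (THE \<Lambda>. \<Lambda> \<in> D \<and>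
    (\<forall>\<gamma>\<in>E. dual_apply \<Lambda> (monomial \<gamma>) = (if \<gamma> = \<beta> then 1 else 0)))"

text \<open>The affine coordinate \<open>\<mu>\<close> at \<open>(\<beta>, \<alpha>)\<close>: the coefficient of \<open>d\<^sup>\<alpha> / \<alpha>!\<close> in the
  element of the dual basis indexed by \<open>\<beta>\<close>.\<close>

definition mu_coord ::
    "('n::{finite,linorder}) expo set \<Rightarrow> ('n, complex) mpol set \<Rightarrow> 'n expo \<Rightarrow> 'n expo \<Rightarrow> complex"
  where "mu_coord E D \<beta> \<alpha> = of_nat (mfact \<alpha>) * lookup (dual_elem E D \<beta>) \<alpha>"


section \<open>The linear system \<open>H\<^sub>t\<close>\<close>

text \<open>The coefficient matrix is given by its set of rows (repetitions of rows affect neither rank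
  nor kernel); \<open>t\<close> is positive and \<open>D\<close> plays the role of \<open>D\<^sub>t\<^sub>-\<^sub>1\<close>. The column indexed by \<open>(\<beta>\<^sub>j, k)\<close> belongs to the
  variable \<open>\<nu>\<^sub>j\<^sup>k\<close>.\<close>

definition H_cols :: "('n::{finite,linorder}) expo set \<Rightarrow> nat \<Rightarrow> ('n expo \<times> 'n) set"
  where "H_cols E t = upto_deg E (t - 1) \<times> UNIV"

definition H_rows ::
    "('n::{finite,linorder}) expo set \<Rightarrow> nat \<Rightarrow> ('n, complex) mpol set
      \<Rightarrow> ('n expo \<times> 'n \<Rightarrow>\<^sub>0 complex) set"
  where "H_rows E t D = (let F = upto_deg E (t - 1) in
    {\<Sum>\<beta> | \<beta> \<in> F \<and> mdeg \<sigma> < mdeg \<beta> \<and> mdeg \<beta> < t.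
        Poly_Mapping.single (\<beta>, k) (mu_coord F D \<beta> (\<sigma> + unit_expo l))
      - Poly_Mapping.single (\<beta>, l) (mu_coord F D \<beta> (\<sigma> + unit_expo k)) | \<sigma> k l. \<sigma> \<in> F \<and> k < l}
    \<union> {Poly_Mapping.single (\<beta>, k) 1 | \<beta> k. \<beta> \<in> F \<and> \<beta> + unit_expo k \<in> F})"

definition H_rank :: "('n::{finite,linorder}) expo set \<Rightarrow> nat \<Rightarrow> ('n, complex) mpol set \<Rightarrow> nat"
  where "H_rank E t D = pm.dim (H_rows E t D)"

definition H_kernel ::
    "('n::{finite,linorder}) expo set \<Rightarrow> nat \<Rightarrow> ('n, complex) mpol set
      \<Rightarrow> ('n expo \<times> 'n \<Rightarrow>\<^sub>0 complex) set"
  where "H_kernel E t D = {\<nu>. keys \<nu> \<subseteq> H_cols E t \<and>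
    (\<forall>\<rho>\<in>H_rows E t D. (\<Sum>c\<in>H_cols E t. lookup \<rho> c * lookup \<nu> c) = 0)}"


section \<open>Regular components and regular bases\<close>

definition integrals :: "nat \<Rightarrow> ('n, complex) mpol set \<Rightarrow> ('n, complex) mpol set"
  where "integrals t D = {\<Lambda> \<in> polys_le t. \<forall>k. pdiff k \<Lambda> \<in> D}"

definition rsum :: "(nat \<Rightarrow> nat) \<Rightarrow> nat \<Rightarrow> nat"
  where "rsum h t = (\<Sum>s\<le>t. h s)"

definition W_pairs :: "(nat \<Rightarrow> nat) \<Rightarrow> nat \<Rightarrow> (('n, complex) mpol set \<times> ('n, complex) mpol set) set"
  where "W_pairs h t = {(D, D') \<in> Grass (rsum h (t - 1)) (polys_le (t - 1)) \<times> Grass (rsum h t) (polys_le t).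
    D \<subseteq> D' \<and> (\<forall>k. pdiff k ` D' \<subseteq> D)}"

text \<open>The open subset of \<open>X\<close> where the space of integrals of degree at most \<open>t\<close> has minimal
  dimension.\<close>

definition min_locus :: "nat \<Rightarrow> ('n, complex) mpol set set \<Rightarrow> ('n, complex) mpol set set"
  where "min_locus t X =
    {D \<in> X. \<forall>D'\<in>X. pm.dim (integrals t D) \<le> pm.dim (integrals t D')}"

primrec Hilb_reg :: "(nat \<Rightarrow> nat) \<Rightarrow> nat \<Rightarrow> ('n, complex) mpol set set"
  where
    "Hilb_reg h 0 = {pm.span {1}}"
  | "Hilb_reg h (Suc t) = snd `
      (zariski_Grass_prod (rsum h t) (polys_le t) (rsum h (Suc t)) (polys_le (Suc t)) closure_of
        {(D, D') \<in> W_pairs h (Suc t). D \<in> min_locus (Suc t) (Hilb_reg h t)})"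

definition rho_gen :: "('n::{finite,linorder}) expo set \<Rightarrow> nat \<Rightarrow> nat"
  where "rho_gen E t = Max (H_rank E t ` (Hilb_reg (hfun E) (t - 1) \<inter> Hilb_B E (t - 1)))"

definition regular_for :: "('n::{finite,linorder}) expo set \<Rightarrow> nat \<Rightarrow> ('n, complex) mpol set \<Rightarrow> bool"
  where "regular_for E t D \<longleftrightarrow>
    pm.dim D = card (upto_deg E t) \<and>
    H_rank E t (D \<inter> polys_le (t - 1)) = rho_gen E t \<and>
    D \<in> Hilb_B E t"

definition U_reg :: "('n::{finite,linorder}) expo set \<Rightarrow> nat \<Rightarrow> ('n, complex) mpol set set"
  where "U_reg E t = (if t = 0 then Hilb_reg (hfun E) 0
    else {D \<in> Hilb_reg (hfun E) t. regular_for E t D})"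

definition regular_basis :: "('n::{finite,linorder}) expo set \<Rightarrow> bool"
  where "regular_basis E \<longleftrightarrow> (\<forall>t\<in>{1..top_deg E}. U_reg E t \<noteq> {})"

definition gamma_part :: "('n::{finite,linorder}) expo set \<Rightarrow> nat \<Rightarrow> nat"
  where "gamma_part E t = (if t = 0 then 0
    else (THE d. \<exists>D\<in>U_reg E (t - 1). H_rank E t D = rho_gen E t \<and>
      d = Grass_dim (hfun E t) (H_kernel E t D)))"

definition gamma_total :: "('n::{finite,linorder}) expo set \<Rightarrow> nat"
  where "gamma_total E = (\<Sum>t\<le>top_deg E. gamma_part E t)"


section \<open>Rational parametrizations\<close>

text \<open>The coordinates \<open>\<mu>\<close> are represented by their index pairs, so that equal exponents
  \<open>\<beta>\<^sub>j + e\<^sub>k\<close> obtained from different \<open>(j, k)\<close> give the same coordinate.\<close>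

definition mu_index :: "'n expo set \<Rightarrow> ('n expo \<times> 'n expo) set"
  where "mu_index E = {(\<beta>, \<sigma> + unit_expo k) | \<beta> \<sigma> k. \<beta> \<in> E \<and> \<sigma> \<in> E \<and> mdeg \<sigma> < mdeg \<beta>}"

definition rat_eval :: "('v \<Rightarrow> complex) \<Rightarrow> ('v, rat) mpol \<Rightarrow> complex"
  where "rat_eval c f = meval c (Poly_Mapping.map of_rat f)"

end

theory Submission
  imports Defs
begin

text \<open>
  By induction on \<open>t\<close>, the regular component in degree \<open>t\<close> has a rational parametrization with
  dense image by coordinates \<open>\<mu>\<close>. At a generic parameter of degree \<open>t\<close> the space of integrals of
  the parametrized space has the minimal dimension, and it is separated by the exponent \<open>0\<close> and the
  exponents \<open>\<beta> + e\<^sub>k\<close> with \<open>\<beta>\<close> in \<open>upto_deg E t\<close>. Since \<open>E\<close> is a regular basis, the exponents in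
  \<open>upto_deg E (t + 1)\<close> are independent there, so they extend to a set \<open>A\<close> of coordinates on the
  space of integrals. By Cramer's rule an integral depends rationally on its values at \<open>A\<close>, and a
  space dual to \<open>upto_deg E (t + 1)\<close> is given by the free values of its top dual basis elements at
  \<open>A - upto_deg E (t + 1)\<close>. These are the new parameters, and they are counted by the dimension of
  a Grassmannian of the kernel of \<open>H\<close>.

  Density is tested by polynomials in the entries of a basis instead of polynomials in the
  Pluecker coordinates. This makes it possible to deform a pair in the incidence variety \<open>W\<close>:
  where the space of integrals has constant dimension, its elements extend to polynomial sections,
  and hence a non-vanishing condition on the large space becomes one on the small space.
\<close>

section \<open>Polynomial functions\<close>

text \<open>The obstacle is that \<open>Hilb_reg\<close> is a projection of a closure: its points
  need not come from pairs over \<open>min_locus\<close>, nor lie in the chart given by E, and no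
  irreducibility of it is established beforehand. An affine parameter space takes over that role:
  two polynomial conditions of the form "nonzero" that can each be satisfied can be satisfied
  together. Every genericity requirement is therefore put as the nonvanishing of one polynomial
  function. In \<open>polyfun K V\<close> the set K of constants is the rationals for the formulas
  of the parametrization and \<open>UNIV\<close> for density tests, which involve arbitrary complex
  matrices; V records the parameters involved.

  The count \<gamma> rests on the fact that the space of integrals has dimension r_t + dim ker H. As
  this is also |A|, dim ker H - h_(t+1) equals |A| - r_(t+1), so each of the h_(t+1) new basis
  elements has exactly dim ker H - h_(t+1) free values. These are coordinates \<mu>, because a free
  exponent is some \<sigma> + e_k with |\<sigma>| \<le> t, while the new elements are indexed by
  exponents of degree t + 1.\<close>

inductive_set polyfun :: "complex set \<Rightarrow> 'v set \<Rightarrow> (('v \<Rightarrow> complex) \<Rightarrow> complex) set"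
  for K :: "complex set" and V :: "'v set" where
  const: "a \<in> K \<Longrightarrow> (\<lambda>_. a) \<in> polyfun K V"
| var: "v \<in> V \<Longrightarrow> (\<lambda>c. c v) \<in> polyfun K V"
| add: "F \<in> polyfun K V \<Longrightarrow> G \<in> polyfun K V \<Longrightarrow> (\<lambda>c. F c + G c) \<in> polyfun K V"
| mult: "F \<in> polyfun K V \<Longrightarrow> G \<in> polyfun K V \<Longrightarrow> (\<lambda>c. F c * G c) \<in> polyfun K V"

lemma polyfun_mono: "F \<in> polyfun K V \<Longrightarrow> K \<subseteq> K' \<Longrightarrow> V \<subseteq> V' \<Longrightarrow> F \<in> polyfun K' V'"
  by (induction rule: polyfun.induct) (auto intro: polyfun.intros)

text \<open>Makes values outside V irrelevant: parameters can be added later, and points can be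
  restricted to the parameter set, without changing what was built before.\<close>

lemma polyfun_cong: "F \<in> polyfun K V \<Longrightarrow> (\<And>v. v \<in> V \<Longrightarrow> c v = c' v) \<Longrightarrow> F c = F c'"
  by (induction rule: polyfun.induct) auto

lemma polyfun_compose:
  assumes "F \<in> polyfun K V" "\<And>v. v \<in> V \<Longrightarrow> (\<lambda>c. G c v) \<in> polyfun K W"
  shows "(\<lambda>c. F (G c)) \<in> polyfun K W"
  using assms by (induction rule: polyfun.induct) (auto intro: polyfun.intros)

lemma polyfun_sum:
  assumes "0 \<in> K" "\<And>i. i \<in> S \<Longrightarrow> F i \<in> polyfun K V"
  shows "(\<lambda>c. \<Sum>i\<in>S. F i c) \<in> polyfun K V"
proof (cases "finite S")
  case True
  then show ?thesis using assms(2)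
    by (induction S rule: finite_induct) (auto intro: polyfun.intros assms(1))
qed (auto intro: polyfun.intros assms(1))

lemma polyfun_prod:
  assumes "1 \<in> K" "\<And>i. i \<in> S \<Longrightarrow> F i \<in> polyfun K V"
  shows "(\<lambda>c. \<Prod>i\<in>S. F i c) \<in> polyfun K V"
proof (cases "finite S")
  case True
  then show ?thesis using assms(2)
    by (induction S rule: finite_induct) (auto intro: polyfun.intros assms(1))
qed (auto intro: polyfun.intros assms(1))

lemma polyfun_power:
  assumes "1 \<in> K" "F \<in> polyfun K V"
  shows "(\<lambda>c. F c ^ n) \<in> polyfun K V"
  using assms by (induction n) (auto intro: polyfun.intros)

lemma polyfun_uminus:
  assumes "-1 \<in> K" "F \<in> polyfun K V"
  shows "(\<lambda>c. - F c) \<in> polyfun K V"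
  using polyfun.mult[OF polyfun.const[OF assms(1)] assms(2)] by simp

lemma polyfun_cmult:
  assumes "a \<in> K" "F \<in> polyfun K V"
  shows "(\<lambda>c. a * F c) \<in> polyfun K V"
  by (rule polyfun.mult[OF polyfun.const[OF assms(1)] assms(2)])

text \<open>The Leibniz formula involves no division, only signs, so 0, 1 and -1 are all the
  constants that K has to supply.\<close>

lemma polyfun_det:
  assumes K: "0 \<in> K" "1 \<in> K" "-1 \<in> K"
    and M: "\<And>i j. i < n \<Longrightarrow> j < n \<Longrightarrow> M i j \<in> polyfun K V"
  shows "(\<lambda>c. det (mat n n (\<lambda>(i, j). M i j c))) \<in> polyfun K V"
proof -
  have lt: "p i < n" if "p permutes {0..<n}" "i < n" for p i
    using permutes_in_image[OF that(1), of i] that(2) by simp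
  have eq: "det (mat n n (\<lambda>(i, j). M i j c)) =
      (\<Sum>p\<in>{p. p permutes {0..<n}}. signof p * (\<Prod>i = 0..<n. M i (p i) c))" for c
    unfolding det_def by (auto simp: lt intro!: sum.cong prod.cong)
  have sg: "signof p \<in> K" for p :: "nat \<Rightarrow> nat"
    using K by (auto simp: sign_def)
  show ?thesis
    unfolding eq
    by (intro polyfun_sum polyfun.mult polyfun_prod K M polyfun.const sg) (auto simp: lt)
qed

lemma polyfun_poly_line:
  assumes "F \<in> polyfun K V"
  shows "\<exists>p. \<forall>s. poly p s = F (\<lambda>v. poly (q v) s)"
  using assms
proof (induction rule: polyfun.induct)
  case (const a)
  then show ?case by (intro exI[of _ "[:a:]"]) auto
next
  case (var v)
  then show ?case by (intro exI[of _ "q v"]) auto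
next
  case (add F G)
  then obtain p r where "\<forall>s. poly p s = F (\<lambda>v. poly (q v) s)" "\<forall>s. poly r s = G (\<lambda>v. poly (q v) s)"
    by auto
  then show ?case by (intro exI[of _ "p + r"]) auto
next
  case (mult F G)
  then obtain p r where "\<forall>s. poly p s = F (\<lambda>v. poly (q v) s)" "\<forall>s. poly r s = G (\<lambda>v. poly (q v) s)"
    by auto
  then show ?case by (intro exI[of _ "p * r"]) auto
qed

lemma poly_nonzero_common:
  fixes p q :: "complex poly"
  assumes "poly p a \<noteq> 0" "poly q b \<noteq> 0"
  shows "\<exists>s. poly p s \<noteq> 0 \<and> poly q s \<noteq> 0"
proof -
  have "p * q \<noteq> 0" using assms by auto
  then have "finite {s. poly (p * q) s = 0}" by (rule poly_roots_finite)
  then obtain s where "s \<notin> {s. poly (p * q) s = 0}"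
    using ex_new_if_finite[OF infinite_UNIV_char_0] by blast
  then show ?thesis by (intro exI[of _ s]) auto
qed

text \<open>Affine space is irreducible: restrict both functions to the line through the two points.\<close>

lemma polyfun_nonzero_line:
  fixes c1 c2 :: "'v \<Rightarrow> complex"
  assumes "F \<in> polyfun K V" "G \<in> polyfun K V" "F c1 \<noteq> 0" "G c2 \<noteq> 0"
  shows "\<exists>s. F (\<lambda>v. c1 v + s * (c2 v - c1 v)) \<noteq> 0 \<and> G (\<lambda>v. c1 v + s * (c2 v - c1 v)) \<noteq> 0"
proof -
  define q where "q v = [:c1 v, c2 v - c1 v:]" for v
  have q: "(\<lambda>v. poly (q v) s) = (\<lambda>v. c1 v + s * (c2 v - c1 v))" for s
    by (auto simp: q_def)
  obtain p where p: "\<forall>s. poly p s = F (\<lambda>v. poly (q v) s)"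
    using polyfun_poly_line[OF assms(1)] by blast
  obtain r where r: "\<forall>s. poly r s = G (\<lambda>v. poly (q v) s)"
    using polyfun_poly_line[OF assms(2)] by blast
  have "poly p 0 \<noteq> 0" "poly r 1 \<noteq> 0"
    unfolding p[rule_format] r[rule_format] q using assms by auto
  from poly_nonzero_common[OF this] show ?thesis
    unfolding p[rule_format] r[rule_format] q .
qed

lemma polyfun_nonzero_common:
  assumes "F \<in> polyfun K V" "G \<in> polyfun K V" "F c1 \<noteq> 0" "G c2 \<noteq> 0"
  shows "\<exists>c. F c \<noteq> 0 \<and> G c \<noteq> 0"
proof -
  have "\<exists>s. F (\<lambda>v. c1 v + s * (c2 v - c1 v)) \<noteq> 0 \<and> G (\<lambda>v. c1 v + s * (c2 v - c1 v)) \<noteq> 0"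
    by (rule polyfun_nonzero_line) (fact assms)+
  then show ?thesis
    by (elim exE) (rule exI, assumption)
qed


subsection \<open>Formal polynomials\<close>

definition mono_eval :: "('v \<Rightarrow> 'a::comm_semiring_1) \<Rightarrow> 'v expo \<Rightarrow> 'a"
  where "mono_eval c \<alpha> = (\<Prod>v\<in>keys \<alpha>. c v ^ lookup \<alpha> v)"

text \<open>Common form of \<open>meval\<close> (h = \<open>id\<close>) and \<open>rat_eval\<close>
  (h = \<open>of_rat\<close>), so that the passage from polynomial functions to formal polynomials
  is carried out once for both.\<close>

definition hom_eval :: "('b \<Rightarrow> 'a) \<Rightarrow> ('v \<Rightarrow> 'a) \<Rightarrow> ('v, 'b::zero) mpol \<Rightarrow> 'a::comm_semiring_1"
  where "hom_eval h c p = (\<Sum>\<alpha>\<in>keys p. h (lookup p \<alpha>) * mono_eval c \<alpha>)"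

lemma meval_hom_eval: "meval c p = hom_eval id c p"
  by (simp add: meval_def hom_eval_def mono_eval_def)

lemma mono_eval_superset:
  assumes "finite S" "keys \<alpha> \<subseteq> S"
  shows "mono_eval c \<alpha> = (\<Prod>v\<in>S. c v ^ lookup \<alpha> v)"
  unfolding mono_eval_def using assms
  by (intro prod.mono_neutral_left) (auto simp: in_keys_iff)

lemma mono_eval_add: "mono_eval c (\<alpha> + \<beta>) = mono_eval c \<alpha> * mono_eval c \<beta>"
proof -
  have "mono_eval c (\<alpha> + \<beta>) = (\<Prod>v\<in>keys \<alpha> \<union> keys \<beta>. c v ^ lookup (\<alpha> + \<beta>) v)"
    by (rule mono_eval_superset) (use keys_add[of \<alpha> \<beta>] in auto)
  also have "\<dots> = (\<Prod>v\<in>keys \<alpha> \<union> keys \<beta>. c v ^ lookup \<alpha> v) * (\<Prod>v\<in>keys \<alpha> \<union> keys \<beta>. c v ^ lookup \<beta> v)"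
    by (simp add: lookup_add power_add prod.distrib)
  finally show ?thesis
    by (simp add: mono_eval_superset[of "keys \<alpha> \<union> keys \<beta>"])
qed

lemma mono_eval_0 [simp]: "mono_eval c 0 = 1"
  by (simp add: mono_eval_def)

lemma hom_eval_superset:
  assumes "h 0 = 0" "finite S" "keys p \<subseteq> S"
  shows "hom_eval h c p = (\<Sum>\<alpha>\<in>S. h (lookup p \<alpha>) * mono_eval c \<alpha>)"
  unfolding hom_eval_def using assms
  by (intro sum.mono_neutral_left) (auto simp: in_keys_iff)

lemma hom_eval_add:
  assumes "h 0 = 0" "\<And>a b. h (a + b) = h a + h b"
  shows "hom_eval h c (p + q) = hom_eval h c p + hom_eval h c q"
proof -
  let ?S = "keys p \<union> keys q"
  have "hom_eval h c (p + q) = (\<Sum>\<alpha>\<in>?S. h (lookup (p + q) \<alpha>) * mono_eval c \<alpha>)"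
    by (rule hom_eval_superset) (use assms keys_add[of p q] in auto)
  then show ?thesis
    by (simp add: hom_eval_superset[where h = h, OF assms(1), of ?S] lookup_add assms(2) distrib_right sum.distrib)
qed

lemma hom_eval_0 [simp]: "hom_eval h c 0 = 0"
  by (simp add: hom_eval_def)

lemma hom_eval_sum:
  assumes "h 0 = 0" "\<And>a b. h (a + b) = h a + h b"
  shows "hom_eval h c (\<Sum>i\<in>S. p i) = (\<Sum>i\<in>S. hom_eval h c (p i))"
proof (cases "finite S")
  case True
  then show ?thesis
    by (induction S rule: finite_induct) (auto simp: hom_eval_add[where h = h, OF assms])
qed simp

lemma hom_eval_single:
  assumes "h 0 = 0"
  shows "hom_eval h c (Poly_Mapping.single \<alpha> a) = h a * mono_eval c \<alpha>"
  using assms by (simp add: hom_eval_def)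

lemma poly_mapping_sum_singles: "p = (\<Sum>\<alpha>\<in>keys p. Poly_Mapping.single \<alpha> (lookup p \<alpha>))"
  by (rule poly_mapping_eqI) (auto simp: lookup_sum lookup_single when_def in_keys_iff)

lemma hom_eval_mult:
  assumes h: "h 0 = 0" "\<And>a b. h (a + b) = h a + h b" "\<And>a b. h (a * b) = h a * h b"
  shows "hom_eval h c (p * q) = hom_eval h c p * hom_eval h c (q :: ('v, 'b::comm_semiring_1) mpol)"
proof -
  have "p * q = (\<Sum>\<alpha>\<in>keys p. \<Sum>\<beta>\<in>keys q.
      Poly_Mapping.single (\<alpha> + \<beta>) (lookup p \<alpha> * lookup q \<beta>))"
    by (subst poly_mapping_sum_singles[of p], subst poly_mapping_sum_singles[of q])
       (simp add: sum_product mult_single)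
  then have "hom_eval h c (p * q) = (\<Sum>\<alpha>\<in>keys p. \<Sum>\<beta>\<in>keys q.
      h (lookup p \<alpha>) * mono_eval c \<alpha> * (h (lookup q \<beta>) * mono_eval c \<beta>))"
    by (simp add: hom_eval_sum[where h = h, OF h(1,2)] hom_eval_single[where h = h] h mono_eval_add ac_simps)
  then show ?thesis by (simp add: hom_eval_def sum_product)
qed

lemma mvars_add: "mvars (p + q) \<subseteq> mvars p \<union> mvars q"
  using keys_add[of p q] by (auto simp: mvars_def)

lemma mvars_mult: "mvars (p * q) \<subseteq> mvars p \<union> mvars (q :: ('v, 'b::comm_semiring_1) mpol)"
proof
  fix v assume "v \<in> mvars (p * q)"
  then obtain \<alpha> \<beta> where "\<alpha> \<in> keys p" "\<beta> \<in> keys q" "v \<in> keys (\<alpha> + \<beta>)"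
    using keys_mult[of p q] by (fastforce simp: mvars_def)
  then show "v \<in> mvars p \<union> mvars q"
    using keys_add[of \<alpha> \<beta>] by (auto simp: mvars_def)
qed

text \<open>Induction over the generation of F. Constants have preimages under h, so the formal
  polynomial gets its coefficients in the source of h; this is how rational numerators and
  denominators arise.\<close>

lemma polyfun_hom_eval:
  assumes h: "h 0 = 0" "h 1 = 1" "\<And>a b. h (a + b) = h a + h b" "\<And>a b. h (a * b) = h a * h b"
    and F: "F \<in> polyfun (range h) V"
  shows "\<exists>f :: ('v, 'b::comm_semiring_1) mpol. mvars f \<subseteq> V \<and> (\<forall>c. hom_eval h c f = F c)"
  using F
proof (induction rule: polyfun.induct)
  case (const a)
  then obtain b where "a = h b" by auto
  then show ?case
    by (intro exI[of _ "Poly_Mapping.single 0 b"]) (auto simp: mvars_def hom_eval_single h)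
next
  case (var v)
  then show ?case
    by (intro exI[of _ "Poly_Mapping.single (Poly_Mapping.single v 1) 1"])
       (auto simp: mvars_def hom_eval_single[where h = h] h mono_eval_def)
next
  case (add F G)
  then obtain f g where "mvars f \<subseteq> V" "\<forall>c. hom_eval h c f = F c" "mvars g \<subseteq> V" "\<forall>c. hom_eval h c g = G c"
    by auto
  then show ?case
    by (intro exI[of _ "f + g"]) (use mvars_add[of f g] in \<open>auto simp: hom_eval_add h\<close>)
next
  case (mult F G)
  then obtain f g where "mvars f \<subseteq> V" "\<forall>c. hom_eval h c f = F c" "mvars g \<subseteq> V" "\<forall>c. hom_eval h c g = G c"
    by auto
  then show ?case
    by (intro exI[of _ "f * g"]) (use mvars_mult[of f g] in \<open>auto simp: hom_eval_mult h\<close>)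
qed

lemma rat_eval_hom_eval: "rat_eval c f = hom_eval of_rat c f"
proof -
  have l: "lookup (Poly_Mapping.map of_rat f) \<alpha> = (of_rat (lookup f \<alpha>) :: complex)" for \<alpha>
    by (simp add: Poly_Mapping.map.rep_eq when_def)
  then have "keys (Poly_Mapping.map of_rat f :: (_, complex) mpol) = keys f"
    by (auto simp: in_keys_iff)
  then show ?thesis by (simp add: rat_eval_def meval_hom_eval hom_eval_def l)
qed

lemma polyfun_rat_eval:
  assumes "F \<in> polyfun \<rat> V"
  shows "\<exists>f. mvars f \<subseteq> V \<and> (\<forall>c. rat_eval c f = F c)"
  using polyfun_hom_eval[of of_rat F V] assms
  by (auto simp: rat_eval_hom_eval Rats_def of_rat_add of_rat_mult)

lemma polyfun_meval:
  assumes "F \<in> polyfun UNIV V"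
  shows "\<exists>f. mvars f \<subseteq> V \<and> (\<forall>c. meval c f = F c)"
  using polyfun_hom_eval[of id F V] assms by (auto simp: meval_hom_eval)

lemma meval_polyfun:
  assumes "mvars f \<subseteq> V"
  shows "(\<lambda>c. meval c f) \<in> polyfun UNIV V"
  unfolding meval_def
  by (intro polyfun_sum polyfun.mult polyfun_prod polyfun_power polyfun.const polyfun.var)
     (use assms in \<open>auto simp: mvars_def\<close>)

section \<open>Homogeneous components and rescaling of the argument\<close>

definition mpol_part :: "nat \<Rightarrow> ('v, complex) mpol \<Rightarrow> ('v, complex) mpol"
  where "mpol_part d f = (\<Sum>\<alpha> | \<alpha> \<in> keys f \<and> mdeg \<alpha> = d. Poly_Mapping.single \<alpha> (lookup f \<alpha>))"

lemma keys_mpol_part: "keys (mpol_part d f) = {\<alpha> \<in> keys f. mdeg \<alpha> = d}"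
  by (auto simp: in_keys_iff mpol_part_def lookup_sum lookup_single when_def split: if_splits)

lemma meval_mpol_part:
  "meval c (mpol_part d f) = (\<Sum>\<alpha> | \<alpha> \<in> keys f \<and> mdeg \<alpha> = d. lookup f \<alpha> * mono_eval c \<alpha>)"
  by (simp add: meval_hom_eval mpol_part_def hom_eval_sum hom_eval_single)

lemma meval_sum_parts: "meval c f = (\<Sum>d\<in>mdeg ` keys f. meval c (mpol_part d f))"
proof -
  have "meval c f = (\<Sum>\<alpha>\<in>keys f. lookup f \<alpha> * mono_eval c \<alpha>)"
    by (simp add: meval_hom_eval hom_eval_def)
  also have "\<dots> = (\<Sum>d\<in>mdeg ` keys f. \<Sum>\<alpha> | \<alpha> \<in> keys f \<and> mdeg \<alpha> = d. lookup f \<alpha> * mono_eval c \<alpha>)"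
    by (rule sum.group[symmetric]) auto
  finally show ?thesis by (simp add: meval_mpol_part)
qed

lemma mono_eval_scale: "mono_eval (\<lambda>v. l * c v) \<alpha> = l ^ mdeg \<alpha> * mono_eval c \<alpha>"
  by (simp add: mono_eval_def power_mult_distrib prod.distrib mdeg_def power_sum)

lemma meval_scale_part: "meval (\<lambda>v. l * c v) (mpol_part d f) = l ^ d * meval c (mpol_part d f)"
  by (simp add: meval_mpol_part mono_eval_scale sum_distrib_left ac_simps)

text \<open>Along the ray through c the function f is a univariate polynomial in l whose coefficient
  at degree d is the value of the d-th component. This leads from a homogeneous polynomial, as
  required for basic open sets, back to the inhomogeneous f.\<close>

lemma meval_nonzero_scale:
  assumes "meval c (mpol_part d f) \<noteq> 0"
  shows "\<exists>l. l \<noteq> 0 \<and> meval (\<lambda>v. l * c v) f \<noteq> 0"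
proof -
  define S where "S = mdeg ` keys f"
  have S: "finite S" by (simp add: S_def)
  have d: "d \<in> S"
  proof (rule ccontr)
    assume "d \<notin> S"
    then have e: "{\<alpha> \<in> keys f. mdeg \<alpha> = d} = {}" unfolding S_def by blast
    show False using assms unfolding meval_mpol_part e by simp
  qed
  define p where "p = (\<Sum>e\<in>S. Polynomial.monom (meval c (mpol_part e f)) e)"
  have "coeff p d = meval c (mpol_part d f)"
    using S d by (simp add: p_def coeff_sum)
  then have "p \<noteq> 0" using assms by auto
  then obtain a where "poly p a \<noteq> 0" using poly_all_0_iff_0 by blast
  \<comment> \<open>The second polynomial is the variable itself; its nonvanishing keeps l away from
    0.\<close>
  moreover have "poly [:0, 1 :: complex:] 1 \<noteq> 0" by simp
  ultimately obtain l where l: "poly p l \<noteq> 0" "poly [:0, 1:] l \<noteq> 0"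
    using poly_nonzero_common by blast
  have "meval (\<lambda>v. l * c v) f = poly p l"
    by (subst meval_sum_parts) (simp add: meval_scale_part p_def poly_sum poly_monom S_def mult.commute)
  then show ?thesis using l by auto
qed

section \<open>Dual families\<close>

definition linfun :: "(('a \<Rightarrow>\<^sub>0 complex) \<Rightarrow> complex) \<Rightarrow> bool"
  where "linfun \<phi> \<longleftrightarrow> (\<forall>x y. \<phi> (x + y) = \<phi> x + \<phi> y) \<and> (\<forall>c x. \<phi> (pscale c x) = c * \<phi> x)"

lemma linfun_add: "linfun \<phi> \<Longrightarrow> \<phi> (x + y) = \<phi> x + \<phi> y"
  and linfun_scale: "linfun \<phi> \<Longrightarrow> \<phi> (pscale c x) = c * \<phi> x"
  by (auto simp: linfun_def)

lemma linfun_zero: "linfun \<phi> \<Longrightarrow> \<phi> 0 = 0"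
  using linfun_add[of \<phi> 0 0] by simp

lemma linfun_uminus: "linfun \<phi> \<Longrightarrow> \<phi> (- x) = - \<phi> x"
  using linfun_add[of \<phi> x "- x"] by (simp add: linfun_zero eq_neg_iff_add_eq_0 add.commute)

lemma linfun_diff: "linfun \<phi> \<Longrightarrow> \<phi> (x - y) = \<phi> x - \<phi> y"
  using linfun_add[of \<phi> x "- y"] by (simp add: linfun_uminus)

lemma linfun_sum: "linfun \<phi> \<Longrightarrow> \<phi> (\<Sum>i\<in>S. f i) = (\<Sum>i\<in>S. \<phi> (f i))"
  by (induction S rule: infinite_finite_induct) (auto simp: linfun_zero linfun_add)

lemma linfun_lookup: "linfun (\<lambda>p. lookup p a)"
  by (simp add: linfun_def lookup_add lookup_pscale)

text \<open>The ambient spaces may be infinite-dimensional, and \<open>pm.dim\<close> is 0 by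
  convention where no finite basis exists. Bounds by the dimension therefore need this
  finiteness.\<close>

definition fin_dim :: "('a \<Rightarrow>\<^sub>0 complex) set \<Rightarrow> bool"
  where "fin_dim D \<longleftrightarrow> (\<exists>S. finite S \<and> D \<subseteq> pm.span S)"

lemma fin_dim_subset: "fin_dim V \<Longrightarrow> D \<subseteq> V \<Longrightarrow> fin_dim D"
  by (auto simp: fin_dim_def)

lemma fin_dim_keys:
  assumes "finite S"
  shows "fin_dim {p. keys p \<subseteq> S}"
proof -
  have "p \<in> pm.span ((\<lambda>a. Poly_Mapping.single a 1) ` S)" if "keys p \<subseteq> S" for p :: "'a \<Rightarrow>\<^sub>0 complex"
  proof -
    have "p = (\<Sum>a\<in>keys p. pscale (lookup p a) (Poly_Mapping.single a 1))"
      by (rule poly_mapping_eqI)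
         (auto simp: lookup_sum lookup_single lookup_pscale when_def in_keys_iff if_distrib cong: if_cong)
    also have "\<dots> \<in> pm.span ((\<lambda>a. Poly_Mapping.single a 1) ` S)"
      using that by (intro pm.span_sum pm.span_scale pm.span_base) auto
    finally show ?thesis .
  qed
  then show ?thesis
    unfolding fin_dim_def using assms by (intro exI[of _ "(\<lambda>a. Poly_Mapping.single a 1) ` S"]) auto
qed

lemma independent_card_le_dim:
  assumes "fin_dim D" "B \<subseteq> D" "pm.independent B"
  shows "finite B \<and> card B \<le> pm.dim D"
proof -
  obtain S where S: "finite S" "D \<subseteq> pm.span S" using assms by (auto simp: fin_dim_def)
  obtain B' where B': "B' \<subseteq> D" "pm.independent B'" "D \<subseteq> pm.span B'" "card B' = pm.dim D"
    using pm.basis_exists by blast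
  have "finite B'" using pm.independent_span_bound[OF S(1) B'(2)] B' S by auto
  from pm.independent_span_bound[OF this assms(3)] show ?thesis
    using assms B' by auto
qed

text \<open>Alone this says that the functionals are independent on D, a property that survives
  enlarging D. Together with \<open>separates\<close> it says that they are linear coordinates on D
  with dual basis u.\<close>

definition dual_fam :: "('i \<Rightarrow> ('a \<Rightarrow>\<^sub>0 complex) \<Rightarrow> complex) \<Rightarrow> ('i \<Rightarrow> ('a \<Rightarrow>\<^sub>0 complex)) \<Rightarrow> 'i set
    \<Rightarrow> ('a \<Rightarrow>\<^sub>0 complex) set \<Rightarrow> bool"
  where "dual_fam \<phi> u I D \<longleftrightarrow> finite I \<and> (\<forall>i\<in>I. linfun (\<phi> i)) \<and> (\<forall>i\<in>I. u i \<in> D) \<and>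
    (\<forall>i\<in>I. \<forall>j\<in>I. \<phi> j (u i) = (if i = j then 1 else 0))"

definition separates :: "('i \<Rightarrow> ('a \<Rightarrow>\<^sub>0 complex) \<Rightarrow> complex) \<Rightarrow> 'i set \<Rightarrow> ('a \<Rightarrow>\<^sub>0 complex) set \<Rightarrow> bool"
  where "separates \<phi> S D \<longleftrightarrow> (\<forall>x\<in>D. (\<forall>i\<in>S. \<phi> i x = 0) \<longrightarrow> x = 0)"

lemma dual_fam_coeff:
  assumes "dual_fam \<phi> u I D" "j \<in> I"
  shows "\<phi> j (\<Sum>i\<in>I. pscale (f i) (u i)) = f j"
proof -
  have "\<phi> j (\<Sum>i\<in>I. pscale (f i) (u i)) = (\<Sum>i\<in>I. f i * \<phi> j (u i))"
    using assms by (simp add: dual_fam_def linfun_sum linfun_scale)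
  also have "\<dots> = (\<Sum>i\<in>I. if i = j then f i else 0)"
    by (rule sum.cong) (use assms in \<open>auto simp: dual_fam_def\<close>)
  finally show ?thesis using assms by (simp add: dual_fam_def)
qed

lemma dual_fam_inj: "dual_fam \<phi> u I D \<Longrightarrow> inj_on u I"
  by (rule inj_onI) (auto simp: dual_fam_def split: if_splits, metis zero_neq_one)

lemma dual_fam_independent:
  assumes "dual_fam \<phi> u I D"
  shows "pm.independent (u ` I)"
proof -
  have fin: "finite (u ` I)" using assms by (auto simp: dual_fam_def)
  show ?thesis
  proof (rule pm.independent_if_scalars_zero[OF fin])
    fix f x assume eq: "(\<Sum>x\<in>u ` I. pscale (f x) x) = 0" and x: "x \<in> u ` I"
    then obtain j where j: "j \<in> I" "x = u j" by auto
    have "(\<Sum>i\<in>I. pscale (f (u i)) (u i)) = 0"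
      using eq by (simp add: sum.reindex[OF dual_fam_inj[OF assms]] o_def)
    with dual_fam_coeff[OF assms j(1), of "\<lambda>i. f (u i)"] show "f x = 0"
      using assms j linfun_zero[of "\<phi> j"] by (auto simp: dual_fam_def)
  qed
qed

lemma dual_fam_card_le:
  assumes "dual_fam \<phi> u I D" "fin_dim D"
  shows "card I \<le> pm.dim D"
  using independent_card_le_dim[OF assms(2) _ dual_fam_independent[OF assms(1)]]
    assms card_image[OF dual_fam_inj[OF assms(1)]] by (auto simp: dual_fam_def)

lemma dual_fam_expand:
  assumes "dual_fam \<phi> u I D" "pm.subspace D" "separates \<phi> I D" "x \<in> D"
  shows "x = (\<Sum>i\<in>I. pscale (\<phi> i x) (u i))"
proof -
  have "x - (\<Sum>i\<in>I. pscale (\<phi> i x) (u i)) \<in> D"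
    using assms by (intro pm.subspace_diff pm.subspace_sum pm.subspace_scale) (auto simp: dual_fam_def)
  moreover have "\<phi> j (x - (\<Sum>i\<in>I. pscale (\<phi> i x) (u i))) = 0" if "j \<in> I" for j
    using dual_fam_coeff[OF assms(1) that, of "\<lambda>i. \<phi> i x"] assms that
    by (simp add: dual_fam_def linfun_diff)
  ultimately have "x - (\<Sum>i\<in>I. pscale (\<phi> i x) (u i)) = 0"
    using assms(3) unfolding separates_def by blast
  then show ?thesis by simp
qed

lemma dual_fam_span:
  assumes "dual_fam \<phi> u I D" "pm.subspace D" "separates \<phi> I D"
  shows "pm.span (u ` I) = D"
proof
  show "pm.span (u ` I) \<subseteq> D"
    by (rule pm.span_minimal) (use assms in \<open>auto simp: dual_fam_def\<close>)
  show "D \<subseteq> pm.span (u ` I)"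
  proof
    fix x assume "x \<in> D"
    from dual_fam_expand[OF assms this] show "x \<in> pm.span (u ` I)"
      by (metis (no_types, lifting) imageI pm.span_base pm.span_scale pm.span_sum)
  qed
qed

lemma dual_fam_dim:
  assumes "dual_fam \<phi> u I D" "pm.subspace D" "separates \<phi> I D"
  shows "pm.dim D = card I"
  using pm.dim_span_eq_card_independent[OF dual_fam_independent[OF assms(1)]]
    dual_fam_span[OF assms] card_image[OF dual_fam_inj[OF assms(1)]] by simp

text \<open>A vector killed by all functionals lies in the span of u, since otherwise adding it
  would give more independent vectors than the dimension allows. Inside the span its coefficients
  are its values, hence 0.\<close>

lemma dual_fam_separates:
  assumes "dual_fam \<phi> u I D" "pm.subspace D" "fin_dim D" "pm.dim D \<le> card I"
  shows "separates \<phi> I D"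
  unfolding separates_def
proof (intro ballI impI)
  fix x assume x: "x \<in> D" "\<forall>i\<in>I. \<phi> i x = 0"
  have ind: "pm.independent (u ` I)" by (rule dual_fam_independent[OF assms(1)])
  have "x \<in> pm.span (u ` I)"
  proof (rule ccontr)
    assume nx: "x \<notin> pm.span (u ` I)"
    then have "pm.independent (insert x (u ` I))" by (rule pm.independent_insertI[OF _ ind])
    moreover have "insert x (u ` I) \<subseteq> D" using x assms by (auto simp: dual_fam_def)
    ultimately have "card (insert x (u ` I)) \<le> pm.dim D" "finite (u ` I)"
      using independent_card_le_dim[OF assms(3), of "insert x (u ` I)"] by auto
    moreover have "x \<notin> u ` I" using nx pm.span_base by blast
    ultimately show False using assms(4) card_image[OF dual_fam_inj[OF assms(1)]] by simp
  qed
  moreover have "finite (u ` I)" using assms by (auto simp: dual_fam_def)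
  ultimately obtain f where "x = (\<Sum>v\<in>u ` I. pscale (f v) v)"
    by (auto simp: pm.span_finite)
  then have e: "x = (\<Sum>i\<in>I. pscale (f (u i)) (u i))"
    by (simp add: sum.reindex[OF dual_fam_inj[OF assms(1)]] o_def)
  have "f (u i) = 0" if "i \<in> I" for i
    using dual_fam_coeff[OF assms(1) that, of "\<lambda>i. f (u i)"] e x that by simp
  then have "(\<Sum>i\<in>I. pscale (f (u i)) (u i)) = 0" by (intro sum.neutral) auto
  with e show "x = 0" by simp
qed

text \<open>An elimination step: w is normalized to be the dual vector of a, and the old vectors are
  corrected by multiples of it, which leaves their values on I unchanged.\<close>

lemma dual_fam_extend_one:
  assumes d: "dual_fam \<phi> u I D" "pm.subspace D" and w: "w \<in> D" "\<forall>i\<in>I. \<phi> i w = 0"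
    and a: "linfun (\<phi> a)" "\<phi> a w \<noteq> 0"
  shows "\<exists>u'. dual_fam \<phi> u' (insert a I) D"
proof -
  define w' where "w' = pscale (1 / \<phi> a w) w"
  have w': "w' \<in> D" "\<phi> a w' = 1" "\<And>i. i \<in> I \<Longrightarrow> \<phi> i w' = 0"
    using assms by (auto simp: w'_def linfun_scale pm.subspace_scale dual_fam_def)
  have aI: "a \<notin> I" using w a by auto
  define u' where "u' i = (if i = a then w' else u i - pscale (\<phi> a (u i)) w')" for i
  have lin: "linfun (\<phi> i)" if "i \<in> insert a I" for i
    using d a that by (auto simp: dual_fam_def)
  have "\<phi> j (u' i) = (if i = j then 1 else 0)" if "i \<in> insert a I" "j \<in> insert a I" for i j
    using that d w' aI by (auto simp: u'_def dual_fam_def linfun_diff[OF lin] linfun_scale[OF lin])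
  moreover have "u' i \<in> D" if "i \<in> insert a I" for i
    using that d w' by (auto simp: u'_def dual_fam_def intro!: pm.subspace_diff pm.subspace_scale)
  ultimately show ?thesis
    using d lin unfolding dual_fam_def by (intro exI[of _ u']) auto
qed

text \<open>Exchange argument for functionals. Cardinalities of dual families are bounded by the
  dimension, so there is a largest one containing I0; if it failed to separate, a vector w that it
  kills would be detected by another functional of S, which could be added.\<close>

lemma dual_fam_extend:
  assumes "pm.subspace D" "fin_dim D" "\<And>i. i \<in> S \<Longrightarrow> linfun (\<phi> i)" "separates \<phi> S D"
    and "dual_fam \<phi> u0 I0 D" "I0 \<subseteq> S"
  shows "\<exists>I u. I0 \<subseteq> I \<and> I \<subseteq> S \<and> dual_fam \<phi> u I D \<and> separates \<phi> I D"
proof -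
  define P where "P I \<longleftrightarrow> I0 \<subseteq> I \<and> I \<subseteq> S \<and> (\<exists>u. dual_fam \<phi> u I D)" for I
  have "P I0" using assms unfolding P_def by blast
  moreover have "\<forall>I. P I \<longrightarrow> card I < Suc (pm.dim D)"
    unfolding P_def less_Suc_eq_le using dual_fam_card_le[OF _ assms(2)] by blast
  ultimately have "\<exists>I. P I \<and> (\<forall>I'. P I' \<longrightarrow> card I' \<le> card I)"
    by (rule Lattices_Big.ex_has_greatest_nat)
  then obtain I where PI: "P I" "\<forall>I'. P I' \<longrightarrow> card I' \<le> card I" by blast
  then have I: "I0 \<subseteq> I" "I \<subseteq> S" "\<exists>u. dual_fam \<phi> u I D" by (auto simp: P_def)
  then obtain u where u: "dual_fam \<phi> u I D" by auto
  have "separates \<phi> I D"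
    unfolding separates_def
  proof (intro ballI impI, rule ccontr)
    fix w assume w: "w \<in> D" "\<forall>i\<in>I. \<phi> i w = 0" "w \<noteq> 0"
    with assms(4) obtain a where a: "a \<in> S" "\<phi> a w \<noteq> 0" by (auto simp: separates_def)
    then have "\<exists>u'. dual_fam \<phi> u' (insert a I) D"
      using dual_fam_extend_one[OF u assms(1) w(1,2) assms(3)] by auto
    then have "P (insert a I)" using I a by (auto simp: P_def)
    then have "card (insert a I) \<le> card I" using PI(2) by blast
    moreover have "a \<notin> I" "finite I" using w a u by (auto simp: dual_fam_def)
    ultimately show False by simp
  qed
  then show ?thesis using I u by blast
qed

lemma dual_fam_exists:
  assumes "pm.subspace D" "fin_dim D" "\<And>i. i \<in> S \<Longrightarrow> linfun (\<phi> i)" "separates \<phi> S D"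
  shows "\<exists>I u. I \<subseteq> S \<and> dual_fam \<phi> u I D \<and> separates \<phi> I D"
  using dual_fam_extend[OF assms, of undefined "{}"] by (auto simp: dual_fam_def)


section \<open>Bases as lists\<close>

definition list_comb :: "(nat \<Rightarrow> nat \<Rightarrow> complex) \<Rightarrow> ('a \<Rightarrow>\<^sub>0 complex) list \<Rightarrow> ('a \<Rightarrow>\<^sub>0 complex) list"
  where "list_comb M bs = map (\<lambda>i. \<Sum>j<length bs. pscale (M i j) (bs ! j)) [0..<length bs]"

text \<open>A one-sided inverse on the indices below n suffices: it recovers the old list
  (\<open>list_comb_left_inv\<close>) and makes both determinants nonzero
  (\<open>left_inv_det\<close>).\<close>

definition left_inv :: "nat \<Rightarrow> (nat \<Rightarrow> nat \<Rightarrow> complex) \<Rightarrow> (nat \<Rightarrow> nat \<Rightarrow> complex) \<Rightarrow> bool"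
  where "left_inv n N M \<longleftrightarrow> (\<forall>i<n. \<forall>k<n. (\<Sum>j<n. N i j * M j k) = (if i = k then 1 else 0))"

definition entries :: "('a \<Rightarrow>\<^sub>0 complex) list \<Rightarrow> nat \<times> 'a \<Rightarrow> complex"
  where "entries bs = (\<lambda>(i, a). lookup (bs ! i) a)"

lemma length_list_comb [simp]: "length (list_comb M bs) = length bs"
  by (simp add: list_comb_def)

lemma nth_list_comb: "i < length bs \<Longrightarrow> list_comb M bs ! i = (\<Sum>j<length bs. pscale (M i j) (bs ! j))"
  by (simp add: list_comb_def)

lemma lookup_list_comb:
  "i < length bs \<Longrightarrow> lookup (list_comb M bs ! i) a = (\<Sum>j<length bs. M i j * lookup (bs ! j) a)"
  by (simp add: nth_list_comb lookup_sum lookup_pscale)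

lemma list_comb_left_inv:
  assumes "left_inv (length bs) N M"
  shows "list_comb N (list_comb M bs) = bs"
proof (rule nth_equalityI)
  fix i assume i: "i < length (list_comb N (list_comb M bs))"
  let ?n = "length bs"
  show "list_comb N (list_comb M bs) ! i = bs ! i"
  proof (rule poly_mapping_eqI)
    fix a
    have "lookup (list_comb N (list_comb M bs) ! i) a
        = (\<Sum>j<?n. N i j * (\<Sum>k<?n. M j k * lookup (bs ! k) a))"
      using i by (simp add: lookup_list_comb)
    also have "\<dots> = (\<Sum>k<?n. (\<Sum>j<?n. N i j * M j k) * lookup (bs ! k) a)"
      unfolding sum_distrib_left sum_distrib_right by (subst sum.swap) (simp add: mult.assoc)
    also have "\<dots> = (\<Sum>k<?n. if i = k then lookup (bs ! k) a else 0)"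
      using assms i by (intro sum.cong) (auto simp: left_inv_def)
    also have "\<dots> = lookup (bs ! i) a" using i by simp
    finally show "lookup (list_comb N (list_comb M bs) ! i) a = lookup (bs ! i) a" .
  qed
qed simp

lemma basis_list_dim: "basis_list D bs \<Longrightarrow> pm.dim D = length bs"
  using pm.dim_span_eq_card_independent[of "set bs"] by (auto simp: basis_list_def distinct_card simp del: pm.dim_span)

lemma basis_list_subspace: "basis_list D bs \<Longrightarrow> pm.subspace D"
  by (auto simp: basis_list_def)

lemma basis_list_fin_dim: "basis_list D bs \<Longrightarrow> fin_dim D"
  by (auto simp: basis_list_def fin_dim_def)

lemma basis_list_in: "basis_list D bs \<Longrightarrow> i < length bs \<Longrightarrow> bs ! i \<in> D"
  unfolding basis_list_def using pm.span_base[of "bs ! i" "set bs"] by auto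

lemma sum_set_nth: "distinct bs \<Longrightarrow> (\<Sum>x\<in>set bs. f x) = (\<Sum>j<length bs. f (bs ! j))"
  by (rule sum.reindex_bij_betw[symmetric]) (auto intro: bij_betw_nth)

lemma span_list:
  assumes "distinct bs" "x \<in> pm.span (set bs)"
  shows "\<exists>f. x = (\<Sum>j<length bs. pscale (f j) (bs ! j))"
proof -
  obtain g where "x = (\<Sum>v\<in>set bs. pscale (g v) v)" using assms by (auto simp: pm.span_finite)
  then show ?thesis
    by (intro exI[of _ "\<lambda>j. g (bs ! j)"]) (simp add: sum_set_nth[OF assms(1)])
qed

lemma basis_list_zero:
  assumes "basis_list D bs" "(\<Sum>j<length bs. pscale (f j) (bs ! j)) = 0" "i < length bs"
  shows "f i = 0"
proof -
  have d: "distinct bs" "pm.independent (set bs)" using assms by (auto simp: basis_list_def)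
  define g where "g = (\<lambda>v. f (THE j. j < length bs \<and> bs ! j = v))"
  have g: "g (bs ! j) = f j" if "j < length bs" for j
  proof -
    have "(THE k. k < length bs \<and> bs ! k = bs ! j) = j"
      by (rule the_equality) (use that d nth_eq_iff_index_eq in auto)
    then show ?thesis by (simp add: g_def)
  qed
  have "(\<Sum>v\<in>set bs. pscale (g v) v) = 0"
    using assms(2) by (simp add: sum_set_nth[OF d(1)] g)
  then have "g (bs ! i) = 0"
    using pm.independentD[OF d(2), of "set bs" g "bs ! i"] assms(3) by simp
  then show ?thesis using g assms(3) by simp
qed

lemma basis_listI_span:
  assumes "pm.span (set bs) = D" "length bs = pm.dim D"
  shows "basis_list D bs"
proof -
  obtain B where B: "B \<subseteq> set bs" "pm.independent B" "set bs \<subseteq> pm.span B"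
    using pm.maximal_independent_subset by blast
  have sp: "pm.span B = D" using B assms
    by (metis pm.span_eq pm.span_mono pm.span_span subset_antisym)
  then have "card B = length bs" using pm.dim_span_eq_card_independent[OF B(2)] assms by simp
  moreover have "card B \<le> card (set bs)" "card (set bs) \<le> length bs"
    using B by (auto intro: card_mono card_length)
  ultimately have "card B = card (set bs)" "distinct bs"
    by (auto intro: card_distinct)
  then have "B = set bs" using B card_subset_eq by blast
  then show ?thesis using B assms \<open>distinct bs\<close> by (auto simp: basis_list_def)
qed

lemma basis_list_list_comb:
  assumes b: "basis_list D bs" and inv: "left_inv (length bs) N M"
  shows "basis_list D (list_comb M bs)"
proof (rule basis_listI_span)
  have sub: "set (list_comb M cs) \<subseteq> pm.span (set cs)" for M and cs :: "('a \<Rightarrow>\<^sub>0 complex) list"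
    unfolding list_comb_def by (auto intro!: pm.span_sum pm.span_scale intro: pm.span_base)
  have "set bs \<subseteq> pm.span (set (list_comb M bs))"
    using sub[of N "list_comb M bs"] list_comb_left_inv[OF inv] by simp
  then show "pm.span (set (list_comb M bs)) = D"
    using sub[of M bs] b unfolding basis_list_def
    by (metis pm.span_minimal pm.subspace_span subset_antisym)
  show "length (list_comb M bs) = pm.dim D" using basis_list_dim[OF b] by simp
qed

lemma basis_list_change:
  assumes b: "basis_list D bs" "basis_list D bs'"
  shows "\<exists>M N. bs' = list_comb M bs \<and> left_inv (length bs) N M"
proof -
  let ?n = "length bs"
  have len: "length bs' = ?n" using basis_list_dim[OF b(1)] basis_list_dim[OF b(2)] by simp
  have "\<exists>f. bs' ! i = (\<Sum>j<length bs. pscale (f j) (bs ! j))" if "i < ?n" for i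
    using basis_list_in[OF b(2)] that len b(1) by (intro span_list) (auto simp: basis_list_def)
  then obtain M where M: "\<And>i. i < ?n \<Longrightarrow> bs' ! i = (\<Sum>j<?n. pscale (M i j) (bs ! j))" by metis
  have "\<exists>f. bs ! i = (\<Sum>j<length bs'. pscale (f j) (bs' ! j))" if "i < ?n" for i
    using basis_list_in[OF b(1)] that b(2) by (intro span_list) (auto simp: basis_list_def)
  then obtain N where N: "\<And>i. i < ?n \<Longrightarrow> bs ! i = (\<Sum>j<?n. pscale (N i j) (bs' ! j))"
    unfolding len by metis
  have "left_inv ?n N M"
    unfolding left_inv_def
  proof (intro allI impI)
    fix i k assume i: "i < ?n" and k: "k < ?n"
    \<comment> \<open>Row i of the product N M minus the unit row. Its combination of the basis
      vanishes, because M leads from bs to bs' and N back, so it is 0 by independence.\<close>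
    define f where "f k = (\<Sum>j<?n. N i j * M j k) - (if i = k then 1 else 0)" for k
    have "(\<Sum>k<?n. pscale (f k) (bs ! k)) = 0"
    proof (rule poly_mapping_eqI)
      fix a
      have "lookup (\<Sum>k<?n. pscale (f k) (bs ! k)) a =
          (\<Sum>k<?n. (\<Sum>j<?n. N i j * M j k) * lookup (bs ! k) a) - (\<Sum>k<?n. if i = k then lookup (bs ! k) a else 0)"
        by (simp add: lookup_sum lookup_pscale f_def left_diff_distrib sum_subtractf if_distrib[where f = "\<lambda>x. x * _"] cong: if_cong)
      also have "(\<Sum>k<?n. (\<Sum>j<?n. N i j * M j k) * lookup (bs ! k) a)
          = (\<Sum>j<?n. N i j * (\<Sum>k<?n. M j k * lookup (bs ! k) a))"
        unfolding sum_distrib_left sum_distrib_right by (subst sum.swap) (simp add: mult.assoc)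
      also have "\<dots> = (\<Sum>j<?n. N i j * lookup (bs' ! j) a)"
        by (simp add: M lookup_sum lookup_pscale)
      also have "\<dots> = lookup (bs ! i) a"
        by (simp add: N[OF i] lookup_sum lookup_pscale)
      finally show "lookup (\<Sum>k<?n. pscale (f k) (bs ! k)) a = lookup 0 a" using i by simp
    qed
    from basis_list_zero[OF b(1) this k] show "(\<Sum>j<?n. N i j * M j k) = (if i = k then 1 else 0)"
      by (simp add: f_def)
  qed
  moreover have "bs' = list_comb M bs"
    by (rule nth_equalityI) (auto simp: len M nth_list_comb)
  ultimately show ?thesis by blast
qed

lemma basis_list_exists:
  assumes "pm.subspace D" "fin_dim D"
  shows "\<exists>bs. basis_list D bs"
proof -
  obtain B where B: "B \<subseteq> D" "pm.independent B" "D \<subseteq> pm.span B" "card B = pm.dim D"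
    using pm.basis_exists[of D] by blast
  have "finite B" using independent_card_le_dim[OF assms(2) B(1,2)] by simp
  then obtain bs where "set bs = B" "distinct bs" using finite_distinct_list by blast
  moreover have "pm.span B = D" using B assms(1) by (simp add: pm.span_minimal subset_antisym)
  ultimately show ?thesis using B by (auto simp: basis_list_def)
qed

lemma basis_list_extend:
  assumes "basis_list D bs" "D \<subseteq> D'" "pm.subspace D'" "fin_dim D'"
  shows "\<exists>ls. basis_list D' (bs @ ls)"
proof -
  have bs: "distinct bs" "pm.independent (set bs)" "set bs \<subseteq> D'"
    using assms(1,2) pm.span_superset[of "set bs"] by (auto simp: basis_list_def)
  obtain B where B: "set bs \<subseteq> B" "B \<subseteq> D'" "pm.independent B" "D' \<subseteq> pm.span B"
    using pm.maximal_independent_subset_extend[OF bs(3,2)] by blast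
  have "finite B" using independent_card_le_dim[OF assms(4) B(2,3)] by simp
  then obtain ls where "set ls = B - set bs" "distinct ls" using finite_distinct_list[of "B - set bs"] by auto
  moreover have "pm.span B = D'" using B assms(3) by (simp add: pm.span_minimal subset_antisym)
  moreover have "set bs \<union> (B - set bs) = B" using B by auto
  ultimately show ?thesis using B bs
    by (intro exI[of _ ls]) (auto simp: basis_list_def Un_absorb1)
qed

lemma basis_list_dual:
  assumes "pm.subspace D" "separates \<phi> (set as) D" "distinct as" "dual_fam \<phi> u (set as) D"
  shows "basis_list D (map u as)"
  using dual_fam_span[OF assms(4,1,2)] dual_fam_independent[OF assms(4)] dual_fam_inj[OF assms(4)] assms(3)
  by (auto simp: basis_list_def distinct_map)

section \<open>Zariski density in Grassmannians\<close>

text \<open>Normal form of a basis in the Pluecker chart of \<open>as\<close>: the columns at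
  \<open>as\<close> form the identity matrix. Plain coefficients are used, since Pluecker
  coordinates are minors of those.\<close>

definition dual_to :: "('a \<Rightarrow>\<^sub>0 complex) list \<Rightarrow> 'a list \<Rightarrow> bool"
  where "dual_to us as \<longleftrightarrow> length as = length us \<and>
    (\<forall>i<length us. \<forall>j<length us. lookup (us ! i) (as ! j) = (if i = j then 1 else 0))"

lemma pluecker_list_comb:
  assumes "length as = length bs"
  shows "pluecker (list_comb M bs) as =
    det (mat (length bs) (length bs) (\<lambda>(i, j). M i j)) * pluecker bs as"
proof -
  let ?n = "length bs"
  let ?B = "mat ?n ?n (\<lambda>(i, j). lookup (bs ! i) (as ! j))" and ?M = "mat ?n ?n (\<lambda>(i, j). M i j)"
  have "mat ?n ?n (\<lambda>(i, j). lookup (list_comb M bs ! i) (as ! j)) = ?M * ?B"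
    by (rule eq_matI) (auto simp: lookup_list_comb scalar_prod_def atLeast0LessThan)
  moreover have "det (?M * ?B) = det ?M * det ?B" by (rule det_mult) auto
  ultimately show ?thesis by (simp add: pluecker_def)
qed

text \<open>Exchanging column j of an identity matrix for another column gives a determinant equal
  to the j-th entry of that column. So all entries of a normalized basis are Pluecker
  coordinates.\<close>

lemma pluecker_dual:
  assumes "dual_to us as" "j < length us"
  shows "pluecker us (as[j := a]) = lookup (us ! j) a"
proof -
  let ?n = "length us"
  let ?v = "vec ?n (\<lambda>i. lookup (us ! i) a)"
  have "mat ?n ?n (\<lambda>(i, k). lookup (us ! i) (as[j := a] ! k)) = replace_col (1\<^sub>m ?n) (1\<^sub>m ?n *\<^sub>v ?v) j"
    by (rule eq_matI) (use assms in \<open>auto simp: replace_col_def dual_to_def nth_list_update\<close>)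
  moreover have "det (replace_col (1\<^sub>m ?n) (1\<^sub>m ?n *\<^sub>v ?v) j) = ?v $ j * det (1\<^sub>m ?n :: complex mat)"
    by (rule cramer_lemma_mat) (use assms in auto)
  ultimately show ?thesis using assms by (simp add: pluecker_def)
qed

lemma pluecker_dual_one:
  assumes "dual_to us as"
  shows "pluecker us as = 1"
proof -
  have "mat (length us) (length us) (\<lambda>(i, j). lookup (us ! i) (as ! j)) = 1\<^sub>m (length us)"
    by (rule eq_matI) (use assms in \<open>auto simp: dual_to_def\<close>)
  then show ?thesis by (simp add: pluecker_def)
qed

lemma left_inv_det:
  assumes "left_inv n N M"
  shows "det (mat n n (\<lambda>(i, j). M i j)) \<noteq> 0" "det (mat n n (\<lambda>(i, j). N i j)) \<noteq> 0"
proof -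
  let ?N = "mat n n (\<lambda>(i, j). N i j)" and ?M = "mat n n (\<lambda>(i, j). M i j)"
  have "?N * ?M = 1\<^sub>m n"
    by (rule eq_matI) (use assms in \<open>auto simp: left_inv_def scalar_prod_def atLeast0LessThan\<close>)
  moreover have "det (?N * ?M) = det ?N * det ?M" by (rule det_mult) auto
  ultimately show "det ?M \<noteq> 0" "det ?N \<noteq> 0" by auto
qed

lemma det_nonzero_inverse:
  fixes A :: "nat \<Rightarrow> nat \<Rightarrow> complex"
  assumes "det (mat n n (\<lambda>(i, j). A i j)) \<noteq> 0"
  shows "\<exists>M. left_inv n A M \<and> left_inv n M A"
proof -
  let ?A = "mat n n (\<lambda>(i, j). A i j)"
  define M where "M i j = adj_mat ?A $$ (i, j) / det ?A" for i j
  note adj = adj_mat[of ?A n, simplified]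
  have "(\<Sum>j<n. A i j * M j k) = (if i = k then 1 else 0)" if "i < n" "k < n" for i k
  proof -
    have "(?A * adj_mat ?A) $$ (i, k) = (\<Sum>j<n. A i j * adj_mat ?A $$ (j, k))"
      using that adj(1) by (auto simp: scalar_prod_def atLeast0LessThan)
    then have "(\<Sum>j<n. A i j * adj_mat ?A $$ (j, k)) = det ?A * (if i = k then 1 else 0)"
      using that by (simp add: adj(2))
    then have "(\<Sum>j<n. A i j * adj_mat ?A $$ (j, k)) / det ?A = (if i = k then 1 else 0)"
      using assms by simp
    then show ?thesis by (simp add: M_def sum_divide_distrib)
  qed
  moreover have "(\<Sum>j<n. M i j * A j k) = (if i = k then 1 else 0)" if "i < n" "k < n" for i k
  proof -
    have "(adj_mat ?A * ?A) $$ (i, k) = (\<Sum>j<n. adj_mat ?A $$ (i, j) * A j k)"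
      using that adj(1) by (auto simp: scalar_prod_def atLeast0LessThan)
    then have "(\<Sum>j<n. adj_mat ?A $$ (i, j) * A j k) = det ?A * (if i = k then 1 else 0)"
      using that by (simp add: adj(3))
    then have "(\<Sum>j<n. adj_mat ?A $$ (i, j) * A j k) / det ?A = (if i = k then 1 else 0)"
      using assms by simp
    then show ?thesis by (simp add: M_def sum_divide_distrib)
  qed
  ultimately show ?thesis unfolding left_inv_def by blast
qed

text \<open>Multiplying by the inverse of the square submatrix at \<open>as\<close> normalizes the
  basis.\<close>

lemma pluecker_nonzero_dual:
  assumes "pluecker bs as \<noteq> 0" "length as = length bs"
  shows "\<exists>M N. left_inv (length bs) N M \<and> dual_to (list_comb M bs) as"
proof -
  let ?n = "length bs"
  define A where "A i j = lookup (bs ! i) (as ! j)" for i j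
  have "det (mat ?n ?n (\<lambda>(i, j). A i j)) \<noteq> 0" using assms by (simp add: pluecker_def A_def)
  then obtain M where M: "left_inv ?n A M" "left_inv ?n M A" using det_nonzero_inverse by blast
  have "dual_to (list_comb M bs) as"
    using M(2) assms(2) by (auto simp: dual_to_def lookup_list_comb left_inv_def A_def)
  with M show ?thesis by blast
qed

text \<open>All coefficient functionals together separate trivially, and finitely many of them are
  coordinates. In other words, every subspace of finite dimension lies in some Pluecker
  chart.\<close>

lemma dual_basis_exists:
  assumes "pm.subspace D" "fin_dim D"
  shows "\<exists>us as. basis_list D us \<and> dual_to us as"
proof -
  define \<phi> :: "'a \<Rightarrow> ('a \<Rightarrow>\<^sub>0 complex) \<Rightarrow> complex" where "\<phi> = (\<lambda>a p. lookup p a)"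
  have "separates \<phi> UNIV D" by (auto simp: separates_def \<phi>_def intro: poly_mapping_eqI)
  then obtain I u where Iu: "dual_fam \<phi> u I D" "separates \<phi> I D"
    using dual_fam_exists[OF assms, of UNIV \<phi>] linfun_lookup by (auto simp: \<phi>_def)
  then have "finite I" by (simp add: dual_fam_def)
  then obtain as where as: "set as = I" "distinct as" using finite_distinct_list by blast
  have "dual_to (map u as) as"
    using Iu(1) as nth_eq_iff_index_eq[OF as(2)] by (auto simp: dual_to_def dual_fam_def \<phi>_def)
  moreover have "basis_list D (map u as)"
    by (rule basis_list_dual[OF assms(1) _ as(2)]) (use Iu as in auto)
  ultimately show ?thesis by blast
qed

lemma entries_list_comb_polyfun:
  "i < n \<Longrightarrow> (\<lambda>c. \<Sum>j<n. M i j * c (j, a)) \<in> polyfun UNIV ({..<n} \<times> UNIV)"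
  by (intro polyfun_sum polyfun_cmult polyfun.var) auto

lemma polyfun_change_basis:
  assumes "F \<in> polyfun UNIV ({..<n} \<times> UNIV)"
  shows "(\<lambda>c. F (\<lambda>(i, a). \<Sum>j<n. M i j * c (j, a))) \<in> polyfun UNIV ({..<n} \<times> UNIV)"
  using assms by (rule polyfun_compose) (auto intro: entries_list_comb_polyfun)

lemma polyfun_entries_list_comb:
  assumes "F \<in> polyfun UNIV ({..<length bs} \<times> UNIV)"
  shows "F (\<lambda>(i, a). \<Sum>j<length bs. M i j * entries bs (j, a)) = F (entries (list_comb M bs))"
  by (rule polyfun_cong[OF assms]) (auto simp: entries_def lookup_list_comb)

lemma Grass_basis_exists:
  assumes "D \<in> Grass m V" "fin_dim V"
  shows "\<exists>bs. basis_list D bs \<and> length bs = m"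
proof -
  have D: "pm.subspace D" "fin_dim D" "pm.dim D = m"
    using assms fin_dim_subset by (auto simp: Grass_def)
  then obtain bs where "basis_list D bs" using basis_list_exists by blast
  then show ?thesis using basis_list_dim D(3) by fastforce
qed

text \<open>The constant polynomial 1 is homogeneous, and its nonvanishing locus is the whole
  Grassmannian, provided that every point has a basis list.\<close>

lemma topspace_zariski_Grass:
  assumes "fin_dim V"
  shows "topspace (zariski_Grass m V) = Grass m V"
proof -
  have "\<exists>f :: ('a list, complex) mpol. homogeneous f \<and> mvars f = {} \<and> (\<forall>c. meval c f = 1)"
    by (intro exI[of _ 1]) (simp add: homogeneous_def mvars_def meval_def)
  then obtain f :: "('a list, complex) mpol" where f: "homogeneous f" "mvars f = {}" "\<forall>c. meval c f = 1"
    by blast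
  show ?thesis
  proof
    show "topspace (zariski_Grass m V) \<subseteq> Grass m V" by (auto simp: zariski_Grass_def)
    show "Grass m V \<subseteq> topspace (zariski_Grass m V)"
    proof
      fix D assume D: "D \<in> Grass m V"
      then obtain bs where "basis_list D bs" using Grass_basis_exists[OF _ assms] by blast
      with D f have "D \<in> {D \<in> Grass m V. \<exists>bs. basis_list D bs \<and> meval (pluecker bs) f \<noteq> 0}" by auto
      moreover have "{D \<in> Grass m V. \<exists>bs. basis_list D bs \<and> meval (pluecker bs) f \<noteq> 0} \<in>
        {{D \<in> Grass m V. \<exists>bs. basis_list D bs \<and> meval (pluecker bs) f \<noteq> 0} | f.
         homogeneous f \<and> mvars f \<subseteq> {as. length as = m}}"
        using f(1,2) by blast
      ultimately show "D \<in> topspace (zariski_Grass m V)"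
        unfolding zariski_Grass_def topology_generated_by_topspace by (rule UnionI[rotated])
    qed
  qed
qed

lemma topspace_zariski_Grass_prod:
  "topspace (zariski_Grass_prod m V m' V') \<subseteq> Grass m V \<times> Grass m' V'"
  by (auto simp: zariski_Grass_prod_def)

text \<open>If \<open>us\<close> is dual to the exponents \<open>as\<close>, then the coefficient of \<open>us ! j\<close> at \<open>a\<close> is the
  Pluecker coordinate at \<open>as[j := a]\<close>. So \<open>F\<close> becomes a polynomial in the Pluecker coordinates, and
  one of its homogeneous components defines the required open set.\<close>

lemma closure_prod_dense:
  assumes cl: "(D0, D0') \<in> zariski_Grass_prod m V m' V' closure_of W"
    and V: "fin_dim V" "fin_dim V'"
    and bs0: "basis_list D0' bs0"
    and F: "F \<in> polyfun UNIV ({..<m'} \<times> UNIV)" "F (entries bs0) \<noteq> 0"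
  shows "\<exists>(D, D')\<in>W. \<exists>bs. basis_list D' bs \<and> F (entries bs) \<noteq> 0"
proof -
  have G0: "D0 \<in> Grass m V" "D0' \<in> Grass m' V'"
    using cl topspace_zariski_Grass_prod[of m V m' V'] unfolding in_closure_of by blast+
  have len0: "length bs0 = m'" using basis_list_dim[OF bs0] G0 by (simp add: Grass_def)
  obtain b0 where b0: "basis_list D0 b0" using Grass_basis_exists[OF G0(1) V(1)] by blast
  obtain us as where us: "basis_list D0' us" "dual_to us as"
    using dual_basis_exists[of D0'] basis_list_subspace[OF bs0] basis_list_fin_dim[OF bs0] by blast
  have lenus: "length us = m'" using basis_list_dim[OF us(1)] G0 by (simp add: Grass_def)
  obtain M N where M: "bs0 = list_comb M us" "left_inv m' N M"
    using basis_list_change[OF us(1) bs0] lenus by auto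
  have lenas: "length as = m'" using us lenus by (simp add: dual_to_def)
  \<comment> \<open>The matrix M leads from the normalized basis to \<open>bs0\<close> and stays
    fixed. The factor \<open>p as\<close> is there to force nearby points into the same Pluecker
    chart, where their bases can be normalized as well.\<close>
  define G where "G p = p as * F (\<lambda>(i, a). \<Sum>j<m'. M i j * p (as[j := a]))" for p :: "'a list \<Rightarrow> complex"
  define Vr :: "('a list + 'a list) set" where "Vr = Inr ` {as. length as = m'}"
  have "(\<lambda>c. G (\<lambda>x. c (Inr x))) \<in> polyfun UNIV Vr"
    unfolding G_def
  proof (intro polyfun.mult polyfun.var)
    show "(\<lambda>c. F (\<lambda>(i, a). \<Sum>j<m'. M i j * c (Inr (as[j := a])))) \<in> polyfun UNIV Vr"
      using F(1)
    proof (rule polyfun_compose)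
      fix v :: "nat \<times> 'a" assume "v \<in> {..<m'} \<times> UNIV"
      show "(\<lambda>c. (case v of (i, a) \<Rightarrow> \<Sum>j<m'. M i j * c (Inr (as[j := a])))) \<in> polyfun UNIV Vr"
        unfolding split_def
        by (intro polyfun_sum polyfun_cmult polyfun.var) (auto simp: Vr_def lenas)
    qed
  qed (auto simp: Vr_def lenas)
  from polyfun_meval[OF this] obtain f where f: "mvars f \<subseteq> Vr" "\<And>c. meval c f = G (\<lambda>x. c (Inr x))"
    by blast
  have Gus: "G (pluecker us) = F (entries bs0)"
  proof -
    have "F (\<lambda>(i, a). \<Sum>j<m'. M i j * pluecker us (as[j := a])) = F (entries bs0)"
      by (rule polyfun_cong[OF F(1)])
         (auto simp: pluecker_dual[OF us(2)] lenus entries_def M(1) lookup_list_comb)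
    then show ?thesis by (simp add: G_def pluecker_dual_one[OF us(2)])
  qed
  have "meval (case_sum (pluecker b0) (pluecker us)) f \<noteq> 0" using f(2) Gus F(2) by simp
  then have "(\<Sum>d\<in>mdeg ` keys f. meval (case_sum (pluecker b0) (pluecker us)) (mpol_part d f)) \<noteq> 0"
    using meval_sum_parts[of "case_sum (pluecker b0) (pluecker us)" f] by argo
  then obtain d where d: "meval (case_sum (pluecker b0) (pluecker us)) (mpol_part d f) \<noteq> 0"
    using sum.not_neutral_contains_not_neutral by blast
  have mv: "mvars (mpol_part d f) \<subseteq> Vr" using f(1) by (auto simp: mvars_def keys_mpol_part)
  \<comment> \<open>Only variables of the second factor occur, so an ordinary degree d becomes the
    bidegree (0, d).\<close>
  have "(\<Sum>v\<in>keys \<alpha> \<inter> range Inl. lookup \<alpha> v) = 0 \<and> (\<Sum>v\<in>keys \<alpha> \<inter> range Inr. lookup \<alpha> v) = d"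
    if a: "\<alpha> \<in> keys (mpol_part d f)" for \<alpha>
  proof -
    from a have sub: "keys \<alpha> \<subseteq> Vr" using mv by (auto simp: mvars_def)
    then have "keys \<alpha> \<inter> range Inl = {}" "keys \<alpha> \<inter> range Inr = keys \<alpha>" by (auto simp: Vr_def)
    then show ?thesis
      using a by (auto simp: keys_mpol_part mdeg_def)
  qed
  then have "bihomogeneous (mpol_part d f)" unfolding bihomogeneous_def by blast
  define T where "T = {(D, D') \<in> Grass m V \<times> Grass m' V'. \<exists>bs bs'. basis_list D bs \<and> basis_list D' bs' \<and>
         meval (case_sum (pluecker bs) (pluecker bs')) (mpol_part d f) \<noteq> 0}"
  have "T \<in> {{(D, D') \<in> Grass m V \<times> Grass m' V'. \<exists>bs bs'. basis_list D bs \<and> basis_list D' bs' \<and>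
         meval (case_sum (pluecker bs) (pluecker bs')) f \<noteq> 0} | f. bihomogeneous f \<and>
       mvars f \<subseteq> Inl ` {as. length as = m} \<union> Inr ` {as. length as = m'}}"
    unfolding T_def using mv \<open>bihomogeneous (mpol_part d f)\<close>
    by (intro CollectI exI[of _ "mpol_part d f"]) (auto simp: Vr_def)
  then have "openin (zariski_Grass_prod m V m' V') T"
    unfolding zariski_Grass_prod_def openin_topology_generated_by_iff
    by (rule generate_topology_on.Basis)
  moreover have "(D0, D0') \<in> T" unfolding T_def using G0 b0 us(1) d by blast
  ultimately obtain D D' where DD: "(D, D') \<in> W" "(D, D') \<in> T"
    using cl by (auto simp: in_closure_of)
  then obtain bs bs' where bs: "D' \<in> Grass m' V'" "basis_list D' bs'"
      "meval (case_sum (pluecker bs) (pluecker bs')) (mpol_part d f) \<noteq> 0"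
    by (auto simp: T_def)
  \<comment> \<open>Returning from the component to all of f costs a common factor l on the
    coordinates, which is absorbed into the matrix below.\<close>
  from meval_nonzero_scale[OF bs(3)] obtain l where
    l: "l \<noteq> 0" "meval (\<lambda>v. l * case_sum (pluecker bs) (pluecker bs') v) f \<noteq> 0" by blast
  then have Gn: "G (\<lambda>x. l * pluecker bs' x) \<noteq> 0" by (simp add: f(2))
  have len': "length bs' = m'" using basis_list_dim[OF bs(2)] bs(1) by (simp add: Grass_def)
  have "pluecker bs' as \<noteq> 0" using Gn l(1) by (auto simp: G_def)
  then obtain M' N' where M': "left_inv m' N' M'" "dual_to (list_comb M' bs') as"
    using pluecker_nonzero_dual[of bs' as] lenas len' by auto
  define us' where "us' = list_comb M' bs'"
  have us': "basis_list D' us'" "length us' = m'"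
    unfolding us'_def using basis_list_list_comb[OF bs(2)] M'(1) len' by auto
  \<comment> \<open>Normalizing the basis multiplies its Pluecker coordinates by det M'. Hence l
    times the coordinates of \<open>bs'\<close> equals k times the entries of \<open>us'\<close>,
    and F is evaluated at the basis obtained from \<open>us'\<close> by k M.\<close>
  define k where "k = l / det (mat m' m' (\<lambda>(i, j). M' i j))"
  have k: "k \<noteq> 0" using l left_inv_det(1)[OF M'(1)] by (simp add: k_def)
  have plus: "l * pluecker bs' (as[j := a]) = k * lookup (us' ! j) a" if "j < m'" for j a
  proof -
    have "lookup (us' ! j) a = pluecker us' (as[j := a])"
      using pluecker_dual[of us' as j a] M'(2) that us'(2) by (simp add: us'_def)
    also have "\<dots> = det (mat m' m' (\<lambda>(i, j). M' i j)) * pluecker bs' (as[j := a])"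
      unfolding us'_def using lenas len' by (simp add: pluecker_list_comb)
    finally show ?thesis using left_inv_det(1)[OF M'(1)] by (simp add: k_def)
  qed
  have inv: "left_inv (length us') (\<lambda>i j. N i j / k) (\<lambda>i j. k * M i j)"
    using M(2) k by (simp add: left_inv_def us'(2))
  have "F (\<lambda>(i, a). \<Sum>j<m'. M i j * (l * pluecker bs' (as[j := a]))) = F (entries (list_comb (\<lambda>i j. k * M i j) us'))"
    by (rule polyfun_cong[OF F(1)])
       (auto simp: plus entries_def lookup_list_comb us'(2) ac_simps intro!: sum.cong)
  with Gn have "F (entries (list_comb (\<lambda>i j. k * M i j) us')) \<noteq> 0" by (auto simp: G_def)
  moreover have "basis_list D' (list_comb (\<lambda>i j. k * M i j) us')"
    by (rule basis_list_list_comb[OF us'(1) inv])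
  ultimately show ?thesis using DD(1) by blast
qed

section \<open>Zariski-open conditions as polynomial conditions on basis entries\<close>

lemma pluecker_polyfun:
  assumes "length es = n"
  shows "\<exists>Q. Q \<in> polyfun UNIV ({..<n} \<times> UNIV) \<and> (\<forall>b. length b = n \<longrightarrow> Q (entries b) = pluecker b es)"
  by (intro exI[of _ "\<lambda>x. det (mat n n (\<lambda>(i, j). x (i, es ! j)))"])
     (auto intro!: polyfun_det polyfun.var simp: pluecker_def entries_def)

lemma meval_pluecker_polyfun:
  assumes "mvars f \<subseteq> {as. length as = m}"
  shows "\<exists>F. F \<in> polyfun UNIV ({..<m} \<times> UNIV) \<and>
    (\<forall>bs. length bs = m \<longrightarrow> F (entries bs) = meval (pluecker bs) f)"
proof -
  define P where "P c as = det (mat m m (\<lambda>(i, j). c (i, as ! j)))" for c :: "nat \<times> 'a \<Rightarrow> complex" and as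
  have "(\<lambda>c. meval (P c) f) \<in> polyfun UNIV ({..<m} \<times> UNIV)"
    by (rule polyfun_compose[OF meval_polyfun[OF assms]])
       (auto simp: P_def intro!: polyfun_det polyfun.var)
  moreover have "P (entries bs) = pluecker bs" if "length bs = m" for bs
    using that by (auto simp: P_def pluecker_def entries_def fun_eq_iff)
  ultimately show ?thesis by (intro exI[of _ "\<lambda>c. meval (P c) f"]) auto
qed

text \<open>Pluecker coordinates are polynomials in the entries, which settles the basic open sets;
  the rest is induction over the generation of the topology. Only one direction is kept:
  nonvanishing of F at a single basis must imply membership in T.\<close>

lemma zariski_open_polyfun:
  assumes "generate_topology_on
    {{D \<in> Grass m V. \<exists>bs. basis_list D bs \<and> meval (pluecker bs) f \<noteq> 0} | f.
       homogeneous f \<and> mvars f \<subseteq> {as. length as = m}} T" "D0 \<in> T"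
  shows "\<exists>bs0 F. basis_list D0 bs0 \<and> length bs0 = m \<and> F \<in> polyfun UNIV ({..<m} \<times> UNIV) \<and> F (entries bs0) \<noteq> 0 \<and>
    (\<forall>D\<in>Grass m V. \<forall>bs. basis_list D bs \<and> F (entries bs) \<noteq> 0 \<longrightarrow> D \<in> T)"
  using assms
proof (induction rule: generate_topology_on.induct)
  case Empty
  then show ?case by simp
next
  case (Int S T)
  have D0: "D0 \<in> S" "D0 \<in> T" using Int.prems by auto
  from Int.IH(1)[OF D0(1)] obtain b1 F1 where
    1: "basis_list D0 b1" "length b1 = m" "F1 \<in> polyfun UNIV ({..<m} \<times> UNIV)" "F1 (entries b1) \<noteq> 0"
      "\<forall>D\<in>Grass m V. \<forall>bs. basis_list D bs \<and> F1 (entries bs) \<noteq> 0 \<longrightarrow> D \<in> S"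
    by (elim exE conjE)
  from Int.IH(2)[OF D0(2)] obtain b2 F2 where
    2: "basis_list D0 b2" "F2 \<in> polyfun UNIV ({..<m} \<times> UNIV)" "F2 (entries b2) \<noteq> 0"
      "\<forall>D\<in>Grass m V. \<forall>bs. basis_list D bs \<and> F2 (entries bs) \<noteq> 0 \<longrightarrow> D \<in> T"
    by (elim exE conjE)
  obtain M N where M: "b2 = list_comb M b1" "left_inv m N M"
    using basis_list_change[OF 1(1) 2(1)] 1(2) by auto
  \<comment> \<open>The two neighbourhoods come with different bases of D0. The second condition is
    pulled back along the fixed change of basis M, so that a product of polynomials at one basis
    expresses both.\<close>
  define F2' where "F2' c = F2 (\<lambda>(i, a). \<Sum>j<m. M i j * c (j, a))" for c
  have F2': "F2' (entries bs) = F2 (entries (list_comb M bs))" if "length bs = m" for bs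
    using polyfun_entries_list_comb[of F2 bs M] 2(2) that by (simp add: F2'_def)
  define F where "F c = F1 c * F2' c" for c
  have "F \<in> polyfun UNIV ({..<m} \<times> UNIV)"
    unfolding F_def F2'_def by (intro polyfun.mult 1 polyfun_change_basis 2)
  moreover have "F (entries b1) \<noteq> 0" using 1 2 M F2'[of b1] by (simp add: F_def)
  moreover have "D \<in> S \<inter> T" if "D \<in> Grass m V" "basis_list D bs" "F (entries bs) \<noteq> 0" for D bs
  proof
    have "length bs = m" using basis_list_dim[OF that(2)] that(1) by (simp add: Grass_def)
    then have "basis_list D (list_comb M bs)" "F2 (entries (list_comb M bs)) \<noteq> 0"
      using basis_list_list_comb[OF that(2)] M(2) that(3) F2' by (auto simp: F_def)
    then show "D \<in> T" using 2(4) that(1) by blast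
    show "D \<in> S" using 1(5) that by (auto simp: F_def)
  qed
  ultimately show ?case using 1(1,2) by (intro exI[of _ b1] exI[of _ F]) auto
next
  case (UN K)
  then obtain k where k: "k \<in> K" "D0 \<in> k" by auto
  from UN.IH[OF this] obtain bs0 F where "basis_list D0 bs0" "length bs0 = m" "F \<in> polyfun UNIV ({..<m} \<times> UNIV)"
    "F (entries bs0) \<noteq> 0" "\<forall>D\<in>Grass m V. \<forall>bs. basis_list D bs \<and> F (entries bs) \<noteq> 0 \<longrightarrow> D \<in> k"
    by (elim exE conjE)
  then show ?case using k by (intro exI[of _ bs0] exI[of _ F]) auto
next
  case (Basis S)
  then obtain f where f: "mvars f \<subseteq> {as. length as = m}"
    and S: "S = {D \<in> Grass m V. \<exists>bs. basis_list D bs \<and> meval (pluecker bs) f \<noteq> 0}" by blast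
  obtain F where F: "F \<in> polyfun UNIV ({..<m} \<times> UNIV)"
     "\<And>bs. length bs = m \<Longrightarrow> F (entries bs) = meval (pluecker bs) f"
    using meval_pluecker_polyfun[OF f] by blast
  obtain bs0 where bs0: "basis_list D0 bs0" "meval (pluecker bs0) f \<noteq> 0" "D0 \<in> Grass m V"
    using Basis(2) S by blast
  have len: "length bs = m" if "basis_list D bs" "D \<in> Grass m V" for D bs
    using basis_list_dim[OF that(1)] that(2) by (simp add: Grass_def)
  show ?case
  proof (intro exI[of _ bs0] exI[of _ F] conjI ballI allI impI)
    fix D bs assume "D \<in> Grass m V" "basis_list D bs \<and> F (entries bs) \<noteq> 0"
    then show "D \<in> S" unfolding S using len[of D bs] F(2)[of bs] by auto
  qed (use bs0 len[OF bs0(1,3)] F in auto)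
qed

text \<open>F is not assumed invariant under change of basis, hence the choice of a basis on both
  sides. This freedom is what allows spaces to be varied through lists of vectors.\<close>

definition poly_dense :: "nat \<Rightarrow> ('a \<Rightarrow>\<^sub>0 complex) set set \<Rightarrow> ('a \<Rightarrow>\<^sub>0 complex) set set \<Rightarrow> bool"
  where "poly_dense m X I \<longleftrightarrow> (\<forall>D\<in>X. \<forall>bs F. basis_list D bs \<longrightarrow> F \<in> polyfun UNIV ({..<m} \<times> UNIV) \<longrightarrow>
    F (entries bs) \<noteq> 0 \<longrightarrow> (\<exists>D'\<in>I. \<exists>bs'. basis_list D' bs' \<and> F (entries bs') \<noteq> 0))"

lemma poly_dense_closure:
  assumes "fin_dim V" "X \<subseteq> Grass m V" "I \<subseteq> Grass m V" "poly_dense m X I"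
  shows "X \<subseteq> zariski_Grass m V closure_of I"
proof
  fix D0 assume D0: "D0 \<in> X"
  show "D0 \<in> zariski_Grass m V closure_of I"
    unfolding in_closure_of
  proof (intro conjI allI impI)
    show "D0 \<in> topspace (zariski_Grass m V)"
      using D0 assms by (auto simp: topspace_zariski_Grass)
    fix T assume T: "D0 \<in> T \<and> openin (zariski_Grass m V) T"
    then have "generate_topology_on
      {{D \<in> Grass m V. \<exists>bs. basis_list D bs \<and> meval (pluecker bs) f \<noteq> 0} | f.
         homogeneous f \<and> mvars f \<subseteq> {as. length as = m}} T"
      by (simp add: zariski_Grass_def openin_topology_generated_by_iff)
    from zariski_open_polyfun[OF this, of D0] T obtain bs0 F where
      "basis_list D0 bs0" "F \<in> polyfun UNIV ({..<m} \<times> UNIV)" "F (entries bs0) \<noteq> 0"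
      "\<forall>D\<in>Grass m V. \<forall>bs. basis_list D bs \<and> F (entries bs) \<noteq> 0 \<longrightarrow> D \<in> T"
      by (elim exE conjE) blast
    moreover from this have "\<exists>D'\<in>I. \<exists>bs'. basis_list D' bs' \<and> F (entries bs') \<noteq> 0"
      using assms(4) D0 by (auto simp: poly_dense_def)
    ultimately show "\<exists>y. y \<in> I \<and> y \<in> T" using assms(3) by blast
  qed
qed

section \<open>Polynomials as functionals\<close>

declare One_nat_def [simp del]

lemma mdeg_UNIV: "mdeg (\<alpha> :: 'n::finite expo) = (\<Sum>k\<in>UNIV. lookup \<alpha> k)"
  unfolding mdeg_def by (rule sum.mono_neutral_left) (auto simp: in_keys_iff)

lemma mfact_UNIV: "mfact (\<alpha> :: 'n::finite expo) = (\<Prod>k\<in>UNIV. fact (lookup \<alpha> k))"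
  unfolding mfact_def by (rule prod.mono_neutral_left) (auto simp: in_keys_iff)

lemma mfact_nonzero [simp]: "mfact \<alpha> \<noteq> 0"
  by (simp add: mfact_def)

lemma mdeg_0 [simp]: "mdeg 0 = 0"
  by (simp add: mdeg_def)

lemma mdeg_add: "mdeg (\<alpha> + \<beta>) = mdeg \<alpha> + mdeg (\<beta> :: 'n::finite expo)"
  by (simp add: mdeg_UNIV lookup_add sum.distrib)

lemma mdeg_unit [simp]: "mdeg (unit_expo k) = 1"
  by (simp add: mdeg_def)

lemma mdeg_add_unit [simp]: "mdeg (\<alpha> + unit_expo k) = Suc (mdeg (\<alpha> :: 'n::finite expo))"
  by (simp add: mdeg_add)

lemma mfact_add_unit: "mfact (\<alpha> + unit_expo k) = (lookup \<alpha> k + 1) * mfact (\<alpha> :: 'n::finite expo)"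
proof -
  have "mfact (\<alpha> + unit_expo k) = (\<Prod>j\<in>UNIV. (if j = k then lookup \<alpha> k + 1 else 1) * fact (lookup \<alpha> j))"
    unfolding mfact_UNIV by (rule prod.cong) (auto simp: lookup_add lookup_single fact_reduce)
  also have "\<dots> = (lookup \<alpha> k + 1) * mfact \<alpha>"
    by (simp add: prod.distrib mfact_UNIV)
  finally show ?thesis .
qed

lemma expo_diff_unit:
  assumes "lookup \<alpha> k > 0"
  shows "(\<alpha> - unit_expo k) + unit_expo k = (\<alpha> :: 'n expo)"
  by (rule poly_mapping_eqI) (use assms in \<open>auto simp: lookup_add lookup_minus lookup_single when_def\<close>)

lemma expo_decompose:
  assumes "mdeg \<alpha> > 0"
  shows "\<exists>k \<alpha>'. \<alpha> = \<alpha>' + unit_expo k \<and> lookup \<alpha> k > 0"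
proof -
  have "keys \<alpha> \<noteq> {}" using assms by (auto simp: mdeg_def)
  then obtain k where "k \<in> keys \<alpha>" by blast
  then have "lookup \<alpha> k > 0" by (simp add: in_keys_iff)
  then show ?thesis
    by (intro exI[of _ k] exI[of _ "\<alpha> - unit_expo k"] conjI expo_diff_unit[symmetric])
qed

lemma mdeg_eq_0: "mdeg \<alpha> = 0 \<longleftrightarrow> \<alpha> = (0 :: 'n::finite expo)"
  by (simp add: mdeg_UNIV poly_mapping_eq_iff fun_eq_iff)

lemma finite_mdeg_le: "finite {\<alpha> :: 'n::finite expo. mdeg \<alpha> \<le> t}"
proof (rule finite_imageD)
  have "lookup \<alpha> k \<le> t" if "mdeg \<alpha> \<le> t" for \<alpha> :: "'n expo" and k
    using that member_le_sum[of k UNIV "lookup \<alpha>"] by (auto simp: mdeg_UNIV)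
  then have "lookup ` {\<alpha> :: 'n expo. mdeg \<alpha> \<le> t} \<subseteq> PiE UNIV (\<lambda>_. {..t})" by auto
  then show "finite (lookup ` {\<alpha> :: 'n expo. mdeg \<alpha> \<le> t})"
    by (rule finite_subset[OF _ finite_PiE]) simp_all
  show "inj_on lookup {\<alpha> :: 'n expo. mdeg \<alpha> \<le> t}"
    by (rule inj_onI) (rule poly_mapping_eqI, simp)
qed

text \<open>The value of the functional \<Lambda> on the monomial with exponent \<alpha>
  (\<open>dual_apply_monomial\<close>), that is, its coefficient with respect to
  \<open>d\<^sup>\<alpha> / \<alpha>!\<close>. In this normalization a derivative is a plain shift
  of exponents (\<open>ev_pdiff\<close>).\<close>

definition ev :: "('n expo \<Rightarrow>\<^sub>0 complex) \<Rightarrow> 'n expo \<Rightarrow> complex"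
  where "ev \<Lambda> \<alpha> = of_nat (mfact \<alpha>) * lookup \<Lambda> \<alpha>"

lemma ev_eq_0: "ev \<Lambda> \<alpha> = 0 \<longleftrightarrow> lookup \<Lambda> \<alpha> = 0"
  by (simp add: ev_def)

lemma linfun_ev: "linfun (\<lambda>\<Lambda>. ev \<Lambda> \<alpha>)"
  by (simp add: linfun_def ev_def lookup_add lookup_pscale algebra_simps)

lemma ev_eqI: "(\<And>\<alpha>. ev p \<alpha> = ev q \<alpha>) \<Longrightarrow> p = q"
  by (rule poly_mapping_eqI) (simp add: ev_def)

lemma lookup_pdiff:
  "lookup (pdiff k p) \<alpha> = of_nat (lookup \<alpha> k + 1) * lookup p (\<alpha> + unit_expo k)"
proof -
  have "lookup (pdiff k p) \<alpha> =
      (\<Sum>\<beta>\<in>keys p. if \<beta> - unit_expo k = \<alpha> then lookup p \<beta> * of_nat (lookup \<beta> k) else 0)"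
    by (simp add: pdiff_def lookup_sum lookup_single when_def)
  also have "\<dots> = (\<Sum>\<beta>\<in>keys p. if \<beta> = \<alpha> + unit_expo k then lookup p \<beta> * of_nat (lookup \<beta> k) else 0)"
  proof (rule sum.cong[OF refl])
    fix \<beta>
    show "(if \<beta> - unit_expo k = \<alpha> then lookup p \<beta> * of_nat (lookup \<beta> k) else 0) =
      (if \<beta> = \<alpha> + unit_expo k then lookup p \<beta> * of_nat (lookup \<beta> k) else 0)"
    \<comment> \<open>Subtraction of exponents is truncated, so \<beta> with k-th entry 0 can also
      satisfy the left condition; its term vanishes because of the factor
      \<open>lookup \<beta> k\<close>.\<close>
    proof (cases "lookup \<beta> k = 0")
      case False
      then have "(\<beta> - unit_expo k = \<alpha>) = (\<beta> = \<alpha> + unit_expo k)"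
        using expo_diff_unit[of \<beta> k] by auto
      then show ?thesis by simp
    qed simp
  qed
  also have "\<dots> = of_nat (lookup \<alpha> k + 1) * lookup p (\<alpha> + unit_expo k)"
    by (simp add: lookup_add in_keys_iff)
  finally show ?thesis .
qed

lemma pdiff_add: "pdiff k (p + q) = pdiff k p + pdiff k q"
  by (rule poly_mapping_eqI) (simp add: lookup_pdiff lookup_add algebra_simps)

lemma pdiff_scale: "pdiff k (pscale c p) = pscale c (pdiff k p)"
  by (rule poly_mapping_eqI) (simp add: lookup_pdiff lookup_pscale)

lemma pdiff_0 [simp]: "pdiff k 0 = 0"
  by (simp add: pdiff_def)

lemma ev_pdiff: "ev (pdiff k p) \<alpha> = ev p (\<alpha> + unit_expo (k :: 'n::finite))"
  by (simp add: ev_def lookup_pdiff mfact_add_unit algebra_simps)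

lemma ev_pdiff_power: "ev ((pdiff k ^^ m) p) \<alpha> = ev p (\<alpha> + Poly_Mapping.single (k :: 'n::finite) m)"
proof (induction m arbitrary: \<alpha>)
  case (Suc m)
  have "\<alpha> + unit_expo k + Poly_Mapping.single k m = \<alpha> + Poly_Mapping.single k (Suc m)"
    by (simp add: add.assoc flip: single_add Suc_eq_plus1_left)
  then show ?case using Suc by (simp add: ev_pdiff)
qed simp

lemma ev_pdiffs: "ev (pdiffs \<beta> p) \<alpha> = ev p (\<alpha> + (\<beta> :: 'n::{finite,linorder} expo))"
proof -
  have *: "ev (fold (\<lambda>k. pdiff k ^^ lookup \<beta> k) ks p) \<alpha> =
      ev p (\<alpha> + (\<Sum>k\<leftarrow>ks. Poly_Mapping.single k (lookup \<beta> k)))" for ks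
    by (induction ks arbitrary: p) (simp_all add: ev_pdiff_power add_ac)
  have "(\<Sum>k\<leftarrow>sorted_list_of_set UNIV. Poly_Mapping.single k (lookup \<beta> k)) = \<beta>"
    by (subst sum_list_distinct_conv_sum_set)
       (auto intro!: poly_mapping_eqI simp: lookup_sum lookup_single when_def)
  then show ?thesis by (simp add: pdiffs_def *)
qed

lemma meval_0: "meval (\<lambda>_. 0) p = lookup p 0"
proof -
  have "mono_eval (\<lambda>_. 0 :: 'a) \<alpha> = (if \<alpha> = 0 then 1 else 0)" for \<alpha> :: "'b expo"
  proof (cases "\<alpha> = 0")
    case False
    then have "keys \<alpha> \<noteq> {}" by (auto simp: poly_mapping_eq_iff fun_eq_iff in_keys_iff)
    then obtain v where "v \<in> keys \<alpha>" by blast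
    then have "(\<Prod>v\<in>keys \<alpha>. (0 :: 'a) ^ lookup \<alpha> v) = 0"
      by (intro prod_zero) (auto simp: in_keys_iff intro!: bexI[of _ v] zero_power)
    then show ?thesis using False by (simp add: mono_eval_def)
  qed simp
  then have "meval (\<lambda>_. 0) p = (\<Sum>\<alpha>\<in>keys p. if \<alpha> = 0 then lookup p \<alpha> else 0)"
    unfolding meval_hom_eval hom_eval_def by (intro sum.cong) auto
  then show ?thesis by (auto simp: in_keys_iff)
qed

lemma dual_apply_ev: "dual_apply \<Lambda> p = (\<Sum>\<beta>\<in>keys \<Lambda>. ev \<Lambda> \<beta> * lookup p \<beta>)"
proof -
  have "meval (\<lambda>_. 0) (pdiffs \<beta> p) = of_nat (mfact \<beta>) * lookup p \<beta>" for \<beta>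
    using ev_pdiffs[of \<beta> p 0] by (simp add: meval_0 ev_def mfact_def)
  then show ?thesis by (simp add: dual_apply_def ev_def ac_simps)
qed

lemma dual_apply_superset:
  assumes "finite S" "keys \<Lambda> \<subseteq> S"
  shows "dual_apply \<Lambda> p = (\<Sum>\<beta>\<in>S. ev \<Lambda> \<beta> * lookup p \<beta>)"
  unfolding dual_apply_ev using assms by (intro sum.mono_neutral_left) (auto simp: in_keys_iff ev_eq_0)

lemma linfun_dual_apply: "linfun (dual_apply \<Lambda>)"
  by (simp add: linfun_def dual_apply_ev lookup_add lookup_pscale sum.distrib sum_distrib_left algebra_simps)

lemma linfun_dual_apply_left: "linfun (\<lambda>\<Lambda>. dual_apply \<Lambda> p)"
  unfolding linfun_def
proof (intro conjI allI)
  fix x y :: "('a, complex) mpol" and c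
  have "keys (x + y) \<subseteq> keys x \<union> keys y" by (rule keys_add)
  then show "dual_apply (x + y) p = dual_apply x p + dual_apply y p"
    by (simp add: dual_apply_superset[of "keys x \<union> keys y"] linfun_add[where \<phi> = "\<lambda>x. ev x _", OF linfun_ev]
        distrib_right sum.distrib)
  have "keys (pscale c x) \<subseteq> keys x" by (auto simp: in_keys_iff lookup_pscale)
  then show "dual_apply (pscale c x) p = c * dual_apply x p"
    by (simp add: dual_apply_superset[of "keys x"] linfun_scale[where \<phi> = "\<lambda>x. ev x _", OF linfun_ev]
        sum_distrib_left mult.assoc)
qed

lemma dual_apply_single: "dual_apply \<Lambda> (Poly_Mapping.single \<alpha> a) = ev \<Lambda> \<alpha> * a"
proof -
  have "dual_apply \<Lambda> (Poly_Mapping.single \<alpha> a) = (\<Sum>\<beta>\<in>keys \<Lambda>. if \<alpha> = \<beta> then ev \<Lambda> \<beta> * a else 0)"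
    unfolding dual_apply_ev by (rule sum.cong) (auto simp: lookup_single when_def)
  then show ?thesis by (auto simp: in_keys_iff ev_eq_0)
qed

lemma dual_apply_monomial: "dual_apply \<Lambda> (monomial \<alpha>) = ev \<Lambda> \<alpha>"
  by (simp add: monomial_def dual_apply_single)

section \<open>The degree filtration and the powers of the maximal ideal\<close>

lemma polys_le_iff: "p \<in> polys_le t \<longleftrightarrow> (\<forall>\<alpha>. mdeg \<alpha> > t \<longrightarrow> lookup p \<alpha> = 0)"
  by (auto simp: polys_le_def in_keys_iff not_le[symmetric])

lemma polys_le_subspace: "pm.subspace (polys_le t)"
  by (auto simp: pm.subspace_def polys_le_iff lookup_add lookup_pscale)

lemma polys_le_fin_dim: "fin_dim (polys_le t :: ('n::finite, complex) mpol set)"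
  by (rule fin_dim_subset[OF fin_dim_keys[OF finite_mdeg_le[of t]]]) (auto simp: polys_le_def)

lemma polys_le_mono: "s \<le> t \<Longrightarrow> polys_le s \<subseteq> polys_le t"
  by (auto simp: polys_le_iff)

interpretation mpol_module: Modules.module "(*) :: ('v, complex) mpol \<Rightarrow> ('v, complex) mpol \<Rightarrow> ('v, complex) mpol"
  by unfold_locales (auto simp: algebra_simps)

lemma ideal_gen_high_degree:
  fixes S :: "('n::finite, complex) mpol set"
  assumes "\<And>p. p \<in> S \<Longrightarrow> \<forall>\<alpha>\<in>keys p. s \<le> mdeg \<alpha>" "q \<in> ideal_gen S"
  shows "\<forall>\<alpha>\<in>keys q. s \<le> mdeg \<alpha>"
proof -
  have "q \<in> {p. \<forall>\<alpha>\<in>keys p. s \<le> mdeg \<alpha>}"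
    using assms(2) unfolding ideal_gen_def
  proof (rule mpol_module.span_induct[where P = "\<lambda>q. q \<in> {p. \<forall>\<alpha>\<in>keys p. s \<le> mdeg \<alpha>}"])
    show "mpol_module.subspace {q. q \<in> {p :: ('n, complex) mpol. \<forall>\<alpha>\<in>keys p. s \<le> mdeg \<alpha>}}"
    proof (rule mpol_module.subspaceI)
      fix x y c :: "('n, complex) mpol"
      assume x: "x \<in> {q. q \<in> {p. \<forall>\<alpha>\<in>keys p. s \<le> mdeg \<alpha>}}"
      show "c * x \<in> {q. q \<in> {p. \<forall>\<alpha>\<in>keys p. s \<le> mdeg \<alpha>}}"
        using x keys_mult[of c x] by (fastforce simp: mdeg_add)
      assume "y \<in> {q. q \<in> {p. \<forall>\<alpha>\<in>keys p. s \<le> mdeg \<alpha>}}"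
      then show "x + y \<in> {q. q \<in> {p. \<forall>\<alpha>\<in>keys p. s \<le> mdeg \<alpha>}}"
        using x keys_add[of x y] by auto
    qed auto
  qed (use assms(1) in auto)
  then show ?thesis by simp
qed

text \<open>Polynomials without terms of degree below a bound form an ideal, and degrees add under
  products. Together with \<open>high_degree_in_max_ideal_power\<close> this describes the powers of
  the maximal ideal by degrees alone.\<close>

lemma max_ideal_power_degree:
  "p \<in> max_ideal_power s \<Longrightarrow> \<forall>\<alpha>\<in>keys (p :: ('n::finite, complex) mpol). s \<le> mdeg \<alpha>"
proof (induction s arbitrary: p)
  case (Suc s)
  have m: "\<forall>\<alpha>\<in>keys a. 1 \<le> mdeg \<alpha>" if "a \<in> max_ideal" for a :: "('n, complex) mpol"
    using that unfolding max_ideal_def by (rule ideal_gen_high_degree[rotated]) (auto simp: monomial_def)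
  show ?case
    using Suc.prems unfolding max_ideal_power.simps
  proof (rule ideal_gen_high_degree[rotated])
    fix q :: "('n, complex) mpol" assume "q \<in> {a * b |a b. a \<in> max_ideal \<and> b \<in> max_ideal_power s}"
    then obtain a b where ab: "q = a * b" "a \<in> max_ideal" "b \<in> max_ideal_power s" by auto
    show "\<forall>\<alpha>\<in>keys q. Suc s \<le> mdeg \<alpha>"
      using keys_mult[of a b] m[OF ab(2)] Suc.IH[OF ab(3)] ab(1) by (fastforce simp: mdeg_add)
  qed
qed simp

lemma single_in_max_ideal_power:
  fixes \<alpha> :: "'n::finite expo"
  shows "s \<le> mdeg \<alpha> \<Longrightarrow> Poly_Mapping.single \<alpha> a \<in> max_ideal_power s"
proof (induction s arbitrary: \<alpha>)
  case (Suc s)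
  then obtain k \<alpha>' where k: "\<alpha> = \<alpha>' + unit_expo k" using expo_decompose[of \<alpha>] by auto
  then have "s \<le> mdeg \<alpha>'" using Suc.prems by simp
  then have "Poly_Mapping.single \<alpha>' a \<in> max_ideal_power s" by (rule Suc.IH)
  moreover have "monomial (unit_expo k) \<in> max_ideal"
    unfolding max_ideal_def ideal_gen_def by (rule mpol_module.span_base) auto
  moreover have "Poly_Mapping.single \<alpha> a = monomial (unit_expo k) * Poly_Mapping.single \<alpha>' a"
    by (simp add: k monomial_def mult_single add.commute)
  ultimately show ?case
    unfolding max_ideal_power.simps ideal_gen_def by (intro mpol_module.span_base) blast
qed simp

lemma high_degree_in_max_ideal_power:
  fixes p :: "('n::finite, complex) mpol"
  assumes "\<forall>\<alpha>\<in>keys p. s \<le> mdeg \<alpha>"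
  shows "p \<in> max_ideal_power s"
proof (cases s)
  case (Suc s')
  have "(\<Sum>\<alpha>\<in>keys p. Poly_Mapping.single \<alpha> (lookup p \<alpha>)) \<in> max_ideal_power s"
    unfolding Suc max_ideal_power.simps ideal_gen_def
  proof (rule mpol_module.span_sum)
    fix \<alpha> assume "\<alpha> \<in> keys p"
    then have "Poly_Mapping.single \<alpha> (lookup p \<alpha>) \<in> max_ideal_power s"
      using assms by (intro single_in_max_ideal_power) auto
    then show "Poly_Mapping.single \<alpha> (lookup p \<alpha>) \<in>
        mpol_module.span {a * b |a b. a \<in> max_ideal \<and> b \<in> max_ideal_power s'}"
      by (simp add: Suc ideal_gen_def)
  qed
  then show ?thesis using poly_mapping_sum_singles[of p] by simp
qed simp

lemma dual_apply_max_ideal_power: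
  assumes "\<Lambda> \<in> polys_le s" "p \<in> max_ideal_power (Suc s)"
  shows "dual_apply \<Lambda> p = 0"
proof -
  have "ev \<Lambda> \<beta> * lookup p \<beta> = 0" for \<beta>
    using assms(1) max_ideal_power_degree[OF assms(2)] by (cases "s < mdeg \<beta>") (auto simp: polys_le_iff in_keys_iff Suc_le_eq ev_eq_0)
  then show ?thesis unfolding dual_apply_ev by (intro sum.neutral) blast
qed


section \<open>Dual bases and the open charts of the Hilbert scheme\<close>

text \<open>The concrete form of the chart condition in \<open>Hilb_B\<close>: a basis dual to E
  that respects degrees. The degree bound replaces the conditions for all s at once, and it is the
  source of the convention that \<mu> at (\<beta>, \<sigma> + e_k) is 0 when |\<sigma>| \<ge>
  |\<beta>|.\<close>

definition dual_basis :: "'n expo set \<Rightarrow> ('n, complex) mpol set \<Rightarrow> ('n expo \<Rightarrow> ('n, complex) mpol) \<Rightarrow> bool"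
  where "dual_basis E D \<Lambda> \<longleftrightarrow> pm.subspace D \<and> dual_fam (\<lambda>\<gamma> p. ev p \<gamma>) \<Lambda> E D \<and>
    separates (\<lambda>\<gamma> p. ev p \<gamma>) E D \<and> (\<forall>\<beta>\<in>E. \<Lambda> \<beta> \<in> polys_le (mdeg \<beta>))"

lemma dual_basisD:
  assumes "dual_basis E D \<Lambda>"
  shows "pm.subspace D" "dual_fam (\<lambda>\<gamma> p. ev p \<gamma>) \<Lambda> E D" "separates (\<lambda>\<gamma> p. ev p \<gamma>) E D"
    "finite E" "\<And>\<beta>. \<beta> \<in> E \<Longrightarrow> \<Lambda> \<beta> \<in> D" "\<And>\<beta>. \<beta> \<in> E \<Longrightarrow> \<Lambda> \<beta> \<in> polys_le (mdeg \<beta>)"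
    "\<And>\<beta> \<gamma>. \<beta> \<in> E \<Longrightarrow> \<gamma> \<in> E \<Longrightarrow> ev (\<Lambda> \<beta>) \<gamma> = (if \<beta> = \<gamma> then 1 else 0)"
  using assms by (auto simp: dual_basis_def dual_fam_def)

lemma dual_basis_expand:
  assumes "dual_basis E D \<Lambda>" "x \<in> D"
  shows "x = (\<Sum>\<beta>\<in>E. pscale (ev x \<beta>) (\<Lambda> \<beta>))"
  using dual_fam_expand[OF dual_basisD(2,1,3)[OF assms(1)] assms(2)] .

lemma dual_fam_dual_apply:
  assumes "dual_fam (\<lambda>\<gamma> p. ev p \<gamma>) u I D" "pm.subspace D" "separates (\<lambda>\<gamma> p. ev p \<gamma>) I D" "x \<in> D"
  shows "dual_apply x p = (\<Sum>i\<in>I. ev x i * dual_apply (u i) p)"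
proof -
  have "dual_apply x p = dual_apply (\<Sum>i\<in>I. pscale (ev x i) (u i)) p"
    using dual_fam_expand[OF assms] by (rule arg_cong)
  also have "\<dots> = (\<Sum>i\<in>I. ev x i * dual_apply (u i) p)"
    by (simp add: linfun_sum[where \<phi> = "\<lambda>x. dual_apply x p", OF linfun_dual_apply_left]
        linfun_scale[where \<phi> = "\<lambda>x. dual_apply x p", OF linfun_dual_apply_left])
  finally show ?thesis .
qed

lemma dual_basis_span: "dual_basis E D \<Lambda> \<Longrightarrow> pm.span (\<Lambda> ` E) = D"
  by (rule dual_fam_span) (rule dual_basisD; assumption)+

lemma dual_basis_dim: "dual_basis E D \<Lambda> \<Longrightarrow> pm.dim D = card E"
  by (rule dual_fam_dim) (rule dual_basisD; assumption)+

lemma dual_basis_unique: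
  assumes "dual_basis E D \<Lambda>" "x \<in> D" "\<beta> \<in> E" "\<And>\<gamma>. \<gamma> \<in> E \<Longrightarrow> ev x \<gamma> = (if \<gamma> = \<beta> then 1 else 0)"
  shows "x = \<Lambda> \<beta>"
proof -
  have "(\<Sum>\<gamma>\<in>E. pscale (ev x \<gamma>) (\<Lambda> \<gamma>)) = (\<Sum>\<gamma>\<in>E. if \<gamma> = \<beta> then \<Lambda> \<gamma> else 0)"
    by (rule sum.cong) (auto simp: assms(4))
  then have "x = (\<Sum>\<gamma>\<in>E. if \<gamma> = \<beta> then \<Lambda> \<gamma> else 0)"
    using dual_basis_expand[OF assms(1,2)] by (rule trans[rotated])
  then show ?thesis using assms(3) dual_basisD(4)[OF assms(1)] by simp
qed

lemma dual_elem_eq: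
  assumes "dual_basis E D \<Lambda>" "\<beta> \<in> E"
  shows "dual_elem E D \<beta> = \<Lambda> \<beta>"
  unfolding dual_elem_def dual_apply_monomial
proof (rule the_equality)
  show "\<Lambda> \<beta> \<in> D \<and> (\<forall>\<gamma>\<in>E. ev (\<Lambda> \<beta>) \<gamma> = (if \<gamma> = \<beta> then 1 else 0))"
    using dual_basisD[OF assms(1)] assms(2) by auto
qed (use dual_basis_unique[OF assms(1) _ assms(2)] in blast)

lemma mu_coord_eq: "dual_basis E D \<Lambda> \<Longrightarrow> \<beta> \<in> E \<Longrightarrow> mu_coord E D \<beta> \<alpha> = ev (\<Lambda> \<beta>) \<alpha>"
  by (simp add: mu_coord_def dual_elem_eq ev_def)

lemma dual_basis_polys_le:
  assumes "dual_basis (upto_deg E t) D \<Lambda>"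
  shows "D \<subseteq> polys_le t"
proof -
  have "\<Lambda> \<beta> \<in> polys_le t" if "\<beta> \<in> upto_deg E t" for \<beta>
    using dual_basisD(6)[OF assms that] polys_le_mono[of "mdeg \<beta>" t] that by (auto simp: upto_deg_def)
  then have "pm.span (\<Lambda> ` upto_deg E t) \<subseteq> polys_le t"
    by (intro pm.span_minimal polys_le_subspace) auto
  then show ?thesis using dual_basis_span[OF assms] by simp
qed

abbreviation chart_kernel :: "('n::{finite,linorder}, complex) mpol set \<Rightarrow> nat \<Rightarrow> ('n, complex) mpol set"
  where "chart_kernel D s \<equiv> {p + q | p q. p \<in> perp D \<and> q \<in> max_ideal_power (Suc s)}"

lemma chart_kernel_dual_apply:
  assumes "x \<in> chart_kernel D s" "\<Lambda> \<in> D" "\<Lambda> \<in> polys_le s"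
  shows "dual_apply \<Lambda> x = 0"
  using assms dual_apply_max_ideal_power[OF assms(3)]
  by (auto simp: linfun_add[OF linfun_dual_apply] perp_def)

lemma inj_monomial: "inj monomial"
  by (rule injI) (metis keys_single monomial_def singleton_insert_inj_eq' zero_neq_one)

lemma sum_monomial_image:
  "(\<Sum>b\<in>monomial ` F. pscale (c b) b) = (\<Sum>\<beta>\<in>F. pscale (c (monomial \<beta>)) (monomial \<beta>))"
  by (subst sum.reindex) (auto intro: inj_on_subset[OF inj_monomial])

lemma dual_apply_sum_monomials:
  "dual_apply \<Lambda> (\<Sum>\<beta>\<in>F. pscale (c \<beta>) (monomial \<beta>)) = (\<Sum>\<beta>\<in>F. c \<beta> * ev \<Lambda> \<beta>)"
  by (simp add: linfun_sum[OF linfun_dual_apply] linfun_scale[OF linfun_dual_apply] dual_apply_monomial)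

text \<open>Existence: subtracting all monomials of \<open>upto_deg E t\<close>, with the values of
  p under the dual basis as coefficients, leads into \<open>perp D\<close>, and those of degree
  above s lie in the power of the maximal ideal. Uniqueness: a dual basis element of degree at most
  s kills both summands of the chart kernel.\<close>

lemma dual_basis_quotient_basis:
  fixes E :: "'n::{finite,linorder} expo set"
  assumes d: "dual_basis (upto_deg E t) D \<Lambda>" and s: "s \<le> t"
  shows "quotient_basis (monomial ` upto_deg E s) (chart_kernel D s)"
  unfolding quotient_basis_def
proof
  fix p :: "('n, complex) mpol"
  let ?Es = "upto_deg E s" and ?Et = "upto_deg E t"
  note D = dual_basisD[OF d]
  have sub: "?Es \<subseteq> ?Et" using s by (auto simp: upto_deg_def)
  have fin: "finite ?Es" using D(4) sub finite_subset by blast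
  have deg: "\<Lambda> \<beta> \<in> polys_le s" if "\<beta> \<in> ?Es" for \<beta>
    using D(6)[of \<beta>] polys_le_mono[of "mdeg \<beta>" s] that sub by (auto simp: upto_deg_def)
  define c where "c b = (if b \<in> monomial ` ?Es then dual_apply (\<Lambda> (inv_into UNIV monomial b)) p else 0)" for b
  have c: "c (monomial \<beta>) = dual_apply (\<Lambda> \<beta>) p" if "\<beta> \<in> ?Es" for \<beta>
    using that by (simp add: c_def inv_f_f[OF inj_monomial])
  show "\<exists>!c. (\<forall>b. b \<notin> monomial ` ?Es \<longrightarrow> c b = 0) \<and>
      p - (\<Sum>b\<in>monomial ` ?Es. pscale (c b) b) \<in> chart_kernel D s"
  proof (rule ex1I[of _ c], intro conjI)
    show "\<forall>b. b \<notin> monomial ` ?Es \<longrightarrow> c b = 0" by (simp add: c_def)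
    define r where "r = p - (\<Sum>\<beta>\<in>?Es. pscale (dual_apply (\<Lambda> \<beta>) p) (monomial \<beta>))"
    define m where "m = (\<Sum>\<beta>\<in>?Et - ?Es. pscale (dual_apply (\<Lambda> \<beta>) p) (monomial \<beta>))"
    have "(\<Sum>b\<in>monomial ` ?Es. pscale (c b) b) = (\<Sum>\<beta>\<in>?Es. pscale (dual_apply (\<Lambda> \<beta>) p) (monomial \<beta>))"
      unfolding sum_monomial_image by (rule sum.cong) (simp_all add: c)
    then have r: "p - (\<Sum>b\<in>monomial ` ?Es. pscale (c b) b) = r" by (simp add: r_def)
    have "r - m = p - (\<Sum>\<beta>\<in>?Et. pscale (dual_apply (\<Lambda> \<beta>) p) (monomial \<beta>))"
      unfolding r_def m_def using sum.subset_diff[OF sub D(4), of "\<lambda>\<beta>. pscale (dual_apply (\<Lambda> \<beta>) p) (monomial \<beta>)"]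
      by (simp add: algebra_simps)
    then have rm: "dual_apply (\<Lambda> \<gamma>) (r - m) = 0" if "\<gamma> \<in> ?Et" for \<gamma>
    proof -
      have "(\<Sum>\<beta>\<in>?Et. dual_apply (\<Lambda> \<beta>) p * ev (\<Lambda> \<gamma>) \<beta>) = (\<Sum>\<beta>\<in>?Et. if \<gamma> = \<beta> then dual_apply (\<Lambda> \<beta>) p else 0)"
        by (rule sum.cong) (use D(7) that in auto)
      then show ?thesis
        using that D(4) \<open>r - m = _\<close>
        by (simp add: linfun_diff[OF linfun_dual_apply] dual_apply_sum_monomials)
    qed
    have "r - m \<in> perp D"
      unfolding perp_def
    proof (intro CollectI ballI)
      fix x assume "x \<in> D"
      from dual_fam_dual_apply[OF D(2,1,3) this, of "r - m"]
      show "dual_apply x (r - m) = 0" by (simp add: rm)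
    qed
    moreover have "m \<in> max_ideal_power (Suc s)"
    proof (rule high_degree_in_max_ideal_power, rule ballI, rule ccontr)
      fix \<alpha> assume "\<alpha> \<in> keys m" "\<not> Suc s \<le> mdeg \<alpha>"
      moreover from this have "lookup m \<alpha> = 0"
        unfolding m_def lookup_sum
        by (intro sum.neutral) (auto simp: lookup_pscale monomial_def lookup_single upto_deg_def when_def)
      ultimately show False by (simp add: in_keys_iff)
    qed
    moreover have "r = (r - m) + m" by simp
    ultimately show "p - (\<Sum>b\<in>monomial ` ?Es. pscale (c b) b) \<in> chart_kernel D s"
      unfolding r by blast
  next
    fix c' assume c': "(\<forall>b. b \<notin> monomial ` ?Es \<longrightarrow> c' b = 0) \<and>
      p - (\<Sum>b\<in>monomial ` ?Es. pscale (c' b) b) \<in> chart_kernel D s"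
    have "c' (monomial \<gamma>) = dual_apply (\<Lambda> \<gamma>) p" if "\<gamma> \<in> ?Es" for \<gamma>
    proof -
      have "dual_apply (\<Lambda> \<gamma>) (p - (\<Sum>\<beta>\<in>?Es. pscale (c' (monomial \<beta>)) (monomial \<beta>))) = 0"
        using chart_kernel_dual_apply[OF conjunct2[OF c'] D(5) deg] that sub
        by (auto simp: sum_monomial_image)
      moreover have "(\<Sum>\<beta>\<in>?Es. c' (monomial \<beta>) * ev (\<Lambda> \<gamma>) \<beta>) = (\<Sum>\<beta>\<in>?Es. if \<gamma> = \<beta> then c' (monomial \<beta>) else 0)"
        by (rule sum.cong) (simp_all add: D(7)[OF subsetD[OF sub that] subsetD[OF sub]])
      ultimately show ?thesis
        using that fin by (simp add: linfun_diff[OF linfun_dual_apply] dual_apply_sum_monomials)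
    qed
    then show "c' = c" using c' c by (auto simp: fun_eq_iff c_def)
  qed
qed

text \<open>A dual basis bounds degrees by t, whereas \<open>Hilb\<close> asks for the bound card -
  1; the last assumption compares the two.\<close>

lemma dual_basis_Hilb_B:
  assumes "dual_basis (upto_deg E t) D \<Lambda>" "\<And>k. pdiff k ` D \<subseteq> D" "t < card (upto_deg E t)"
  shows "D \<in> Hilb_B E t"
proof -
  have "polys_le t \<subseteq> polys_le (card (upto_deg E t) - 1)" by (rule polys_le_mono) (use assms in auto)
  then show ?thesis
    using dual_basis_quotient_basis[OF assms(1)] dual_basis_polys_le[OF assms(1)]
      dual_basis_dim[OF assms(1)] dual_basisD(1)[OF assms(1)] assms(2)
    unfolding Hilb_B_def Hilb_def Grass_def by auto
qed

lemma Hilb_B_D: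
  assumes "D \<in> Hilb_B E t"
  shows "pm.subspace D" "pm.dim D = card (upto_deg E t)" "pdiff k ` D \<subseteq> D"
    "D \<subseteq> polys_le (card (upto_deg E t) - 1)"
    "\<And>s. s \<le> t \<Longrightarrow> quotient_basis (monomial ` upto_deg E s) (chart_kernel D s)"
  using assms by (auto simp: Hilb_B_def Hilb_def Grass_def)

text \<open>By the uniqueness in \<open>quotient_basis\<close>, no combination of the monomials of degree at most
  \<open>s\<close> vanishes on the elements of degree at most \<open>s\<close>: those of higher degree are killed by
  correcting with monomials of degree above \<open>s\<close>.\<close>

lemma quotient_basis_dual_fam:
  fixes E :: "'n::{finite,linorder} expo set"
  assumes E: "finite E" and D: "pm.subspace D" "fin_dim D"
    and q: "quotient_basis (monomial ` upto_deg E s) (chart_kernel D s)"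
  shows "\<exists>u. dual_fam (\<lambda>\<gamma> p. ev p \<gamma>) u (upto_deg E s) (D \<inter> polys_le s) \<and>
    separates (\<lambda>\<gamma> p. ev p \<gamma>) (upto_deg E s) (D \<inter> polys_le s)"
proof -
  let ?Es = "upto_deg E s" and ?Ds = "D \<inter> polys_le s"
  let ?\<phi> = "\<lambda>\<gamma> p :: ('n, complex) mpol. ev p \<gamma>"
  have Ds: "pm.subspace ?Ds" "fin_dim ?Ds"
    using D pm.subspace_inter[OF D(1) polys_le_subspace] fin_dim_subset[OF D(2)] by auto
  have fin: "finite ?Es" using E by (auto simp: upto_deg_def)
  have "separates ?\<phi> ?Es ?Ds"
    unfolding separates_def
  proof (intro ballI impI)
    fix x assume x: "x \<in> ?Ds" "\<forall>\<gamma>\<in>?Es. ev x \<gamma> = 0"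
    show "x = 0"
    proof (rule ev_eqI)
      fix \<alpha>
      obtain c where c: "monomial \<alpha> - (\<Sum>b\<in>monomial ` ?Es. pscale (c b) b) \<in> chart_kernel D s"
        using q unfolding quotient_basis_def by blast
      have "dual_apply x (monomial \<alpha> - (\<Sum>b\<in>monomial ` ?Es. pscale (c b) b)) = 0"
        by (rule chart_kernel_dual_apply[OF c]) (use x in auto)
      then show "ev x \<alpha> = ev 0 \<alpha>"
        using x(2) by (simp add: sum_monomial_image linfun_diff[OF linfun_dual_apply]
            dual_apply_sum_monomials dual_apply_monomial ev_def)
    qed
  qed
  then obtain I u where I: "I \<subseteq> ?Es" "dual_fam ?\<phi> u I ?Ds" "separates ?\<phi> I ?Ds"
    using dual_fam_exists[OF Ds, of ?Es ?\<phi>] linfun_ev by blast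
  \<comment> \<open>The annihilator of \<open>?Ds\<close> is no larger than the chart kernel. The
    coordinates I of \<open>?Ds\<close> are extended to coordinates J of D by exponents of degree
    above s, and the values of p on the added dual vectors are removed by monomials at these
    exponents.\<close>
  have perp: "p \<in> chart_kernel D s" if p: "\<And>\<Lambda>. \<Lambda> \<in> ?Ds \<Longrightarrow> dual_apply \<Lambda> p = 0" for p
  proof -
    let ?S = "I \<union> {\<alpha>. s < mdeg \<alpha>}"
    have "separates ?\<phi> ?S D"
      unfolding separates_def
    proof (intro ballI impI)
      fix x assume x: "x \<in> D" "\<forall>i\<in>?S. ev x i = 0"
      then have "x \<in> ?Ds" by (auto simp: polys_le_iff ev_eq_0)
      then show "x = 0" using I(3) x(2) unfolding separates_def by blast
    qed
    moreover have "dual_fam ?\<phi> u I D" using I(2) by (auto simp: dual_fam_def)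
    ultimately obtain J w where J: "I \<subseteq> J" "J \<subseteq> ?S" "dual_fam ?\<phi> w J D" "separates ?\<phi> J D"
      using dual_fam_extend[OF D, of ?S ?\<phi> u I] linfun_ev by blast
    have finJ: "finite J" using J(3) by (simp add: dual_fam_def)
    \<comment> \<open>Extending the family does not change the vectors indexed by I: u i has degree
      at most s, so it vanishes at the exponents of J - I.\<close>
    have wI: "w i \<in> ?Ds" if "i \<in> I" for i
    proof -
      have ui: "u i \<in> D" "u i \<in> polys_le s" using I(2) that by (auto simp: dual_fam_def)
      have "(\<Sum>j\<in>J. pscale (ev (u i) j) (w j)) = (\<Sum>j\<in>J. if j = i then w j else 0)"
      proof (rule sum.cong[OF refl])
        fix j assume j: "j \<in> J"
        show "pscale (ev (u i) j) (w j) = (if j = i then w j else 0)"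
        proof (cases "j \<in> I")
          case True
          then show ?thesis using I(2) that by (auto simp: dual_fam_def)
        next
          case False
          then have "ev (u i) j = 0" using J(2) j ui by (auto simp: polys_le_iff ev_eq_0)
          then show ?thesis using that False by auto
        qed
      qed
      also have "\<dots> = w i" using finJ J(1) that by auto
      finally have "w i = u i" using dual_fam_expand[OF J(3) D(1) J(4) ui(1)] by simp
      then show ?thesis using ui by simp
    qed
    define m where "m = (\<Sum>j\<in>J - I. pscale (dual_apply (w j) p) (monomial j))"
    have wm: "dual_apply (w i) m = (if i \<in> I then 0 else dual_apply (w i) p)" if "i \<in> J" for i
    proof -
      have "(\<Sum>j\<in>J - I. dual_apply (w j) p * ev (w i) j) = (\<Sum>j\<in>J - I. if j = i then dual_apply (w j) p else 0)"
        by (rule sum.cong) (use J(3) that in \<open>auto simp: dual_fam_def\<close>)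
      then show ?thesis using finJ that unfolding m_def dual_apply_sum_monomials by auto
    qed
    have "dual_apply (w i) (p - m) = 0" if "i \<in> J" for i
      using wm[OF that] p[OF wI] by (cases "i \<in> I") (auto simp: linfun_diff[OF linfun_dual_apply])
    then have "p - m \<in> perp D"
      using dual_fam_dual_apply[OF J(3) D(1) J(4)] by (auto simp: perp_def)
    moreover have "m \<in> max_ideal_power (Suc s)"
    proof (rule high_degree_in_max_ideal_power, rule ballI, rule ccontr)
      fix \<alpha> assume "\<alpha> \<in> keys m" "\<not> Suc s \<le> mdeg \<alpha>"
      moreover from this have "lookup m \<alpha> = 0"
        unfolding m_def lookup_sum using J(2)
        by (intro sum.neutral) (auto simp: lookup_pscale monomial_def lookup_single when_def)
      ultimately show False by (simp add: in_keys_iff)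
    qed
    moreover have "p = (p - m) + m" by simp
    ultimately show ?thesis by blast
  qed
  have "I = ?Es"
  proof (rule ccontr)
    assume "I \<noteq> ?Es"
    then obtain \<gamma> where \<gamma>: "\<gamma> \<in> ?Es" "\<gamma> \<notin> I" using I(1) by blast
    \<comment> \<open>On \<open>?Ds\<close> the value at \<gamma> is the combination of the values
      at I with coefficients \<open>ev (u \<beta>) \<gamma>\<close>. This relation is a nonzero
      combination of monomials in the chart kernel, against the uniqueness of the representation of
      0.\<close>
    define f where "f \<beta> = (if \<beta> = \<gamma> then -1 else if \<beta> \<in> I then ev (u \<beta>) \<gamma> else 0)" for \<beta>
    define c where "c b = (if b \<in> monomial ` ?Es then f (inv_into UNIV monomial b) else 0)" for b
    have c: "c (monomial \<beta>) = f \<beta>" if "\<beta> \<in> ?Es" for \<beta>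
      using that by (simp add: c_def inv_f_f[OF inj_monomial])
    define Q where "Q c \<longleftrightarrow> (\<forall>b. b \<notin> monomial ` ?Es \<longrightarrow> c b = 0) \<and>
      0 - (\<Sum>b\<in>monomial ` ?Es. pscale (c b) b) \<in> chart_kernel D s" for c
    have "0 - (\<Sum>b\<in>monomial ` ?Es. pscale (c b) b) \<in> chart_kernel D s"
    proof (rule perp)
      fix \<Lambda> assume \<Lambda>: "\<Lambda> \<in> ?Ds"
      have "ev \<Lambda> \<gamma> = ev (\<Sum>i\<in>I. pscale (ev \<Lambda> i) (u i)) \<gamma>"
        using dual_fam_expand[OF I(2) Ds(1) I(3) \<Lambda>] by (rule arg_cong)
      then have e: "ev \<Lambda> \<gamma> = (\<Sum>i\<in>I. ev \<Lambda> i * ev (u i) \<gamma>)"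
        by (simp add: linfun_sum[where \<phi> = "?\<phi> \<gamma>", OF linfun_ev] linfun_scale[where \<phi> = "?\<phi> \<gamma>", OF linfun_ev])
      have "(\<Sum>\<beta>\<in>?Es. c (monomial \<beta>) * ev \<Lambda> \<beta>) = (\<Sum>\<beta>\<in>insert \<gamma> I. f \<beta> * ev \<Lambda> \<beta>)"
        using I(1) \<gamma> fin c by (intro sum.mono_neutral_cong_right) (auto simp: f_def)
      also have "\<dots> = - ev \<Lambda> \<gamma> + (\<Sum>\<beta>\<in>I. f \<beta> * ev \<Lambda> \<beta>)"
        using \<gamma> I(2) by (simp add: dual_fam_def f_def)
      also have "(\<Sum>\<beta>\<in>I. f \<beta> * ev \<Lambda> \<beta>) = (\<Sum>i\<in>I. ev \<Lambda> i * ev (u i) \<gamma>)"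
        using \<gamma> by (intro sum.cong) (auto simp: f_def)
      finally show "dual_apply \<Lambda> (0 - (\<Sum>b\<in>monomial ` ?Es. pscale (c b) b)) = 0"
        using e by (simp add: sum_monomial_image linfun_diff[OF linfun_dual_apply]
            linfun_zero[OF linfun_dual_apply] linfun_uminus[OF linfun_dual_apply] dual_apply_sum_monomials)
    qed
    then have "Q c" by (simp add: Q_def c_def)
    moreover have "0 - (\<Sum>b\<in>monomial ` ?Es. pscale ((\<lambda>_. 0) b) b) \<in> chart_kernel D s"
      by (rule perp) (simp add: linfun_zero[OF linfun_dual_apply])
    then have "Q (\<lambda>_. 0)" by (simp add: Q_def)
    moreover have "\<exists>!c. Q c"
      using q unfolding quotient_basis_def Q_def by (rule spec)
    ultimately have "c = (\<lambda>_. 0)" by blast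
    then have "f \<gamma> = 0" using c[OF \<gamma>(1)] by simp
    then show False by (simp add: f_def)
  qed
  with I show ?thesis by auto
qed

text \<open>The level s = \<open>mdeg \<beta>\<close> of the filtration supplies the element for
  \<beta>, already with the right degree bound. Its values at exponents of higher degree vanish for
  degree reasons, so the levels fit together.\<close>

lemma Hilb_B_dual_basis:
  fixes E :: "'n::{finite,linorder} expo set"
  assumes "D \<in> Hilb_B E t" "finite E"
  shows "\<exists>\<Lambda>. dual_basis (upto_deg E t) D \<Lambda>"
proof -
  let ?\<phi> = "\<lambda>\<gamma> p :: ('n, complex) mpol. ev p \<gamma>"
  note D = Hilb_B_D[OF assms(1)]
  have fd: "fin_dim D" using fin_dim_subset[OF polys_le_fin_dim D(4)] .
  have "\<forall>s\<le>t. \<exists>u. dual_fam ?\<phi> u (upto_deg E s) (D \<inter> polys_le s)"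
    using quotient_basis_dual_fam[OF assms(2) D(1) fd D(5)] by blast
  then obtain u where u: "\<And>s. s \<le> t \<Longrightarrow> dual_fam ?\<phi> (u s) (upto_deg E s) (D \<inter> polys_le s)"
    by metis
  define \<Lambda> where "\<Lambda> \<beta> = u (mdeg \<beta>) \<beta>" for \<beta>
  have \<Lambda>: "\<Lambda> \<beta> \<in> D \<inter> polys_le (mdeg \<beta>)" if "\<beta> \<in> upto_deg E t" for \<beta>
    using u[of "mdeg \<beta>"] that by (auto simp: dual_fam_def upto_deg_def \<Lambda>_def)
  have "ev (\<Lambda> \<beta>) \<gamma> = (if \<beta> = \<gamma> then 1 else 0)" if "\<beta> \<in> upto_deg E t" "\<gamma> \<in> upto_deg E t" for \<beta> \<gamma>
  proof (cases "mdeg \<gamma> \<le> mdeg \<beta>")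
    case True
    then show ?thesis using u[of "mdeg \<beta>"] that by (auto simp: dual_fam_def upto_deg_def \<Lambda>_def)
  next
    case False
    then show ?thesis using \<Lambda>[OF that(1)] by (auto simp: polys_le_iff ev_def)
  qed
  then have df: "dual_fam ?\<phi> \<Lambda> (upto_deg E t) D"
    using \<Lambda> assms(2) linfun_ev by (auto simp: dual_fam_def upto_deg_def)
  moreover have "separates ?\<phi> (upto_deg E t) D"
    by (rule dual_fam_separates[OF df D(1) fd]) (simp add: D(2))
  ultimately show ?thesis using D(1) \<Lambda> unfolding dual_basis_def by blast
qed


section \<open>Linear systems depending polynomially on parameters\<close>

lemma polyfun_cofactor:
  assumes K: "0 \<in> K" "1 \<in> K" "-1 \<in> K"
    and M: "\<And>i j. i < n \<Longrightarrow> j < n \<Longrightarrow> M i j \<in> polyfun K V" and pq: "p < n" "q < n"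
  shows "(\<lambda>c. cofactor (mat n n (\<lambda>(i, j). M i j c)) p q) \<in> polyfun K V"
proof -
  let ?s = "\<lambda>p i. if i < p then i else Suc i"
  have "mat_delete (mat n n (\<lambda>(i, j). M i j c)) p q = mat (n - 1) (n - 1) (\<lambda>(i, j). M (?s p i) (?s q j) c)" for c
    unfolding mat_delete_def by (rule eq_matI) auto
  moreover have "(-1) ^ (p + q) \<in> K" using K by (cases "even (p + q)") auto
  ultimately show ?thesis
    unfolding cofactor_def by (auto intro!: polyfun.mult polyfun.const polyfun_det K M)
qed

lemma subspace_keys: "pm.subspace {p :: 'a \<Rightarrow>\<^sub>0 complex. keys p \<subseteq> J}"
proof -
  have "{p :: 'a \<Rightarrow>\<^sub>0 complex. keys p \<subseteq> J} = {p. \<forall>a. a \<notin> J \<longrightarrow> lookup p a = 0}"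
    by (auto simp: in_keys_iff)
  then show ?thesis by (simp add: pm.subspace_def lookup_add lookup_pscale)
qed

lemma dim_keys:
  assumes "finite J"
  shows "pm.dim {p :: 'a \<Rightarrow>\<^sub>0 complex. keys p \<subseteq> J} = card J"
proof (rule dual_fam_dim[OF _ subspace_keys])
  show "dual_fam (\<lambda>j p. lookup p j) (\<lambda>j. Poly_Mapping.single j 1) J {p :: 'a \<Rightarrow>\<^sub>0 complex. keys p \<subseteq> J}"
    using assms linfun_lookup by (auto simp: dual_fam_def lookup_single when_def)
  show "separates (\<lambda>j p. lookup p j) J {p :: 'a \<Rightarrow>\<^sub>0 complex. keys p \<subseteq> J}"
    by (auto simp: separates_def in_keys_iff intro!: poly_mapping_eqI)
qed

text \<open>Cramer's rule for a square subsystem, consisting of equations and prescribed values, that is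
  regular at the parameter \<open>x0\<close>.\<close>

lemma polyfun_solve:
  fixes a :: "'r \<Rightarrow> 'j \<Rightarrow> ('v \<Rightarrow> complex) \<Rightarrow> complex"
  assumes K: "0 \<in> K" "1 \<in> K" "-1 \<in> K" and J: "finite J" "A \<subseteq> J"
    and a: "\<And>r j. r \<in> R \<Longrightarrow> j \<in> J \<Longrightarrow> a r j \<in> polyfun K V"
    and inj: "\<And>\<xi>. (\<And>r. r \<in> R \<Longrightarrow> (\<Sum>j\<in>J. a r j x0 * \<xi> j) = 0) \<Longrightarrow> (\<And>j. j \<in> A \<Longrightarrow> \<xi> j = 0) \<Longrightarrow>
      (\<And>j. j \<in> J \<Longrightarrow> \<xi> j = 0)"
  shows "\<exists>\<delta> N. \<delta> \<in> polyfun K V \<and> (\<forall>i\<in>A. \<forall>j\<in>J. N i j \<in> polyfun K V) \<and> \<delta> x0 \<noteq> 0 \<and>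
    (\<forall>x \<xi>. (\<forall>r\<in>R. (\<Sum>j\<in>J. a r j x * \<xi> j) = 0) \<longrightarrow> (\<forall>j\<in>J. \<delta> x * \<xi> j = (\<Sum>i\<in>A. N i j x * \<xi> i)))"
proof -
  let ?D = "{p :: 'j \<Rightarrow>\<^sub>0 complex. keys p \<subseteq> J}"
  have D: "pm.subspace ?D" "fin_dim ?D"
    using fin_dim_keys[OF J(1)] subspace_keys by auto
  \<comment> \<open>Rows tagged \<open>Inl\<close> are the equations; a row tagged
    \<open>Inr\<close> reads off the unknown i, whose value is regarded as prescribed.\<close>
  define b where "b i j x = (case i of Inl r \<Rightarrow> a r j x | Inr i \<Rightarrow> if i = j then 1 else 0)" for i :: "'r + 'j" and j x
  define \<phi> where "\<phi> i p = (\<Sum>j\<in>J. b i j x0 * lookup p j)" for i p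
  let ?S = "Inl ` R \<union> Inr ` A :: ('r + 'j) set"
  have lin: "linfun (\<phi> i)" for i
    by (simp add: linfun_def \<phi>_def lookup_add lookup_pscale sum.distrib sum_distrib_left algebra_simps)
  have "separates \<phi> ?S ?D"
    unfolding separates_def
  proof (intro ballI impI)
    fix p assume p: "p \<in> ?D" "\<forall>i\<in>?S. \<phi> i p = 0"
    have "lookup p j = 0" if "j \<in> J" for j
    proof (rule inj[OF _ _ that])
      fix r assume "r \<in> R"
      then have "\<phi> (Inl r) p = 0" using p(2) by auto
      then show "(\<Sum>j\<in>J. a r j x0 * lookup p j) = 0" by (simp add: \<phi>_def b_def)
    next
      fix i assume i: "i \<in> A"
      then have "\<phi> (Inr i) p = 0" using p(2) by auto
      moreover have "\<phi> (Inr i) p = (\<Sum>j\<in>J. if i = j then lookup p j else 0)"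
        unfolding \<phi>_def b_def by (rule sum.cong) auto
      ultimately show "lookup p i = 0" using J i by auto
    qed
    then show "p = 0" using p(1) by (intro poly_mapping_eqI) (auto simp: in_keys_iff)
  qed
  then obtain I u where I: "I \<subseteq> ?S" "dual_fam \<phi> u I ?D" "separates \<phi> I ?D"
    using dual_fam_exists[OF D, of ?S \<phi>] lin by blast
  have "pm.dim ?D = card J" by (rule dim_keys[OF J(1)])
  then have card: "card I = card J" using dual_fam_dim[OF I(2) D(1) I(3)] by simp
  define n where "n = card J"
  obtain js where js: "set js = J" "distinct js" using finite_distinct_list[OF J(1)] by blast
  obtain rs where iss: "set rs = I" "distinct rs" using finite_distinct_list[of I] I(2) by (auto simp: dual_fam_def)
  have len: "length js = n" "length rs = n" using js iss card by (auto simp: n_def distinct_card[symmetric])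
  have isin: "rs ! p \<in> ?S" if "p < n" for p using iss len I(1) that nth_mem[of p rs] by auto
  have jsin: "js ! p \<in> J" if "p < n" for p using js len that nth_mem[of p js] by auto
  have sumJ: "(\<Sum>j\<in>J. f j) = (\<Sum>q<n. f (js ! q))" for f :: "'j \<Rightarrow> complex"
    using sum.reindex_bij_betw[OF bij_betw_nth[OF js(2) refl refl], of f] js(1) len by simp
  define T where "T p q x = b (rs ! p) (js ! q) x" for p q x
  define A' where "A' x = mat n n (\<lambda>(p, q). T p q x)" for x
  have T: "T p q \<in> polyfun K V" if "p < n" "q < n" for p q
  proof (cases "rs ! p")
    case (Inl r)
    then have "T p q = a r (js ! q)" "r \<in> R"
      using isin[OF that(1)] by (auto simp: T_def b_def fun_eq_iff)
    then show ?thesis using a jsin[OF that(2)] by simp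
  next
    case (Inr i)
    then have "T p q = (\<lambda>_. if i = js ! q then 1 else 0)"
      by (auto simp: T_def b_def fun_eq_iff)
    then show ?thesis using K by (auto intro: polyfun.const)
  qed
  define \<delta> where "\<delta> x = det (A' x)" for x
  \<comment> \<open>Entries of the adjugate: q is the position of the unknown j, and p that of the
    row prescribing i. If this row is not part of the square subsystem, the inner sum is empty and i
    contributes 0.\<close>
  define N where "N i j x = (\<Sum>q | q < n \<and> js ! q = j. \<Sum>p | p < n \<and> rs ! p = Inr i. cofactor (A' x) p q)" for i j x
  \<comment> \<open>The dual vectors of the chosen functionals are the columns of an inverse at x0,
    whence the determinant is nonzero there.\<close>
  have "left_inv n (\<lambda>p q. T p q x0) (\<lambda>q p. lookup (u (rs ! p)) (js ! q))"
    unfolding left_inv_def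
  proof (intro allI impI)
    fix p p' assume p: "p < n" "p' < n"
    have "(\<Sum>q<n. T p q x0 * lookup (u (rs ! p')) (js ! q)) = \<phi> (rs ! p) (u (rs ! p'))"
      by (simp add: \<phi>_def sumJ T_def)
    also have "\<dots> = (if rs ! p' = rs ! p then 1 else 0)"
      using I(2) iss len p nth_mem[of p rs] nth_mem[of p' rs] by (auto simp: dual_fam_def)
    also have "\<dots> = (if p = p' then 1 else 0)"
      using nth_eq_iff_index_eq[OF iss(2)] len p by auto
    finally show "(\<Sum>q<n. T p q x0 * lookup (u (rs ! p')) (js ! q)) = (if p = p' then 1 else 0)" .
  qed
  then have "\<delta> x0 \<noteq> 0" unfolding \<delta>_def A'_def by (rule left_inv_det(2))
  moreover have "\<delta> \<in> polyfun K V"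
    unfolding \<delta>_def A'_def by (intro polyfun_det K) (simp add: T)
  moreover have "N i j \<in> polyfun K V" for i j
    unfolding N_def A'_def by (intro polyfun_sum K polyfun_cofactor T) auto
  moreover have "\<delta> x * \<xi> j = (\<Sum>i\<in>A. N i j x * \<xi> i)"
    if sol: "\<forall>r\<in>R. (\<Sum>j\<in>J. a r j x * \<xi> j) = 0" and j: "j \<in> J" for x \<xi> j
  proof -
    obtain q where q: "q < n" "js ! q = j" using j js len by (metis in_set_conv_nth)
    have q_unique: "{q'. q' < n \<and> js ! q' = j} = {q}"
      using q nth_eq_iff_index_eq[OF js(2)] len by auto
    have A': "A' x \<in> carrier_mat n n" by (simp add: A'_def)
    \<comment> \<open>The right-hand side of the square system: 0 in the rows of equations and \<xi>
      i in the row prescribing i.\<close>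
    define w where "w p = (\<Sum>i\<in>A. if rs ! p = Inr i then \<xi> i else 0)" for p
    have Tw: "(\<Sum>q<n. T p q x * \<xi> (js ! q)) = w p" if p: "p < n" for p
    proof -
      have "(\<Sum>q<n. T p q x * \<xi> (js ! q)) = (\<Sum>j\<in>J. b (rs ! p) j x * \<xi> j)" by (simp add: sumJ T_def)
      also have "\<dots> = w p"
      proof (cases "rs ! p")
        case (Inl r)
        then have "r \<in> R" using isin[OF p] by auto
        then show ?thesis using sol Inl by (simp add: b_def w_def)
      next
        case (Inr i)
        then have i: "i \<in> A" using isin[OF p] by auto
        have "(\<Sum>j\<in>J. b (rs ! p) j x * \<xi> j) = (\<Sum>j\<in>J. if i = j then \<xi> j else 0)"
          by (rule sum.cong) (auto simp: b_def Inr)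
        also have "\<dots> = \<xi> i" using i J by auto
        also have "\<xi> i = w p" using i J finite_subset[OF J(2,1)] by (simp add: w_def Inr)
        finally show ?thesis .
      qed
      finally show ?thesis .
    qed
    have "\<delta> x * \<xi> j = (\<Sum>q'<n. (if q = q' then \<delta> x else 0) * \<xi> (js ! q'))"
      using q by (simp add: if_distrib[where f = "\<lambda>z. z * _"] cong: if_cong)
    also have "\<dots> = (\<Sum>q'<n. (adj_mat (A' x) * A' x) $$ (q, q') * \<xi> (js ! q'))"
      unfolding adj_mat(3)[OF A'] using q by (intro sum.cong) (auto simp: \<delta>_def)
    also have "\<dots> = (\<Sum>q'<n. (\<Sum>p<n. cofactor (A' x) p q * T p q' x) * \<xi> (js ! q'))"
      using q by (intro sum.cong) (auto simp: adj_mat_def A'_def scalar_prod_def atLeast0LessThan)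
    also have "\<dots> = (\<Sum>p<n. cofactor (A' x) p q * (\<Sum>q'<n. T p q' x * \<xi> (js ! q')))"
      unfolding sum_distrib_left sum_distrib_right by (subst sum.swap) (simp add: mult.assoc)
    also have "\<dots> = (\<Sum>p<n. cofactor (A' x) p q * w p)" by (simp add: Tw)
    also have "\<dots> = (\<Sum>i\<in>A. \<Sum>p<n. if rs ! p = Inr i then cofactor (A' x) p q * \<xi> i else 0)"
      unfolding w_def sum_distrib_left by (subst sum.swap) (simp add: if_distrib cong: if_cong)
    also have "\<dots> = (\<Sum>i\<in>A. N i j x * \<xi> i)"
    proof (rule sum.cong[OF refl])
      fix i
      have "(\<Sum>p<n. if rs ! p = Inr i then cofactor (A' x) p q * \<xi> i else 0) =
          (\<Sum>p | p < n \<and> rs ! p = Inr i. cofactor (A' x) p q * \<xi> i)"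
        by (rule sum.mono_neutral_cong_right) auto
      then show "(\<Sum>p<n. if rs ! p = Inr i then cofactor (A' x) p q * \<xi> i else 0) = N i j x * \<xi> i"
        unfolding N_def q_unique by (simp add: sum_distrib_right)
    qed
    finally show ?thesis .
  qed
  ultimately show ?thesis by (intro exI[of _ \<delta>] exI[of _ N]) auto
qed

section \<open>Spaces of integrals\<close>

lemma integrals_subspace:
  assumes "pm.subspace D"
  shows "pm.subspace (integrals t D)"
  using assms polys_le_subspace[of t]
  unfolding pm.subspace_def integrals_def by (auto simp: pdiff_add pdiff_scale)

lemma integrals_fin_dim: "fin_dim (integrals t D :: ('n::finite, complex) mpol set)"
  by (rule fin_dim_subset[OF polys_le_fin_dim]) (auto simp: integrals_def)

lemma span_image_sum:
  assumes "finite I" "x \<in> pm.span (v ` I)"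
  shows "\<exists>c. x = (\<Sum>i\<in>I. pscale (c i) (v i))"
proof -
  have "pm.span (v ` I) \<subseteq> {x. \<exists>c. x = (\<Sum>i\<in>I. pscale (c i) (v i))}"
  proof (rule pm.span_minimal)
    show "v ` I \<subseteq> {x. \<exists>c. x = (\<Sum>i\<in>I. pscale (c i) (v i))}"
    proof clarify
      fix i assume i: "i \<in> I"
      have "v i = (\<Sum>j\<in>I. pscale (if j = i then 1 else 0) (v j))"
        by (rule poly_mapping_eqI) (use i assms(1) in \<open>simp add: lookup_sum lookup_pscale if_distrib[where f = "\<lambda>z. z * _"] cong: if_cong\<close>)
      then show "\<exists>c. v i = (\<Sum>j\<in>I. pscale (c j) (v j))"
        by (intro exI[of _ "\<lambda>j. if j = i then 1 else 0"])
    qed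
    show "pm.subspace {x. \<exists>c. x = (\<Sum>i\<in>I. pscale (c i) (v i))}"
      unfolding pm.subspace_def
    proof (intro conjI ballI allI)
      show "0 \<in> {x. \<exists>c. x = (\<Sum>i\<in>I. pscale (c i) (v i))}"
        by (intro CollectI exI[of _ "\<lambda>_. 0"]) simp
    next
      fix x y assume "x \<in> {x. \<exists>c. x = (\<Sum>i\<in>I. pscale (c i) (v i))}" "y \<in> {x. \<exists>c. x = (\<Sum>i\<in>I. pscale (c i) (v i))}"
      then obtain c d where "x = (\<Sum>i\<in>I. pscale (c i) (v i))" "y = (\<Sum>i\<in>I. pscale (d i) (v i))" by auto
      then show "x + y \<in> {x. \<exists>c. x = (\<Sum>i\<in>I. pscale (c i) (v i))}"
        by (intro CollectI exI[of _ "\<lambda>i. c i + d i"]) (simp add: pm.scale_left_distrib sum.distrib)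
    next
      fix r x assume "x \<in> {x. \<exists>c. x = (\<Sum>i\<in>I. pscale (c i) (v i))}"
      then obtain c where "x = (\<Sum>i\<in>I. pscale (c i) (v i))" by auto
      then show "pscale r x \<in> {x. \<exists>c. x = (\<Sum>i\<in>I. pscale (c i) (v i))}"
        by (intro CollectI exI[of _ "\<lambda>i. r * c i"]) (simp add: pm.scale_sum_right)
    qed
  qed
  then show ?thesis using assms(2) by blast
qed

definition from_coeffs :: "'a set \<Rightarrow> ('a \<Rightarrow> complex) \<Rightarrow> ('a \<Rightarrow>\<^sub>0 complex)"
  where "from_coeffs S f = (\<Sum>a\<in>S. Poly_Mapping.single a (f a))"

lemma lookup_from_coeffs: "finite S \<Longrightarrow> lookup (from_coeffs S f) a = (if a \<in> S then f a else 0)"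
  by (simp add: from_coeffs_def lookup_sum lookup_single when_def)

text \<open>The unknowns are the coefficients of \<Lambda> (tag \<open>Inl\<close>) and those of its
  partial derivatives in terms of the spanning family v (tag \<open>Inr\<close>); the row (k,
  \<alpha>) compares coefficients at \<alpha>. The matrix has integers and negated entries of v, so
  Cramer's rule stays over the rationals. At v0 the values at A determine \<Lambda> by
  \<open>separates\<close>, and then independence determines the other unknowns.\<close>

lemma integrals_solve:
  fixes v0 :: "'i \<Rightarrow> ('n::{finite,linorder}, complex) mpol"
  assumes I: "finite I" "\<And>i. i \<in> I \<Longrightarrow> v0 i \<in> polys_le t"
    and ind: "\<And>f i. (\<Sum>i\<in>I. pscale (f i) (v0 i)) = 0 \<Longrightarrow> i \<in> I \<Longrightarrow> f i = 0"
    and A: "A \<subseteq> {\<alpha>. mdeg \<alpha> \<le> Suc t}" "separates (\<lambda>\<alpha> p. lookup p \<alpha>) A (integrals (Suc t) (pm.span (v0 ` I)))"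
  shows "\<exists>\<delta> N. \<delta> \<in> polyfun \<rat> (I \<times> UNIV) \<and>
    (\<forall>\<alpha>\<in>A. \<forall>\<beta>. N \<alpha> \<beta> \<in> polyfun \<rat> (I \<times> UNIV)) \<and> \<delta> (\<lambda>(i, \<alpha>). lookup (v0 i) \<alpha>) \<noteq> 0 \<and>
    (\<forall>v. (\<forall>i\<in>I. v i \<in> polys_le t) \<longrightarrow> (\<forall>\<Lambda>\<in>integrals (Suc t) (pm.span (v ` I)). \<forall>\<beta>.
      \<delta> (\<lambda>(i, \<alpha>). lookup (v i) \<alpha>) * lookup \<Lambda> \<beta> =
      (\<Sum>\<alpha>\<in>A. N \<alpha> \<beta> (\<lambda>(i, \<alpha>). lookup (v i) \<alpha>) * lookup \<Lambda> \<alpha>)))"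
proof -
  let ?Mt = "{\<alpha> :: 'n expo. mdeg \<alpha> \<le> Suc t}"
  have fM: "finite ?Mt" by (rule finite_mdeg_le)
  define J where "J = Inl ` ?Mt \<union> Inr ` ((UNIV :: 'n set) \<times> I)"
  have J: "finite J" using fM I(1) by (auto simp: J_def)
  define R where "R = {(k :: 'n, \<alpha> :: 'n expo). mdeg \<alpha> \<le> t}"
  define a where "a r j x = (case r of (k, \<alpha>) \<Rightarrow> case j of
      Inl \<beta> \<Rightarrow> if \<beta> = \<alpha> + unit_expo k then of_nat (lookup \<alpha> k + 1) else 0
    | Inr (l, i) \<Rightarrow> if l = k then - x (i, \<alpha>) else 0)"
    for r :: "'n \<times> 'n expo" and j :: "'n expo + 'n \<times> 'i" and x :: "'i \<times> 'n expo \<Rightarrow> complex"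
  have row: "(\<Sum>j\<in>J. a (k, \<alpha>) j x * \<xi> j) =
      of_nat (lookup \<alpha> k + 1) * \<xi> (Inl (\<alpha> + unit_expo k)) - (\<Sum>i\<in>I. x (i, \<alpha>) * \<xi> (Inr (k, i)))"
    if "mdeg \<alpha> \<le> t" for k \<alpha> x and \<xi> :: "_ \<Rightarrow> complex"
  proof -
    have "(\<Sum>j\<in>J. a (k, \<alpha>) j x * \<xi> j) =
        (\<Sum>\<beta>\<in>?Mt. a (k, \<alpha>) (Inl \<beta>) x * \<xi> (Inl \<beta>)) + (\<Sum>(l, i)\<in>UNIV \<times> I. a (k, \<alpha>) (Inr (l, i)) x * \<xi> (Inr (l, i)))"
      unfolding J_def using fM I(1)
      by (subst sum.union_disjoint) (auto simp: sum.reindex split_def)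
    also have "(\<Sum>\<beta>\<in>?Mt. a (k, \<alpha>) (Inl \<beta>) x * \<xi> (Inl \<beta>)) =
        (\<Sum>\<beta>\<in>?Mt. if \<beta> = \<alpha> + unit_expo k then of_nat (lookup \<alpha> k + 1) * \<xi> (Inl \<beta>) else 0)"
      by (rule sum.cong) (auto simp: a_def)
    also have "\<dots> = of_nat (lookup \<alpha> k + 1) * \<xi> (Inl (\<alpha> + unit_expo k))"
      using that fM by simp
    also have "(\<Sum>(l, i)\<in>UNIV \<times> I. a (k, \<alpha>) (Inr (l, i)) x * \<xi> (Inr (l, i))) =
        (\<Sum>l\<in>UNIV. if l = k then - (\<Sum>i\<in>I. x (i, \<alpha>) * \<xi> (Inr (k, i))) else 0)"
      unfolding sum.cartesian_product[symmetric] by (rule sum.cong) (auto simp: a_def sum_negf)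
    finally show ?thesis by simp
  qed
  have "\<exists>\<delta> N. \<delta> \<in> polyfun \<rat> (I \<times> UNIV) \<and> (\<forall>i\<in>Inl ` A. \<forall>j\<in>J. N i j \<in> polyfun \<rat> (I \<times> UNIV)) \<and>
    \<delta> (\<lambda>(i, \<alpha>). lookup (v0 i) \<alpha>) \<noteq> 0 \<and>
    (\<forall>x \<xi>. (\<forall>r\<in>R. (\<Sum>j\<in>J. a r j x * \<xi> j) = 0) \<longrightarrow>
       (\<forall>j\<in>J. \<delta> x * \<xi> j = (\<Sum>i\<in>Inl ` A. N i j x * \<xi> i)))"
  proof (rule polyfun_solve)
    show "Inl ` A \<subseteq> J" using A by (auto simp: J_def)
    fix r j assume r: "r \<in> R" "j \<in> J"
    obtain k \<alpha> where r': "r = (k, \<alpha>)" by (cases r)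
    show "a r j \<in> polyfun \<rat> (I \<times> UNIV)"
    proof (cases j)
      case (Inl \<beta>)
      then have "a r j = (\<lambda>_. if \<beta> = \<alpha> + unit_expo k then of_nat (lookup \<alpha> k + 1) else 0)"
        by (auto simp: a_def r' fun_eq_iff)
      then show ?thesis by (auto intro!: polyfun.const simp del: of_nat_add)
    next
      case (Inr li)
      then obtain l i where li: "j = Inr (l, i)" "i \<in> I" using r(2) by (cases li) (auto simp: J_def)
      show ?thesis
      proof (cases "l = k")
        case True
        then have "a r j = (\<lambda>x. - x (i, \<alpha>))" by (auto simp: a_def r' li fun_eq_iff)
        then show ?thesis using li(2) by (auto intro!: polyfun_uminus polyfun.var)
      next
        case False
        then have "a r j = (\<lambda>x. 0)" by (auto simp: a_def r' li fun_eq_iff)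
        then show ?thesis by (auto intro!: polyfun.const)
      qed
    qed
  next
    fix \<xi> j
    assume sol: "\<And>r. r \<in> R \<Longrightarrow> (\<Sum>j\<in>J. a r j (\<lambda>(i, \<alpha>). lookup (v0 i) \<alpha>) * \<xi> j) = 0"
      and 0: "\<And>j. j \<in> Inl ` A \<Longrightarrow> \<xi> j = 0" and j: "j \<in> J"
    define \<Lambda> where "\<Lambda> = from_coeffs ?Mt (\<lambda>\<beta>. \<xi> (Inl \<beta>))"
    have l\<Lambda>: "lookup \<Lambda> \<beta> = (if mdeg \<beta> \<le> Suc t then \<xi> (Inl \<beta>) else 0)" for \<beta>
      by (simp add: \<Lambda>_def lookup_from_coeffs[OF fM])
    have pd: "pdiff k \<Lambda> = (\<Sum>i\<in>I. pscale (\<xi> (Inr (k, i))) (v0 i))" for k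
    proof (rule poly_mapping_eqI)
      fix \<alpha>
      show "lookup (pdiff k \<Lambda>) \<alpha> = lookup (\<Sum>i\<in>I. pscale (\<xi> (Inr (k, i))) (v0 i)) \<alpha>"
      proof (cases "mdeg \<alpha> \<le> t")
        case True
        then have "(k, \<alpha>) \<in> R" by (simp add: R_def)
        from sol[OF this, unfolded row[OF True]] show ?thesis using True
          by (simp add: lookup_pdiff l\<Lambda> lookup_sum lookup_pscale mult.commute)
      next
        case False
        then have "lookup (v0 i) \<alpha> = 0" if "i \<in> I" for i using I(2)[OF that] by (auto simp: polys_le_iff)
        then show ?thesis using False by (simp add: lookup_pdiff l\<Lambda> lookup_sum lookup_pscale)
      qed
    qed
    then have "pdiff k \<Lambda> \<in> pm.span (v0 ` I)" for k
      unfolding pd by (intro pm.span_sum pm.span_scale pm.span_base) auto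
    then have "\<Lambda> \<in> integrals (Suc t) (pm.span (v0 ` I))"
      by (auto simp: integrals_def polys_le_iff l\<Lambda>)
    moreover have "\<forall>\<alpha>\<in>A. lookup \<Lambda> \<alpha> = 0" using 0 A(1) by (auto simp: l\<Lambda>)
    ultimately have \<Lambda>0: "\<Lambda> = 0" using A(2) by (auto simp: separates_def)
    show "\<xi> j = 0"
    proof (cases j)
      case (Inl \<beta>)
      then have "mdeg \<beta> \<le> Suc t" using j by (auto simp: J_def)
      then show ?thesis using l\<Lambda>[of \<beta>] \<Lambda>0 Inl by simp
    next
      case (Inr ki)
      then obtain k i where ki: "j = Inr (k, i)" "i \<in> I" using j by (cases ki) (auto simp: J_def)
      have "(\<Sum>i\<in>I. pscale (\<xi> (Inr (k, i))) (v0 i)) = 0" using pd[of k] \<Lambda>0 by simp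
      from ind[OF this ki(2)] show ?thesis by (simp add: ki)
    qed
  qed (use J in auto)
  then obtain \<delta> N where dN: "\<delta> \<in> polyfun \<rat> (I \<times> UNIV)" "\<forall>i\<in>Inl ` A. \<forall>j\<in>J. N i j \<in> polyfun \<rat> (I \<times> UNIV)"
    "\<delta> (\<lambda>(i, \<alpha>). lookup (v0 i) \<alpha>) \<noteq> 0"
    "\<And>x \<xi> j. (\<forall>r\<in>R. (\<Sum>j\<in>J. a r j x * \<xi> j) = 0) \<Longrightarrow> j \<in> J \<Longrightarrow> \<delta> x * \<xi> j = (\<Sum>i\<in>Inl ` A. N i j x * \<xi> i)"
    by (elim exE conjE) blast
  \<comment> \<open>Exponents of degree above t + 1 are not unknowns of the system; every integral
    vanishes there.\<close>
  define N' where "N' \<alpha> \<beta> = (if mdeg \<beta> \<le> Suc t then N (Inl \<alpha>) (Inl \<beta>) else (\<lambda>_. 0))" for \<alpha> \<beta>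
  have "N' \<alpha> \<beta> \<in> polyfun \<rat> (I \<times> UNIV)" if "\<alpha> \<in> A" for \<alpha> \<beta>
    using dN(2) that by (auto simp: N'_def J_def intro: polyfun.const)
  moreover have "\<delta> (\<lambda>(i, \<alpha>). lookup (v i) \<alpha>) * lookup \<Lambda> \<beta> =
      (\<Sum>\<alpha>\<in>A. N' \<alpha> \<beta> (\<lambda>(i, \<alpha>). lookup (v i) \<alpha>) * lookup \<Lambda> \<alpha>)"
    if v: "\<forall>i\<in>I. v i \<in> polys_le t" and \<Lambda>: "\<Lambda> \<in> integrals (Suc t) (pm.span (v ` I))" for v \<Lambda> \<beta>
  proof (cases "mdeg \<beta> \<le> Suc t")
    case False
    then show ?thesis using \<Lambda> by (auto simp: N'_def integrals_def polys_le_iff)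
  next
    case True
    have "\<exists>c. pdiff k \<Lambda> = (\<Sum>i\<in>I. pscale (c i) (v i))" for k
      by (rule span_image_sum[OF I(1)]) (use \<Lambda> in \<open>auto simp: integrals_def\<close>)
    then obtain c where c: "\<And>k. pdiff k \<Lambda> = (\<Sum>i\<in>I. pscale (c k i) (v i))" by metis
    define \<xi> where "\<xi> j = (case j of Inl \<beta> \<Rightarrow> lookup \<Lambda> \<beta> | Inr (k, i) \<Rightarrow> c k i)" for j
    have "(\<Sum>j\<in>J. a (k, \<alpha>) j (\<lambda>(i, \<alpha>). lookup (v i) \<alpha>) * \<xi> j) = 0" if "mdeg \<alpha> \<le> t" for k \<alpha>
      unfolding row[OF that] using arg_cong[OF c[of k], of "\<lambda>p. lookup p \<alpha>"]
      by (simp add: \<xi>_def lookup_pdiff lookup_sum lookup_pscale mult.commute)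
    then have "\<delta> (\<lambda>(i, \<alpha>). lookup (v i) \<alpha>) * \<xi> (Inl \<beta>) = (\<Sum>i\<in>Inl ` A. N i (Inl \<beta>) (\<lambda>(i, \<alpha>). lookup (v i) \<alpha>) * \<xi> i)"
      using True by (intro dN(4)) (auto simp: R_def J_def)
    then show ?thesis using True by (simp add: sum.reindex \<xi>_def N'_def)
  qed
  ultimately show ?thesis using dN(1,3) by (intro exI[of _ \<delta>] exI[of _ N']) auto
qed

text \<open>The semicontinuity argument: a set A that separates at one point still does where a
  determinant is nonzero, which bounds the dimension there; where the dimension reaches |A|, values
  at A can be prescribed freely.\<close>

lemma dual_fam_lookup_subset:
  assumes "pm.subspace Z" "fin_dim Z" "finite A" "separates (\<lambda>\<alpha> p. lookup p \<alpha>) A Z"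
  shows "pm.dim Z \<le> card A" "pm.dim Z = card A \<Longrightarrow> \<exists>u. dual_fam (\<lambda>\<alpha> p. lookup p \<alpha>) u A Z"
proof -
  obtain I u where I: "I \<subseteq> A" "dual_fam (\<lambda>\<alpha> p. lookup p \<alpha>) u I Z" "separates (\<lambda>\<alpha> p. lookup p \<alpha>) I Z"
    using dual_fam_exists[OF assms(1,2) linfun_lookup assms(4)] by blast
  have d: "pm.dim Z = card I" using dual_fam_dim[OF I(2) assms(1) I(3)] .
  then show "pm.dim Z \<le> card A" using card_mono[OF assms(3) I(1)] by simp
  assume "pm.dim Z = card A"
  then have "I = A" using d card_subset_eq[OF assms(3) I(1)] by simp
  then show "\<exists>u. dual_fam (\<lambda>\<alpha> p. lookup p \<alpha>) u A Z" using I(2) by blast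
qed

text \<open>On the locus where the space of integrals has constant dimension its elements extend to
  polynomial sections.\<close>

lemma integrals_section:
  fixes D :: "('n::{finite,linorder}, complex) mpol set"
  assumes bs: "basis_list D bs" "length bs = m" "D \<subseteq> polys_le t"
    and ls: "set ls \<subseteq> integrals (Suc t) D" "length ls = h"
    and F: "F \<in> polyfun UNIV ({..<m + h} \<times> UNIV)" "F (entries (bs @ ls)) \<noteq> 0"
  shows "\<exists>F1. F1 \<in> polyfun UNIV ({..<m} \<times> UNIV) \<and> F1 (entries bs) \<noteq> 0 \<and>
    (\<forall>D' bs'. basis_list D' bs' \<and> length bs' = m \<and> D' \<subseteq> polys_le t \<and> F1 (entries bs') \<noteq> 0 \<longrightarrow>
      pm.dim (integrals (Suc t) D') \<le> pm.dim (integrals (Suc t) D) \<and>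
      (pm.dim (integrals (Suc t) D') = pm.dim (integrals (Suc t) D) \<longrightarrow>
        (\<exists>ls'. length ls' = h \<and> set ls' \<subseteq> integrals (Suc t) D' \<and> F (entries (bs' @ ls')) \<noteq> 0)))"
proof -
  let ?\<phi> = "\<lambda>\<alpha> p :: ('n, complex) mpol. lookup p \<alpha>"
  let ?Mt = "{\<alpha> :: 'n expo. mdeg \<alpha> \<le> Suc t}"
  let ?Z = "integrals (Suc t) D"
  have subZ: "pm.subspace (integrals (Suc t) D')" if "basis_list D' bs'" for D' :: "('n, complex) mpol set" and bs'
    using basis_list_subspace[OF that] by (rule integrals_subspace)
  have img: "(!) xs ` {..<length xs} = set xs" for xs :: "('n, complex) mpol list"
    by (auto simp: set_conv_nth)
  have spanD: "pm.span ((!) bs' ` {..<m}) = D'" if "basis_list D' bs'" "length bs' = m"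
    for D' :: "('n, complex) mpol set" and bs'
    using that img[of bs'] by (auto simp: basis_list_def)
  have "separates ?\<phi> ?Mt ?Z"
    by (auto simp: separates_def integrals_def polys_le_iff not_le intro!: poly_mapping_eqI)
      (metis leI)
  then obtain A u where A: "A \<subseteq> ?Mt" "dual_fam ?\<phi> u A ?Z" "separates ?\<phi> A ?Z"
    using dual_fam_exists[where S = ?Mt and \<phi> = ?\<phi>, OF subZ[OF bs(1)] integrals_fin_dim linfun_lookup] by blast
  have finA: "finite A" using A(2) by (simp add: dual_fam_def)
  have dimZ: "pm.dim ?Z = card A" using dual_fam_dim[OF A(2) subZ[OF bs(1)] A(3)] .
  have en: "(\<lambda>(i, \<alpha>). lookup (bs' ! i) \<alpha>) = entries bs'" for bs' :: "('n, complex) mpol list"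
    by (simp add: entries_def)
  have "\<exists>\<delta> N. \<delta> \<in> polyfun \<rat> ({..<m} \<times> UNIV) \<and>
    (\<forall>\<alpha>\<in>A. \<forall>\<beta>. N \<alpha> \<beta> \<in> polyfun \<rat> ({..<m} \<times> UNIV)) \<and> \<delta> (\<lambda>(i, \<alpha>). lookup (bs ! i) \<alpha>) \<noteq> 0 \<and>
    (\<forall>v. (\<forall>i\<in>{..<m}. v i \<in> polys_le t) \<longrightarrow> (\<forall>\<Lambda>\<in>integrals (Suc t) (pm.span (v ` {..<m})). \<forall>\<beta>.
      \<delta> (\<lambda>(i, \<alpha>). lookup (v i) \<alpha>) * lookup \<Lambda> \<beta> =
      (\<Sum>\<alpha>\<in>A. N \<alpha> \<beta> (\<lambda>(i, \<alpha>). lookup (v i) \<alpha>) * lookup \<Lambda> \<alpha>)))"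
    using basis_list_in[OF bs(1)] bs basis_list_zero[OF bs(1)] A
    by (intro integrals_solve) (auto simp: spanD)
  then obtain \<delta> N where \<delta>: "\<delta> \<in> polyfun \<rat> ({..<m} \<times> UNIV)" and N: "\<forall>\<alpha>\<in>A. \<forall>\<beta>. N \<alpha> \<beta> \<in> polyfun \<rat> ({..<m} \<times> UNIV)"
    and \<delta>0: "\<delta> (entries bs) \<noteq> 0"
    and sol: "\<forall>v. (\<forall>i\<in>{..<m}. v i \<in> polys_le t) \<longrightarrow> (\<forall>\<Lambda>\<in>integrals (Suc t) (pm.span (v ` {..<m})). \<forall>\<beta>.
      \<delta> (\<lambda>(i, \<alpha>). lookup (v i) \<alpha>) * lookup \<Lambda> \<beta> =
      (\<Sum>\<alpha>\<in>A. N \<alpha> \<beta> (\<lambda>(i, \<alpha>). lookup (v i) \<alpha>) * lookup \<Lambda> \<alpha>))"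
    unfolding en by (elim exE conjE)
  have sol': "\<delta> (entries bs') * lookup \<Lambda> \<beta> = (\<Sum>\<alpha>\<in>A. N \<alpha> \<beta> (entries bs') * lookup \<Lambda> \<alpha>)"
    if "basis_list D' bs'" "length bs' = m" "D' \<subseteq> polys_le t" "\<Lambda> \<in> integrals (Suc t) D'" for D' bs' \<Lambda> \<beta>
    using sol[rule_format, of "(!) bs'" \<Lambda> \<beta>] that basis_list_in[OF that(1)] by (auto simp: en spanD)
  \<comment> \<open>The section through \<open>ls ! s\<close>: its values at A are carried along and
    extended to all exponents by Cramer's rule. Dividing by the constant
    \<open>\<delta> (entries bs)\<close> makes it return \<open>ls ! s\<close> at the starting
    basis.\<close>
  define \<xi> where "\<xi> s \<beta> x = (\<Sum>\<alpha>\<in>A. (lookup (ls ! s) \<alpha> / \<delta> (entries bs)) * N \<alpha> \<beta> x)" for s \<beta> x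
  define ext where "ext x = (\<lambda>(i, \<beta>). if i < m then x (i, \<beta>) else \<xi> (i - m) \<beta> x)" for x
  \<comment> \<open>The factor \<delta> restricts to bases where the values at A still determine an
    integral.\<close>
  define F1 where "F1 x = \<delta> x * F (ext x)" for x
  have N': "N \<alpha> \<beta> \<in> polyfun UNIV ({..<m} \<times> UNIV)" if "\<alpha> \<in> A" for \<alpha> \<beta>
    using N that polyfun_mono by blast
  have \<xi>: "\<xi> s \<beta> \<in> polyfun UNIV ({..<m} \<times> UNIV)" for s \<beta>
    unfolding \<xi>_def[abs_def] by (intro polyfun_sum polyfun_cmult N') auto
  have "F1 \<in> polyfun UNIV ({..<m} \<times> UNIV)"
    unfolding F1_def[abs_def]
  proof (intro polyfun.mult)
    show "\<delta> \<in> polyfun UNIV ({..<m} \<times> UNIV)" using \<delta> polyfun_mono by blast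
    show "(\<lambda>x. F (ext x)) \<in> polyfun UNIV ({..<m} \<times> UNIV)"
      using F(1)
    proof (rule polyfun_compose)
      fix v :: "nat \<times> 'n expo"
      obtain i \<beta> where v: "v = (i, \<beta>)" by (cases v)
      show "(\<lambda>x. ext x v) \<in> polyfun UNIV ({..<m} \<times> UNIV)"
        by (cases "i < m") (auto simp: ext_def v intro: polyfun.var \<xi>)
    qed
  qed
  moreover have "F1 (entries bs) \<noteq> 0"
  proof -
    have "F (ext (entries bs)) = F (entries (bs @ ls))"
    proof (rule polyfun_cong[OF F(1)], clarify)
      fix i \<beta> assume i: "i < m + h"
      show "ext (entries bs) (i, \<beta>) = entries (bs @ ls) (i, \<beta>)"
      proof (cases "i < m")
        case False
        then have "ls ! (i - m) \<in> ?Z" using i ls nth_mem[of "i - m" ls] by auto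
        from sol'[OF bs this, of \<beta>]
        have "lookup (ls ! (i - m)) \<beta> = (\<Sum>\<alpha>\<in>A. N \<alpha> \<beta> (entries bs) * lookup (ls ! (i - m)) \<alpha>) / \<delta> (entries bs)"
          using \<delta>0 by (simp add: field_simps)
        also have "\<dots> = \<xi> (i - m) \<beta> (entries bs)"
          by (simp add: \<xi>_def sum_divide_distrib mult.commute)
        finally show ?thesis using False bs(2) by (simp add: ext_def entries_def nth_append)
      qed (use bs(2) in \<open>simp add: ext_def entries_def nth_append\<close>)
    qed
    then show ?thesis using F(2) \<delta>0 by (simp add: F1_def)
  qed
  moreover have "pm.dim (integrals (Suc t) D') \<le> pm.dim ?Z \<and>
      (pm.dim (integrals (Suc t) D') = pm.dim ?Z \<longrightarrow>
        (\<exists>ls'. length ls' = h \<and> set ls' \<subseteq> integrals (Suc t) D' \<and> F (entries (bs' @ ls')) \<noteq> 0))"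
    if b': "basis_list D' bs'" "length bs' = m" "D' \<subseteq> polys_le t" "F1 (entries bs') \<noteq> 0" for D' bs'
  proof -
    let ?Z' = "integrals (Suc t) D'"
    have \<delta>': "\<delta> (entries bs') \<noteq> 0" using b'(4) by (auto simp: F1_def)
    have "separates ?\<phi> A ?Z'"
      unfolding separates_def
    proof (intro ballI impI)
      fix \<Lambda> assume "\<Lambda> \<in> ?Z'" "\<forall>i\<in>A. lookup \<Lambda> i = 0"
      then have "\<delta> (entries bs') * lookup \<Lambda> \<beta> = 0" for \<beta> using sol'[OF b'(1-3)] by simp
      then show "\<Lambda> = 0" using \<delta>' by (intro poly_mapping_eqI) auto
    qed
    note dl = dual_fam_lookup_subset[OF subZ[OF b'(1)] integrals_fin_dim finA this]
    show ?thesis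
    proof (intro conjI impI)
      show "pm.dim ?Z' \<le> pm.dim ?Z" using dl(1) dimZ by simp
      assume "pm.dim ?Z' = pm.dim ?Z"
      then obtain w where w: "dual_fam ?\<phi> w A ?Z'" using dl(2) dimZ by auto
      \<comment> \<open>The factor \<open>\<delta> (entries bs')\<close> in the prescribed values
        cancels the denominator of Cramer's rule, so that the resulting integral has exactly the
        polynomial coefficients \<xi>.\<close>
      define ls' where "ls' = map (\<lambda>s. \<Sum>\<alpha>\<in>A. pscale (\<delta> (entries bs') * lookup (ls ! s) \<alpha> / \<delta> (entries bs)) (w \<alpha>)) [0..<h]"
      have Z': "ls' ! s \<in> ?Z'" if "s < h" for s
        using that w subZ[OF b'(1)] unfolding ls'_def
        by (auto intro!: pm.subspace_sum pm.subspace_scale simp: dual_fam_def)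
      have lA: "lookup (ls' ! s) \<alpha> = \<delta> (entries bs') * lookup (ls ! s) \<alpha> / \<delta> (entries bs)" if "s < h" "\<alpha> \<in> A" for s \<alpha>
        using that dual_fam_coeff[OF w that(2)] by (simp add: ls'_def)
      have l\<xi>: "lookup (ls' ! s) \<beta> = \<xi> s \<beta> (entries bs')" if "s < h" for s \<beta>
      proof -
        have "\<delta> (entries bs') * lookup (ls' ! s) \<beta> = \<delta> (entries bs') * \<xi> s \<beta> (entries bs')"
          using sol'[OF b'(1-3) Z'[OF that], of \<beta>] lA[OF that]
          by (simp add: \<xi>_def sum_distrib_left ac_simps cong: sum.cong)
        then show ?thesis using \<delta>' by simp
      qed
      have "F (entries (bs' @ ls')) = F (ext (entries bs'))"
      proof (rule polyfun_cong[OF F(1)], clarify)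
        fix i \<beta> assume i: "i < m + h"
        then show "entries (bs' @ ls') (i, \<beta>) = ext (entries bs') (i, \<beta>)"
          using b'(2) l\<xi>[of "i - m" \<beta>] by (auto simp: ext_def entries_def nth_append)
      qed
      then have "F (entries (bs' @ ls')) \<noteq> 0" using b'(4) by (auto simp: F1_def)
      moreover have "length ls' = h" by (simp add: ls'_def)
      moreover have "set ls' \<subseteq> ?Z'" using Z' \<open>length ls' = h\<close> by (auto simp: in_set_conv_nth)
      ultimately show "\<exists>ls'. length ls' = h \<and> set ls' \<subseteq> ?Z' \<and> F (entries (bs' @ ls')) \<noteq> 0" by blast
    qed
  qed
  ultimately show ?thesis by (intro exI[of _ F1]) blast
qed

section \<open>The linear system and the space of integrals\<close>

definition pairing :: "'c set \<Rightarrow> ('c \<Rightarrow>\<^sub>0 complex) \<Rightarrow> ('c \<Rightarrow>\<^sub>0 complex) \<Rightarrow> complex"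
  where "pairing C \<rho> \<nu> = (\<Sum>c\<in>C. lookup \<rho> c * lookup \<nu> c)"

lemma linfun_pairing: "linfun (\<lambda>\<rho>. pairing C \<rho> \<nu>)"
  by (simp add: linfun_def pairing_def lookup_add lookup_pscale sum.distrib sum_distrib_left algebra_simps)

lemma linfun_pairing_right: "linfun (pairing C \<rho>)"
  by (simp add: linfun_def pairing_def lookup_add lookup_pscale sum.distrib sum_distrib_left algebra_simps)

lemma pairing_single:
  assumes "finite C" "c \<in> C"
  shows "pairing C (Poly_Mapping.single c a) \<nu> = a * lookup \<nu> c"
proof -
  have "pairing C (Poly_Mapping.single c a) \<nu> = (\<Sum>c'\<in>C. if c = c' then a * lookup \<nu> c' else 0)"
    unfolding pairing_def by (rule sum.cong) (auto simp: lookup_single when_def)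
  then show ?thesis using assms by simp
qed

lemma separates_lookup:
  assumes "D \<subseteq> {p. keys p \<subseteq> C}"
  shows "separates (\<lambda>c p. lookup p c) C D"
  unfolding separates_def
proof (intro ballI impI poly_mapping_eqI)
  fix x c assume x: "x \<in> D" "\<forall>i\<in>C. lookup x i = 0"
  then have "keys x \<subseteq> C" using assms by blast
  then have "c \<notin> C \<Longrightarrow> lookup x c = 0" by (auto simp flip: not_in_keys_iff_lookup_eq_zero)
  then show "lookup x c = lookup 0 c" using x(2) by auto
qed

text \<open>As with a reduced row echelon form: I is a set of pivot columns of the row space with
  dual rows u, and each remaining column c gives the kernel vector w c, the unit vector at c minus
  the entries of column c placed at the pivots.\<close>

lemma rank_nullity:
  fixes R :: "('c \<Rightarrow>\<^sub>0 complex) set"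
  assumes C: "finite C" and R: "\<And>\<rho>. \<rho> \<in> R \<Longrightarrow> keys \<rho> \<subseteq> C"
  shows "pm.dim R + pm.dim {\<nu>. keys \<nu> \<subseteq> C \<and> (\<forall>\<rho>\<in>R. pairing C \<rho> \<nu> = 0)} = card C"
proof -
  let ?\<phi> = "\<lambda>c p :: 'c \<Rightarrow>\<^sub>0 complex. lookup p c"
  let ?V = "pm.span R" and ?K = "{\<nu>. keys \<nu> \<subseteq> C \<and> (\<forall>\<rho>\<in>R. pairing C \<rho> \<nu> = 0)}"
  have VC: "?V \<subseteq> {p. keys p \<subseteq> C}"
    by (rule pm.span_minimal[OF _ subspace_keys]) (use R in auto)
  have fV: "fin_dim ?V" using fin_dim_subset[OF fin_dim_keys[OF C] VC] .
  have "separates ?\<phi> C ?V" using VC by (rule separates_lookup)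
  then obtain I u where I: "I \<subseteq> C" "dual_fam ?\<phi> u I ?V" "separates ?\<phi> I ?V"
    using dual_fam_exists[where S = C and \<phi> = ?\<phi>, OF pm.subspace_span fV linfun_lookup] by blast
  have dV: "pm.dim R = card I" using dual_fam_dim[OF I(2) pm.subspace_span I(3)] by simp
  have finI: "finite I" using I(2) by (simp add: dual_fam_def)
  have ann: "pairing C x \<nu> = 0" if "x \<in> ?V" "\<nu> \<in> ?K" for x \<nu>
  proof -
    have "pm.subspace {x. pairing C x \<nu> = 0}"
      by (auto simp: pm.subspace_def linfun_zero[where \<phi> = "\<lambda>x. pairing C x \<nu>", OF linfun_pairing]
          linfun_add[where \<phi> = "\<lambda>x. pairing C x \<nu>", OF linfun_pairing]
          linfun_scale[where \<phi> = "\<lambda>x. pairing C x \<nu>", OF linfun_pairing])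
    then have "?V \<subseteq> {x. pairing C x \<nu> = 0}" by (intro pm.span_minimal) (use that(2) in auto)
    then show ?thesis using that(1) by blast
  qed
  have subK: "pm.subspace ?K"
    using subspace_keys[of C]
    by (auto simp: pm.subspace_def linfun_zero[OF linfun_pairing_right] linfun_add[OF linfun_pairing_right]
          linfun_scale[OF linfun_pairing_right])
  define w where "w c = Poly_Mapping.single c 1 - (\<Sum>i\<in>I. pscale (lookup (u i) c) (Poly_Mapping.single i 1))"
    for c :: 'c
  have lw: "lookup (w c) c' = (if c = c' then 1 else 0) - (if c' \<in> I then lookup (u c') c else 0)" for c c'
  proof -
    have "(\<Sum>i\<in>I. lookup (u i) c * (if i = c' then 1 else 0)) = (\<Sum>i\<in>I. if i = c' then lookup (u i) c else 0)"
      by (rule sum.cong) auto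
    then show ?thesis
      using finI by (simp add: w_def lookup_minus lookup_single when_def lookup_sum lookup_pscale)
  qed
  have uw: "pairing C (u i) (w c) = 0" if "i \<in> I" "c \<in> C" for i c
  proof -
    have "pairing C (u i) (w c) = (\<Sum>c'\<in>C. if c = c' then lookup (u i) c' else 0)
        - (\<Sum>c'\<in>C. if c' \<in> I then lookup (u i) c' * lookup (u c') c else 0)"
      unfolding pairing_def sum_subtractf[symmetric] by (rule sum.cong) (auto simp: lw algebra_simps)
    also have "(\<Sum>c'\<in>C. if c' \<in> I then lookup (u i) c' * lookup (u c') c else 0) =
        (\<Sum>c'\<in>I. if c' = i then lookup (u i) c else 0)"
      using C I(1,2) that(1) by (intro sum.mono_neutral_cong_right) (auto simp: dual_fam_def)
    finally show ?thesis using C that finI by simp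
  qed
  have "w c \<in> ?K" if "c \<in> C - I" for c
  proof -
    have "pairing C \<rho> (w c) = 0" if "\<rho> \<in> R" for \<rho>
    proof -
      have "\<rho> = (\<Sum>i\<in>I. pscale (lookup \<rho> i) (u i))"
        using dual_fam_expand[OF I(2) pm.subspace_span I(3) pm.span_base[OF that]] .
      then have "pairing C \<rho> (w c) = pairing C (\<Sum>i\<in>I. pscale (lookup \<rho> i) (u i)) (w c)" by (rule arg_cong)
      also have "\<dots> = 0"
        using uw \<open>c \<in> C - I\<close>
        by (simp add: linfun_sum[where \<phi> = "\<lambda>x. pairing C x _", OF linfun_pairing]
            linfun_scale[where \<phi> = "\<lambda>x. pairing C x _", OF linfun_pairing])
      finally show ?thesis .
    qed
    moreover have "keys (w c) \<subseteq> C" using that I(1) by (auto simp: in_keys_iff lw split: if_splits)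
    ultimately show ?thesis by simp
  qed
  then have "dual_fam ?\<phi> w (C - I) ?K"
    using C linfun_lookup by (auto simp: dual_fam_def lw)
  moreover have "separates ?\<phi> (C - I) ?K"
    unfolding separates_def
  proof (intro ballI impI)
    fix \<nu> assume \<nu>: "\<nu> \<in> ?K" "\<forall>i\<in>C - I. lookup \<nu> i = 0"
    have "lookup \<nu> i = 0" if i: "i \<in> I" for i
    proof -
      have "pairing C (u i) \<nu> = (\<Sum>c\<in>I. if c = i then lookup \<nu> c else 0)"
        unfolding pairing_def using C I(1,2) i \<nu>(2)
        by (intro sum.mono_neutral_cong_right) (auto simp: dual_fam_def)
      moreover have "u i \<in> ?V" using I(2) i by (simp add: dual_fam_def)
      ultimately show ?thesis using ann[of "u i" \<nu>] \<nu>(1) finI i by simp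
    qed
    then show "\<nu> = 0" using \<nu> by (intro poly_mapping_eqI) (auto simp: in_keys_iff subset_iff)
  qed
  ultimately have "pm.dim ?K = card (C - I)" using subK by (intro dual_fam_dim)
  then show ?thesis
    using dV card_Diff_subset[OF finI I(1)] card_mono[OF C I(1)] by simp
qed

lemma H_rows_keys:
  assumes "\<rho> \<in> H_rows E t D"
  shows "keys \<rho> \<subseteq> H_cols E t"
proof -
  let ?F = "upto_deg E (t - 1)"
  let ?S = "{p :: ('a expo \<times> 'a) \<Rightarrow>\<^sub>0 complex. keys p \<subseteq> H_cols E t}"
  have sub: "pm.subspace ?S" by (rule subspace_keys)
  have s: "Poly_Mapping.single (\<beta>, k) a \<in> ?S" if "\<beta> \<in> ?F" for \<beta> k a
    using that by (simp add: H_cols_def)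
  from assms consider \<sigma> k l where "\<rho> = (\<Sum>\<beta> | \<beta> \<in> ?F \<and> mdeg \<sigma> < mdeg \<beta> \<and> mdeg \<beta> < t.
        Poly_Mapping.single (\<beta>, k) (mu_coord ?F D \<beta> (\<sigma> + unit_expo l))
      - Poly_Mapping.single (\<beta>, l) (mu_coord ?F D \<beta> (\<sigma> + unit_expo k)))"
    | \<beta> k where "\<rho> = Poly_Mapping.single (\<beta>, k) 1" "\<beta> \<in> ?F"
    unfolding H_rows_def Let_def by blast
  then have "\<rho> \<in> ?S"
  proof cases
    case 1
    show ?thesis unfolding 1 by (intro pm.subspace_sum[OF sub] pm.subspace_diff[OF sub] s) simp_all
  next
    case 2
    show ?thesis unfolding 2(1) by (rule s[OF 2(2)])
  qed
  then show ?thesis by simp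
qed

lemma finite_H_cols: "finite E \<Longrightarrow> finite (H_cols E t)"
  by (simp add: H_cols_def upto_deg_def)

lemma H_kernel_pairing: "H_kernel E t D = {\<nu>. keys \<nu> \<subseteq> H_cols E t \<and> (\<forall>\<rho>\<in>H_rows E t D. pairing (H_cols E t) \<rho> \<nu> = 0)}"
  by (simp add: H_kernel_def pairing_def)

lemma H_rank_nullity:
  assumes "finite E"
  shows "H_rank E t D + pm.dim (H_kernel E t D) = card (H_cols E t)"
  unfolding H_rank_def H_kernel_pairing
  by (rule rank_nullity) (use assms H_rows_keys finite_H_cols in blast)+

section \<open>Monomial sets closed under division and integration of closed families\<close>

lemma upto_deg_closed:
  assumes "closed_under_division E" "\<alpha> + unit_expo k \<in> upto_deg E t"
  shows "\<alpha> \<in> upto_deg (E :: 'n::finite expo set) t"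
proof -
  have "\<alpha> + unit_expo k - unit_expo k = \<alpha>" by simp
  moreover have "lookup (\<alpha> + unit_expo k) k > 0" by (simp add: lookup_add)
  ultimately have "\<alpha> \<in> E"
    using assms unfolding closed_under_division_def upto_deg_def by (metis (no_types, lifting) mem_Collect_eq)
  then show ?thesis using assms(2) by (auto simp: upto_deg_def)
qed

lemma zero_in_upto_deg:
  assumes "closed_under_division E" "\<alpha> \<in> upto_deg (E :: 'n::finite expo set) t"
  shows "0 \<in> upto_deg E t"
  using assms(2)
proof (induction "mdeg \<alpha>" arbitrary: \<alpha>)
  case 0
  then show ?case using mdeg_eq_0[of \<alpha>] by simp
next
  case (Suc d)
  then obtain k \<alpha>' where \<alpha>: "\<alpha> = \<alpha>' + unit_expo k" using expo_decompose[of \<alpha>] by auto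
  then have "\<alpha>' \<in> upto_deg E t" using upto_deg_closed[OF assms(1)] Suc.prems by blast
  moreover have "d = mdeg \<alpha>'" using Suc.hyps(2) \<alpha> by simp
  ultimately show ?case using Suc.hyps(1) by blast
qed

text \<open>A formal Poincare lemma. The value of \<Lambda> at \<alpha> is read off from \<Gamma> at
  some variable K \<alpha> dividing \<alpha>; closedness, through the exchange of two variables,
  makes the result independent of the choice. The constant term, which no derivative sees, is set to
  0.\<close>

lemma closed_form_exact:
  fixes \<Gamma> :: "'n::{finite,linorder} \<Rightarrow> ('n, complex) mpol"
  assumes cl: "\<And>k l. pdiff l (\<Gamma> k) = pdiff k (\<Gamma> l)" and deg: "\<And>k. \<Gamma> k \<in> polys_le t"
  shows "\<exists>\<Lambda>\<in>polys_le (Suc t). (\<forall>k. pdiff k \<Lambda> = \<Gamma> k) \<and> lookup \<Lambda> 0 = 0"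
proof -
  define K where "K \<alpha> = (SOME k. lookup \<alpha> k > 0)" for \<alpha> :: "'n expo"
  define e where "e \<alpha> = (if \<alpha> = 0 then 0 else ev (\<Gamma> (K \<alpha>)) (\<alpha> - unit_expo (K \<alpha>)))" for \<alpha>
  have e: "e (\<beta> + unit_expo k) = ev (\<Gamma> k) \<beta>" for \<beta> k
  proof -
    let ?\<alpha> = "\<beta> + unit_expo k"
    have pos: "lookup ?\<alpha> k > 0" by (simp add: lookup_add)
    then have K: "lookup ?\<alpha> (K ?\<alpha>) > 0" unfolding K_def by (rule someI)
    have nz: "?\<alpha> \<noteq> 0" using pos by (intro notI) simp
    show ?thesis
    proof (cases "K ?\<alpha> = k")
      case True
      then show ?thesis using nz by (simp add: e_def)
    next
      case False
      define l where "l = K ?\<alpha>"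
      have "lookup \<beta> l > 0" using K False by (simp add: l_def lookup_add lookup_single)
      then have \<beta>: "\<beta> = (\<beta> - unit_expo l) + unit_expo l" by (rule expo_diff_unit[symmetric])
      define \<eta> where "\<eta> = \<beta> - unit_expo l"
      have "?\<alpha> - unit_expo l = \<eta> + unit_expo k"
      proof -
        have "?\<alpha> = (\<eta> + unit_expo k) + unit_expo l" using \<beta> by (simp add: \<eta>_def ac_simps)
        then show ?thesis by simp
      qed
      then have "e ?\<alpha> = ev (\<Gamma> l) (\<eta> + unit_expo k)" using nz by (simp add: e_def l_def)
      also have "\<dots> = ev (\<Gamma> k) (\<eta> + unit_expo l)" using cl[of k l] by (simp flip: ev_pdiff)
      finally show ?thesis using \<beta> by (simp add: \<eta>_def)
    qed
  qed
  define \<Lambda> where "\<Lambda> = from_coeffs {\<alpha>. mdeg \<alpha> \<le> Suc t} (\<lambda>\<alpha>. e \<alpha> / of_nat (mfact \<alpha>))"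
  have l\<Lambda>: "lookup \<Lambda> \<alpha> = (if mdeg \<alpha> \<le> Suc t then e \<alpha> / of_nat (mfact \<alpha>) else 0)" for \<alpha>
    by (simp add: \<Lambda>_def lookup_from_coeffs[OF finite_mdeg_le])
  then have ev\<Lambda>: "ev \<Lambda> \<alpha> = (if mdeg \<alpha> \<le> Suc t then e \<alpha> else 0)" for \<alpha>
    by (simp add: ev_def)
  have "pdiff k \<Lambda> = \<Gamma> k" for k
  proof (rule ev_eqI)
    fix \<alpha>
    show "ev (pdiff k \<Lambda>) \<alpha> = ev (\<Gamma> k) \<alpha>"
      using deg[of k] by (simp add: ev_pdiff ev\<Lambda> e polys_le_iff ev_eq_0)
  qed
  moreover have "\<Lambda> \<in> polys_le (Suc t)" by (simp add: polys_le_iff l\<Lambda>)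
  moreover have "lookup \<Lambda> 0 = 0" by (simp add: l\<Lambda> e_def)
  ultimately show ?thesis by blast
qed

text \<open>Larger than the usual border: products that stay in F are kept and 0 is added. So it
  contains the monomials of the next degree and also detects constant terms.\<close>

definition border :: "'n expo set \<Rightarrow> 'n expo set"
  where "border F = insert 0 {\<beta> + unit_expo k | \<beta> k. \<beta> \<in> F}"

lemma upto_deg_Suc_border:
  assumes "closed_under_division E"
  shows "upto_deg E (Suc t) \<subseteq> border (upto_deg (E :: 'n::finite expo set) t)"
proof
  fix \<alpha> assume \<alpha>: "\<alpha> \<in> upto_deg E (Suc t)"
  show "\<alpha> \<in> border (upto_deg E t)"
  proof (cases "mdeg \<alpha> = 0")
    case True
    then show ?thesis by (simp add: border_def mdeg_eq_0)
  next
    case False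
    then obtain k \<beta> where b: "\<alpha> = \<beta> + unit_expo k" using expo_decompose[of \<alpha>] by auto
    then have "\<beta> \<in> upto_deg E (Suc t)" using upto_deg_closed[OF assms] \<alpha> by blast
    moreover have "mdeg \<beta> \<le> t" using \<alpha> b by (simp add: upto_deg_def)
    ultimately show ?thesis using b by (auto simp: border_def upto_deg_def)
  qed
qed

lemma upto_deg_Suc_subset: "upto_deg E t \<subseteq> upto_deg E (Suc t)"
  by (auto simp: upto_deg_def)

text \<open>The derivatives lie in D, and their values at F are values of \<Lambda> on the border,
  so they vanish. Only a constant remains, which the exponent 0 detects.\<close>

lemma border_separates:
  assumes d: "dual_basis F D \<Lambda>0"
  shows "separates (\<lambda>\<gamma> p. ev p \<gamma>) (border F) (integrals (Suc t) (D :: ('n::finite, complex) mpol set))"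
  unfolding separates_def
proof (intro ballI impI)
  fix \<Lambda> assume \<Lambda>: "\<Lambda> \<in> integrals (Suc t) D" "\<forall>\<alpha>\<in>border F. ev \<Lambda> \<alpha> = 0"
  have p0: "pdiff k \<Lambda> = 0" for k
  proof -
    have "pdiff k \<Lambda> \<in> D" using \<Lambda>(1) by (auto simp: integrals_def)
    moreover have "\<forall>\<beta>\<in>F. ev (pdiff k \<Lambda>) \<beta> = 0" using \<Lambda>(2) by (auto simp: ev_pdiff border_def)
    ultimately show ?thesis using dual_basisD(3)[OF d] by (auto simp: separates_def)
  qed
  show "\<Lambda> = 0"
  proof (rule ev_eqI)
    fix \<alpha>
    show "ev \<Lambda> \<alpha> = ev 0 \<alpha>"
    proof (cases "mdeg \<alpha> = 0")
      case True
      then show ?thesis using \<Lambda>(2) by (simp add: border_def mdeg_eq_0 ev_def[of 0])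
    next
      case False
      then obtain k \<beta> where "\<alpha> = \<beta> + unit_expo k" using expo_decompose[of \<alpha>] by auto
      then show ?thesis using p0[of k] by (simp add: ev_def[of 0] flip: ev_pdiff)
    qed
  qed
qed

lemma integrals_contains:
  assumes "D \<subseteq> polys_le t" "\<And>k. pdiff k ` D \<subseteq> D"
  shows "D \<subseteq> integrals (Suc t) D"
  using assms polys_le_mono[of t "Suc t"] by (auto simp: integrals_def)

text \<open>A vector \<nu> encodes candidates \<Gamma> k for the derivatives of an integral by their
  coordinates in D. The restriction |\<sigma>| < |\<beta>| in the rows loses nothing by the degree
  bound on the dual basis; k < l suffices by symmetry; and testing at \<sigma> in F suffices because
  F separates D. The second kind of row makes the integral vanish at nonzero exponents of F.\<close>

lemma H_kernel_iff:
  fixes E :: "'n::{finite,linorder} expo set"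
  assumes E: "finite E" and d: "dual_basis (upto_deg E t) D \<Lambda>" and st: "\<And>k. pdiff k ` D \<subseteq> D"
  defines "\<Gamma> \<nu> k \<equiv> \<Sum>\<beta>\<in>upto_deg E t. pscale (lookup \<nu> (\<beta>, k)) (\<Lambda> \<beta>)"
  shows "\<nu> \<in> H_kernel E (Suc t) D \<longleftrightarrow> keys \<nu> \<subseteq> upto_deg E t \<times> UNIV \<and>
    (\<forall>k l. pdiff l (\<Gamma> \<nu> k) = pdiff k (\<Gamma> \<nu> l)) \<and>
    (\<forall>\<beta> k. \<beta> \<in> upto_deg E t \<longrightarrow> \<beta> + unit_expo k \<in> upto_deg E t \<longrightarrow> lookup \<nu> (\<beta>, k) = 0)"
proof -
  let ?F = "upto_deg E t"
  let ?C = "H_cols E (Suc t)"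
  note D = dual_basisD[OF d]
  have C: "finite ?C" "?C = ?F \<times> UNIV" using finite_H_cols[OF E, of "Suc t"] by (auto simp: H_cols_def)
  have ps: "pairing ?C (Poly_Mapping.single (\<beta>, k) a) \<nu> = a * lookup \<nu> (\<beta>, k)" if "\<beta> \<in> ?F" for \<beta> k a
    by (rule pairing_single[OF C(1)]) (use that C(2) in simp)
  define \<rho> where "\<rho> \<sigma> k l = (\<Sum>\<beta> | \<beta> \<in> ?F \<and> mdeg \<sigma> < mdeg \<beta> \<and> mdeg \<beta> < Suc t.
        Poly_Mapping.single (\<beta>, k) (mu_coord ?F D \<beta> (\<sigma> + unit_expo l))
      - Poly_Mapping.single (\<beta>, l) (mu_coord ?F D \<beta> (\<sigma> + unit_expo k)))" for \<sigma> and k l :: 'n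
  have ev\<Gamma>: "ev (pdiff l (\<Gamma> \<nu> k)) \<sigma> = (\<Sum>\<beta>\<in>?F. lookup \<nu> (\<beta>, k) * ev (\<Lambda> \<beta>) (\<sigma> + unit_expo l))" for k l \<sigma>
    by (simp add: ev_pdiff \<Gamma>_def linfun_sum[where \<phi> = "\<lambda>p. ev p _", OF linfun_ev]
        linfun_scale[where \<phi> = "\<lambda>p. ev p _", OF linfun_ev])
  have row: "pairing ?C (\<rho> \<sigma> k l) \<nu> = ev (pdiff l (\<Gamma> \<nu> k)) \<sigma> - ev (pdiff k (\<Gamma> \<nu> l)) \<sigma>" for \<sigma> k l
  proof -
    have "pairing ?C (\<rho> \<sigma> k l) \<nu> = (\<Sum>\<beta> | \<beta> \<in> ?F \<and> mdeg \<sigma> < mdeg \<beta> \<and> mdeg \<beta> < Suc t.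
        ev (\<Lambda> \<beta>) (\<sigma> + unit_expo l) * lookup \<nu> (\<beta>, k) - ev (\<Lambda> \<beta>) (\<sigma> + unit_expo k) * lookup \<nu> (\<beta>, l))"
      unfolding \<rho>_def linfun_sum[where \<phi> = "\<lambda>x. pairing ?C x \<nu>", OF linfun_pairing]
        linfun_diff[where \<phi> = "\<lambda>x. pairing ?C x \<nu>", OF linfun_pairing]
      by (rule sum.cong) (auto simp: ps mu_coord_eq[OF d])
    also have "\<dots> = (\<Sum>\<beta>\<in>?F.
        ev (\<Lambda> \<beta>) (\<sigma> + unit_expo l) * lookup \<nu> (\<beta>, k) - ev (\<Lambda> \<beta>) (\<sigma> + unit_expo k) * lookup \<nu> (\<beta>, l))"
    proof (rule sum.mono_neutral_left)
      show "finite ?F" using D(4) .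
      show "\<forall>\<beta>\<in>?F - {\<beta> \<in> ?F. mdeg \<sigma> < mdeg \<beta> \<and> mdeg \<beta> < Suc t}.
        ev (\<Lambda> \<beta>) (\<sigma> + unit_expo l) * lookup \<nu> (\<beta>, k) - ev (\<Lambda> \<beta>) (\<sigma> + unit_expo k) * lookup \<nu> (\<beta>, l) = 0"
      proof
        fix \<beta> assume \<beta>: "\<beta> \<in> ?F - {\<beta> \<in> ?F. mdeg \<sigma> < mdeg \<beta> \<and> mdeg \<beta> < Suc t}"
        then have "mdeg \<beta> \<le> mdeg \<sigma>" by (auto simp: upto_deg_def)
        then have "ev (\<Lambda> \<beta>) (\<sigma> + unit_expo j) = 0" for j
          using D(6)[of \<beta>] \<beta> by (auto simp: polys_le_iff ev_eq_0)
        then show "ev (\<Lambda> \<beta>) (\<sigma> + unit_expo l) * lookup \<nu> (\<beta>, k) - ev (\<Lambda> \<beta>) (\<sigma> + unit_expo k) * lookup \<nu> (\<beta>, l) = 0"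
          by simp
      qed
    qed auto
    finally show ?thesis by (simp add: ev\<Gamma> sum_subtractf mult.commute)
  qed
  have rows: "H_rows E (Suc t) D = {\<rho> \<sigma> k l | \<sigma> k l. \<sigma> \<in> ?F \<and> k < l}
    \<union> {Poly_Mapping.single (\<beta>, k) 1 | \<beta> k. \<beta> \<in> ?F \<and> \<beta> + unit_expo k \<in> ?F}"
    by (simp add: H_rows_def Let_def \<rho>_def)
  have \<Gamma>D: "\<Gamma> \<nu> k \<in> D" for k
    unfolding \<Gamma>_def using D by (intro pm.subspace_sum pm.subspace_scale) auto
  have "(\<forall>\<sigma> k l. \<sigma> \<in> ?F \<and> k < l \<longrightarrow> pairing ?C (\<rho> \<sigma> k l) \<nu> = 0) \<longleftrightarrow> (\<forall>k l. pdiff l (\<Gamma> \<nu> k) = pdiff k (\<Gamma> \<nu> l))"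
  proof (intro iffI allI impI)
    fix k l assume 0: "\<forall>\<sigma> k l. \<sigma> \<in> ?F \<and> k < l \<longrightarrow> pairing ?C (\<rho> \<sigma> k l) \<nu> = 0"
    have lt: "pdiff l (\<Gamma> \<nu> k) = pdiff k (\<Gamma> \<nu> l)" if "k < l" for k l
    proof -
      have "pdiff l (\<Gamma> \<nu> k) - pdiff k (\<Gamma> \<nu> l) \<in> D"
        using \<Gamma>D st by (intro pm.subspace_diff[OF D(1)]) blast+
      moreover have "\<forall>\<sigma>\<in>?F. ev (pdiff l (\<Gamma> \<nu> k) - pdiff k (\<Gamma> \<nu> l)) \<sigma> = 0"
        using 0 that row by (simp add: linfun_diff[where \<phi> = "\<lambda>p. ev p _", OF linfun_ev])
      ultimately have "pdiff l (\<Gamma> \<nu> k) - pdiff k (\<Gamma> \<nu> l) = 0"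
        using D(3) unfolding separates_def by blast
      then show ?thesis by simp
    qed
    show "pdiff l (\<Gamma> \<nu> k) = pdiff k (\<Gamma> \<nu> l)"
      using lt[of k l] lt[of l k] by (cases k l rule: linorder_cases) auto
  qed (simp add: row)
  moreover have "(\<forall>x\<in>{Poly_Mapping.single (\<beta>, k) 1 | \<beta> k. \<beta> \<in> ?F \<and> \<beta> + unit_expo k \<in> ?F}. pairing ?C x \<nu> = 0) \<longleftrightarrow>
    (\<forall>\<beta> k. \<beta> \<in> ?F \<longrightarrow> \<beta> + unit_expo k \<in> ?F \<longrightarrow> lookup \<nu> (\<beta>, k) = 0)"
    using ps by fastforce
  moreover have "\<nu> \<in> H_kernel E (Suc t) D \<longleftrightarrow> keys \<nu> \<subseteq> ?C \<and>
      (\<forall>\<sigma> k l. \<sigma> \<in> ?F \<and> k < l \<longrightarrow> pairing ?C (\<rho> \<sigma> k l) \<nu> = 0) \<and>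
      (\<forall>x\<in>{Poly_Mapping.single (\<beta>, k) 1 | \<beta> k. \<beta> \<in> ?F \<and> \<beta> + unit_expo k \<in> ?F}. pairing ?C x \<nu> = 0)"
    unfolding H_kernel_pairing rows by blast
  ultimately show ?thesis unfolding C(2) by simp
qed

text \<open>The kernel is isomorphic to the space of integrals vanishing at F, by the map \<Psi>
  that records the coordinates of all derivatives; surjectivity is the integration of closed
  families. This space complements D in the integrals, so extending F to coordinates A gives the
  dimension as |A - F|.\<close>

lemma H_kernel_dim:
  fixes E :: "'n::{finite,linorder} expo set"
  assumes E: "finite E" "closed_under_division E" and D: "D \<in> Hilb_B E t"
    and ne: "upto_deg E t \<noteq> {}"
  shows "pm.dim (integrals (Suc t) D) = card (upto_deg E t) + pm.dim (H_kernel E (Suc t) D)"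
proof -
  let ?\<phi> = "\<lambda>\<gamma> p :: ('n, complex) mpol. ev p \<gamma>" and ?F = "upto_deg E t" and ?Z = "integrals (Suc t) D"
  obtain \<Lambda> where d: "dual_basis ?F D \<Lambda>" using Hilb_B_dual_basis[OF D E(1)] by blast
  have st: "pdiff k ` D \<subseteq> D" for k using Hilb_B_D(3)[OF D] .
  note L = dual_basisD[OF d]
  have DZ: "D \<subseteq> ?Z" using integrals_contains[OF dual_basis_polys_le[OF d] st] .
  have subZ: "pm.subspace ?Z" using integrals_subspace[OF L(1)] .
  have "0 \<in> ?F" using zero_in_upto_deg[OF E(2)] ne by blast
  have "?F \<subseteq> border ?F" using upto_deg_Suc_border[OF E(2), of t] upto_deg_Suc_subset[of E t] by blast
  moreover have "dual_fam ?\<phi> \<Lambda> ?F ?Z" using L(2) DZ by (auto simp: dual_fam_def)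
  ultimately have "\<exists>A u. ?F \<subseteq> A \<and> A \<subseteq> border ?F \<and> dual_fam ?\<phi> u A ?Z \<and> separates ?\<phi> A ?Z"
    by (intro dual_fam_extend[OF subZ integrals_fin_dim linfun_ev border_separates[OF d]])
  then obtain A u where A: "?F \<subseteq> A" "A \<subseteq> border ?F" "dual_fam ?\<phi> u A ?Z" "separates ?\<phi> A ?Z"
    by blast
  have finA: "finite A" using A(3) by (simp add: dual_fam_def)
  have dimZ: "pm.dim ?Z = card A" using dual_fam_dim[OF A(3) subZ A(4)] .
  define \<Psi> where "\<Psi> p = from_coeffs (?F \<times> UNIV) (\<lambda>(\<beta>, k). ev p (\<beta> + unit_expo k))" for p :: "('n, complex) mpol"
  have l\<Psi>: "lookup (\<Psi> p) (\<beta>, k) = (if \<beta> \<in> ?F then ev p (\<beta> + unit_expo k) else 0)" for p \<beta> k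
    using L(4) by (simp add: \<Psi>_def lookup_from_coeffs)
  have \<Psi>K: "\<Psi> p \<in> H_kernel E (Suc t) D" if p: "p \<in> ?Z" "\<forall>\<beta>\<in>?F. ev p \<beta> = 0" for p
  proof -
    have "(\<Sum>\<beta>\<in>?F. pscale (lookup (\<Psi> p) (\<beta>, k)) (\<Lambda> \<beta>)) = pdiff k p" for k
    proof -
      have "pdiff k p \<in> D" using p(1) by (auto simp: integrals_def)
      from dual_basis_expand[OF d this] show ?thesis by (simp add: l\<Psi> ev_pdiff)
    qed
    moreover have "pdiff l (pdiff k p) = pdiff k (pdiff l p)" for k l
      by (rule ev_eqI) (simp add: ev_pdiff add_ac)
    moreover have "keys (\<Psi> p) \<subseteq> ?F \<times> UNIV" by (auto simp: in_keys_iff l\<Psi> split: if_splits)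
    moreover have "lookup (\<Psi> p) (\<beta>, k) = 0" if "\<beta> + unit_expo k \<in> ?F" for \<beta> k
      using p(2) that by (simp add: l\<Psi>)
    ultimately show ?thesis unfolding H_kernel_iff[OF E(1) d st] by simp
  qed
  have surj: "\<exists>p\<in>?Z. (\<forall>\<beta>\<in>?F. ev p \<beta> = 0) \<and> \<nu> = \<Psi> p" if \<nu>: "\<nu> \<in> H_kernel E (Suc t) D" for \<nu>
  proof -
    define \<Gamma> where "\<Gamma> k = (\<Sum>\<beta>\<in>?F. pscale (lookup \<nu> (\<beta>, k)) (\<Lambda> \<beta>))" for k
    have h: "keys \<nu> \<subseteq> ?F \<times> UNIV" "\<And>k l. pdiff l (\<Gamma> k) = pdiff k (\<Gamma> l)"
      "\<And>\<beta> k. \<beta> \<in> ?F \<Longrightarrow> \<beta> + unit_expo k \<in> ?F \<Longrightarrow> lookup \<nu> (\<beta>, k) = 0"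
      using \<nu> unfolding H_kernel_iff[OF E(1) d st] \<Gamma>_def by blast+
    have \<Gamma>D: "\<Gamma> k \<in> D" for k
      unfolding \<Gamma>_def using L by (intro pm.subspace_sum pm.subspace_scale) auto
    then obtain p where p: "p \<in> polys_le (Suc t)" "\<And>k. pdiff k p = \<Gamma> k" "lookup p 0 = 0"
      using closed_form_exact[of \<Gamma> t, OF h(2)] dual_basis_polys_le[OF d] by blast
    have evp: "ev p (\<beta> + unit_expo k) = lookup \<nu> (\<beta>, k)" if "\<beta> \<in> ?F" for \<beta> k
    proof -
      have "ev p (\<beta> + unit_expo k) = ev (\<Gamma> k) \<beta>" using p(2)[of k] by (simp flip: ev_pdiff)
      then show ?thesis unfolding \<Gamma>_def using dual_fam_coeff[OF L(2) that] by simp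
    qed
    have "p \<in> ?Z" using p \<Gamma>D by (simp add: integrals_def)
    moreover have "ev p \<alpha> = 0" if \<alpha>: "\<alpha> \<in> ?F" for \<alpha>
    proof (cases "mdeg \<alpha> = 0")
      case True
      then show ?thesis using p(3) by (simp add: mdeg_eq_0 ev_eq_0)
    next
      case False
      then obtain k \<beta> where b: "\<alpha> = \<beta> + unit_expo k" using expo_decompose[of \<alpha>] by auto
      then have "\<beta> \<in> ?F" using upto_deg_closed[OF E(2)] \<alpha> by blast
      then show ?thesis using h(3) evp \<alpha> b by simp
    qed
    moreover have "\<nu> = \<Psi> p"
    proof (rule poly_mapping_eqI)
      fix c :: "'n expo \<times> 'n"
      obtain \<beta> k where c: "c = (\<beta>, k)" by (cases c)
      show "lookup \<nu> c = lookup (\<Psi> p) c"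
        using evp[of \<beta> k] h(1) by (auto simp: c l\<Psi> in_keys_iff subset_iff)
    qed
    ultimately show ?thesis by blast
  qed
  \<comment> \<open>An exponent of the border may be a product \<beta> + e_k in several ways. One is
    chosen, so that evaluation at \<alpha> becomes one coordinate of \<nu>.\<close>
  define rep where "rep \<alpha> = (SOME c. fst c \<in> ?F \<and> \<alpha> = fst c + unit_expo (snd c))" for \<alpha> :: "'n expo"
  have rep: "fst (rep \<alpha>) \<in> ?F" "\<alpha> = fst (rep \<alpha>) + unit_expo (snd (rep \<alpha>))" if \<alpha>: "\<alpha> \<in> A - ?F" for \<alpha>
  proof -
    have "\<alpha> \<in> border ?F" "\<alpha> \<noteq> 0" using \<alpha> A(2) \<open>0 \<in> ?F\<close> by auto
    then obtain \<beta> k where "\<beta> \<in> ?F" "\<alpha> = \<beta> + unit_expo k" by (auto simp: border_def)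
    then have "\<exists>c. fst c \<in> ?F \<and> \<alpha> = fst c + unit_expo (snd c)" by (intro exI[of _ "(\<beta>, k)"]) simp
    from someI_ex[OF this] show "fst (rep \<alpha>) \<in> ?F" "\<alpha> = fst (rep \<alpha>) + unit_expo (snd (rep \<alpha>))"
      unfolding rep_def by auto
  qed
  have lrep: "lookup (\<Psi> p) (rep \<alpha>) = ev p \<alpha>" if "\<alpha> \<in> A - ?F" for p \<alpha>
    using l\<Psi>[of p "fst (rep \<alpha>)" "snd (rep \<alpha>)"] rep[OF that] by simp
  have "pm.dim (H_kernel E (Suc t) D) = card (A - ?F)"
  proof (rule dual_fam_dim)
    show "pm.subspace (H_kernel E (Suc t) D)"
      unfolding H_kernel_pairing using subspace_keys[of "H_cols E (Suc t)"]
      by (auto simp: pm.subspace_def linfun_zero[OF linfun_pairing_right] linfun_add[OF linfun_pairing_right]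
          linfun_scale[OF linfun_pairing_right])
    show "dual_fam (\<lambda>\<alpha> \<nu>. lookup \<nu> (rep \<alpha>)) (\<lambda>\<alpha>. \<Psi> (u \<alpha>)) (A - ?F) (H_kernel E (Suc t) D)"
      unfolding dual_fam_def
    proof (intro conjI ballI)
      fix \<alpha> \<alpha>' assume a: "\<alpha> \<in> A - ?F"
      then show "\<Psi> (u \<alpha>) \<in> H_kernel E (Suc t) D"
        using A(1,3) by (intro \<Psi>K) (auto simp: dual_fam_def)
      assume a': "\<alpha>' \<in> A - ?F"
      then show "lookup (\<Psi> (u \<alpha>)) (rep \<alpha>') = (if \<alpha> = \<alpha>' then 1 else 0)"
        using lrep[OF a'] a A(3) by (auto simp: dual_fam_def)
    qed (use finA linfun_lookup in auto)
    show "separates (\<lambda>\<alpha> \<nu>. lookup \<nu> (rep \<alpha>)) (A - ?F) (H_kernel E (Suc t) D)"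
      unfolding separates_def
    proof (intro ballI impI)
      fix \<nu> assume \<nu>: "\<nu> \<in> H_kernel E (Suc t) D" "\<forall>\<alpha>\<in>A - ?F. lookup \<nu> (rep \<alpha>) = 0"
      obtain p where p: "p \<in> ?Z" "\<forall>\<beta>\<in>?F. ev p \<beta> = 0" "\<nu> = \<Psi> p" using surj[OF \<nu>(1)] by blast
      have "ev p \<alpha> = 0" if "\<alpha> \<in> A" for \<alpha>
        using \<nu>(2) lrep[of \<alpha> p] p(2,3) that by (cases "\<alpha> \<in> ?F") auto
      then have "p = 0" using A(4) p(1) by (simp add: separates_def)
      then show "\<nu> = 0"
        using p(3) by (intro poly_mapping_eqI) (auto simp: l\<Psi> ev_def split_paired_all)
    qed
  qed
  moreover have "card A = card ?F + card (A - ?F)"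
    using card_Diff_subset[OF L(4) A(1)] card_mono[OF finA A(1)] by simp
  ultimately show ?thesis using dimZ by simp
qed

section \<open>Regular components\<close>

lemma topspace_zariski_Grass_prod_eq:
  assumes "fin_dim V" "fin_dim V'"
  shows "topspace (zariski_Grass_prod m V m' V') = Grass m V \<times> Grass m' V'"
proof
  let ?S = "\<lambda>f. {(D, D') \<in> Grass m V \<times> Grass m' V'. \<exists>bs bs'. basis_list D bs \<and> basis_list D' bs' \<and>
         meval (case_sum (pluecker bs) (pluecker bs')) f \<noteq> 0}"
  have "\<exists>f :: ('a list + 'a list, complex) mpol. bihomogeneous f \<and> mvars f = {} \<and> (\<forall>c. meval c f = 1)"
    by (intro exI[of _ 1]) (simp add: bihomogeneous_def mvars_def meval_def)
  then obtain f :: "('a list + 'a list, complex) mpol"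
    where f: "bihomogeneous f" "mvars f = {}" "\<forall>c. meval c f = 1" by blast
  show "Grass m V \<times> Grass m' V' \<subseteq> topspace (zariski_Grass_prod m V m' V')"
  proof
    fix p assume p: "p \<in> Grass m V \<times> Grass m' V'"
    then obtain D D' where DD: "p = (D, D')" "D \<in> Grass m V" "D' \<in> Grass m' V'" by blast
    obtain bs bs' where "basis_list D bs" "basis_list D' bs'"
      using Grass_basis_exists[OF DD(2) assms(1)] Grass_basis_exists[OF DD(3) assms(2)] by blast
    then have "p \<in> ?S f" using DD f(3) by auto
    moreover have "?S f \<in> {?S f | f. bihomogeneous f \<and>
       mvars f \<subseteq> Inl ` {as. length as = m} \<union> Inr ` {as. length as = m'}}"
      using f(1,2) by blast
    ultimately show "p \<in> topspace (zariski_Grass_prod m V m' V')"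
      unfolding zariski_Grass_prod_def topology_generated_by_topspace by (rule UnionI[rotated])
  qed
qed (rule topspace_zariski_Grass_prod)

lemma dual_to_independent:
  assumes "dual_to us as"
  shows "distinct us \<and> pm.independent (set us)"
proof -
  let ?\<phi> = "\<lambda>i p :: 'a \<Rightarrow>\<^sub>0 complex. lookup p (as ! i)"
  have d: "dual_fam ?\<phi> ((!) us) {..<length us} UNIV"
    using assms linfun_lookup by (auto simp: dual_to_def dual_fam_def)
  have "set us = (!) us ` {..<length us}" by (auto simp: set_conv_nth)
  then show ?thesis
    using dual_fam_independent[OF d] dual_fam_inj[OF d] by (auto simp: distinct_conv_nth inj_on_def)
qed

text \<open>This lets a nonvanishing minor certify that a deformed list of vectors is still
  independent.\<close>

lemma pluecker_nonzero_basis: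
  assumes "pluecker bs as \<noteq> 0" "length as = length bs"
  shows "basis_list (pm.span (set bs)) bs"
proof (rule basis_listI_span)
  obtain M N where M: "dual_to (list_comb M bs) as"
    using pluecker_nonzero_dual[OF assms] by blast
  note us = dual_to_independent[OF M]
  have "set (list_comb M bs) \<subseteq> pm.span (set bs)"
    unfolding list_comb_def by (auto intro!: pm.span_sum pm.span_scale intro: pm.span_base)
  moreover have "fin_dim (pm.span (set bs))" by (auto simp: fin_dim_def)
  ultimately have "card (set (list_comb M bs)) \<le> pm.dim (pm.span (set bs))"
    using independent_card_le_dim us by blast
  then have "length bs \<le> pm.dim (pm.span (set bs))" using us distinct_card by fastforce
  moreover have "pm.dim (pm.span (set bs)) \<le> card (set bs)" by (rule pm.dim_le_card) auto
  ultimately show "length bs = pm.dim (pm.span (set bs))" using card_length[of bs] by simp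
qed simp

lemma finite_upto_deg: "finite E \<Longrightarrow> finite (upto_deg E t)"
  by (simp add: upto_deg_def)

lemma card_upto_deg_Suc:
  assumes "finite E"
  shows "card (upto_deg E (Suc t)) = card (upto_deg E t) + hfun E (Suc t)"
proof -
  have "upto_deg E (Suc t) = upto_deg E t \<union> {\<beta> \<in> E. mdeg \<beta> = Suc t}"
    by (auto simp: upto_deg_def)
  then show ?thesis
    unfolding hfun_def using assms by (simp add: card_Un_disjoint upto_deg_def disjoint_iff)
qed

lemma rsum_hfun: "finite E \<Longrightarrow> rsum (hfun E) t = card (upto_deg E t)"
proof (induction t)
  case 0
  show ?case by (simp add: rsum_def hfun_def upto_deg_def)
next
  case (Suc t)
  then show ?case by (simp add: card_upto_deg_Suc rsum_def)
qed

lemma upto_deg_0: "closed_under_division E \<Longrightarrow> E \<noteq> {} \<Longrightarrow> upto_deg (E :: 'n::finite expo set) 0 = {0}"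
proof -
  assume E: "closed_under_division E" "E \<noteq> {}"
  then obtain \<alpha> where "\<alpha> \<in> upto_deg E (mdeg \<alpha>)" by (auto simp: upto_deg_def)
  from zero_in_upto_deg[OF E(1) this] show ?thesis by (auto simp: upto_deg_def mdeg_eq_0)
qed

lemma span_one: "pm.span {1 :: ('a::finite, complex) mpol} = polys_le 0"
proof
  show "pm.span {1 :: ('a, complex) mpol} \<subseteq> polys_le 0"
    by (rule pm.span_minimal[OF _ polys_le_subspace]) (simp add: polys_le_def)
  show "polys_le 0 \<subseteq> pm.span {1 :: ('a::finite, complex) mpol}"
  proof
    fix p :: "('a, complex) mpol" assume p: "p \<in> polys_le 0"
    have "p = pscale (lookup p 0) 1"
    proof (rule poly_mapping_eqI)
      fix \<alpha>
      show "lookup p \<alpha> = lookup (pscale (lookup p 0) 1) \<alpha>"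
        using p mdeg_eq_0[of \<alpha>] by (cases "\<alpha> = 0") (auto simp: lookup_pscale lookup_one polys_le_iff)
    qed
    then show "p \<in> pm.span {1}" by (metis insertI1 pm.span_base pm.span_scale)
  qed
qed

lemma Hilb_reg_subset:
  assumes "finite E" "closed_under_division E" "E \<noteq> {}"
  shows "(Hilb_reg (hfun E) t :: ('n, complex) mpol set set) \<subseteq>
    Grass (card (upto_deg (E :: 'n::finite expo set) t)) (polys_le t)"
proof (cases t)
  case 0
  have "pm.dim (polys_le 0 :: ('n, complex) mpol set) = 1"
  proof -
    have "pm.independent {1 :: ('n, complex) mpol}" by simp
    then show ?thesis unfolding span_one[symmetric] using pm.dim_span_eq_card_independent by fastforce
  qed
  then have "(polys_le 0 :: ('n, complex) mpol set) \<in> Grass (card (upto_deg E 0)) (polys_le 0)"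
    using polys_le_subspace by (simp add: Grass_def upto_deg_0 assms One_nat_def)
  then show ?thesis unfolding 0 Hilb_reg.simps span_one by blast
next
  case (Suc s)
  show ?thesis
  proof
    fix D assume "D \<in> Hilb_reg (hfun E) t"
    then obtain D' where "(D', D) \<in> topspace (zariski_Grass_prod (rsum (hfun E) s) (polys_le s)
        (rsum (hfun E) (Suc s)) (polys_le (Suc s)))"
      unfolding Suc Hilb_reg.simps by (auto simp: in_closure_of)
    then have "D \<in> Grass (rsum (hfun E) (Suc s)) (polys_le (Suc s))"
      using topspace_zariski_Grass_prod by blast
    then show "D \<in> Grass (card (upto_deg E t)) (polys_le t)"
      using assms(1) by (simp add: Suc rsum_hfun)
  qed
qed

lemma U_reg_subset: "U_reg E t \<subseteq> Hilb_reg (hfun E) t"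
  by (auto simp: U_reg_def)

text \<open>Rank plus kernel dimension is the number of columns, and the kernel dimension differs
  from the dimension of the integrals by a constant. So few integrals mean large rank.\<close>

lemma H_rank_min_locus:
  fixes E :: "'n::{finite,linorder} expo set"
  assumes E: "finite E" "closed_under_division E" and ne: "upto_deg E t \<noteq> {}"
    and D: "D \<in> Hilb_B E t" "D \<in> min_locus (Suc t) (Hilb_reg (hfun E) t)"
  shows "H_rank E (Suc t) D = rho_gen E (Suc t)"
proof -
  let ?S = "Hilb_reg (hfun E) t \<inter> Hilb_B E t"
  have le: "H_rank E (Suc t) D' \<le> H_rank E (Suc t) D" if "D' \<in> ?S" for D'
  proof -
    have "pm.dim (integrals (Suc t) D) \<le> pm.dim (integrals (Suc t) D')"
      using D(2) that by (auto simp: min_locus_def)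
    then show ?thesis
      using H_kernel_dim[OF E D(1) ne] H_kernel_dim[OF E _ ne, of D'] that
        H_rank_nullity[OF E(1), of "Suc t" D] H_rank_nullity[OF E(1), of "Suc t" D'] by auto
  qed
  have "Max (H_rank E (Suc t) ` ?S) = H_rank E (Suc t) D"
  proof (rule Max_eqI)
    \<comment> \<open>There may be infinitely many points, but their ranks are bounded by that of
      D.\<close>
    show "finite (H_rank E (Suc t) ` ?S)"
      by (rule finite_subset[of _ "{..H_rank E (Suc t) D}"]) (use le in auto)
    show "H_rank E (Suc t) D \<in> H_rank E (Suc t) ` ?S"
      using D by (auto simp: min_locus_def)
  qed (use le in auto)
  then show ?thesis by (simp add: rho_gen_def)
qed

text \<open>The Grassmannian dimension depends only on the kernel dimension, which the rank
  determines. Hence the definite description is well defined and may be evaluated at any such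
  D.\<close>

lemma gamma_part_eq:
  fixes E :: "'n::{finite,linorder} expo set"
  assumes "finite E" "D \<in> U_reg E t" "H_rank E (Suc t) D = rho_gen E (Suc t)"
  shows "gamma_part E (Suc t) = Grass_dim (hfun E (Suc t)) (H_kernel E (Suc t) D)"
proof -
  have "pm.dim (H_kernel E (Suc t) D') = pm.dim (H_kernel E (Suc t) D)"
    if "H_rank E (Suc t) D' = rho_gen E (Suc t)" for D'
    using that assms(3) H_rank_nullity[OF assms(1), of "Suc t" D] H_rank_nullity[OF assms(1), of "Suc t" D'] by simp
  note dim = this
  have "(THE d. \<exists>D\<in>U_reg E t. H_rank E (Suc t) D = rho_gen E (Suc t) \<and>
      d = Grass_dim (hfun E (Suc t)) (H_kernel E (Suc t) D)) = Grass_dim (hfun E (Suc t)) (H_kernel E (Suc t) D)"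
  proof (rule the_equality)
    fix d assume "\<exists>D\<in>U_reg E t. H_rank E (Suc t) D = rho_gen E (Suc t) \<and>
      d = Grass_dim (hfun E (Suc t)) (H_kernel E (Suc t) D)"
    then obtain D' where "H_rank E (Suc t) D' = rho_gen E (Suc t)"
      "d = Grass_dim (hfun E (Suc t)) (H_kernel E (Suc t) D')" by blast
    then show "d = Grass_dim (hfun E (Suc t)) (H_kernel E (Suc t) D)"
      using dim[of D'] by (simp add: Grass_dim_def)
  qed (use assms(2,3) in blast)
  then show ?thesis by (simp add: gamma_part_def)
qed


section \<open>Rational parametrizations of the regular components\<close>

text \<open>Cutting off above degree t guarantees finite support for arbitrary L;
  \<open>parametrizes\<close> demands that no coefficient be lost by it.\<close>

definition pt_elem :: "nat \<Rightarrow> (('v \<Rightarrow> complex) \<Rightarrow> complex) \<Rightarrow> ('n expo \<Rightarrow> 'n expo \<Rightarrow> ('v \<Rightarrow> complex) \<Rightarrow> complex)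
    \<Rightarrow> ('v \<Rightarrow> complex) \<Rightarrow> 'n expo \<Rightarrow> ('n, complex) mpol"
  where "pt_elem t g L c \<beta> = from_coeffs {\<alpha>. mdeg \<alpha> \<le> t} (\<lambda>\<alpha>. L \<beta> \<alpha> c / g c)"

definition pt_space :: "'n expo set \<Rightarrow> nat \<Rightarrow> (('v \<Rightarrow> complex) \<Rightarrow> complex)
    \<Rightarrow> ('n expo \<Rightarrow> 'n expo \<Rightarrow> ('v \<Rightarrow> complex) \<Rightarrow> complex) \<Rightarrow> ('v \<Rightarrow> complex) \<Rightarrow> ('n, complex) mpol set"
  where "pt_space E t g L c = pm.span (pt_elem t g L c ` upto_deg E t)"

text \<open>\<open>g\<close> is a common denominator: at a point \<open>c\<close> with \<open>g c \<noteq> 0\<close> the coefficient of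
  \<open>d\<^sup>\<alpha>\<close> in the dual basis element indexed by \<open>\<beta>\<close> is \<open>L \<beta> \<alpha> c / g c\<close>. The last clause expresses
  that the image is Zariski dense.\<close>

definition parametrizes :: "('n::{finite,linorder}) expo set \<Rightarrow> nat \<Rightarrow> ('n expo \<times> 'n expo) set
    \<Rightarrow> (('n expo \<times> 'n expo \<Rightarrow> complex) \<Rightarrow> complex)
    \<Rightarrow> ('n expo \<Rightarrow> 'n expo \<Rightarrow> ('n expo \<times> 'n expo \<Rightarrow> complex) \<Rightarrow> complex) \<Rightarrow> bool"
  where "parametrizes E t V g L \<longleftrightarrow>
    finite V \<and> V \<subseteq> mu_index (upto_deg E t) \<and> card V = (\<Sum>s\<le>t. gamma_part E s) \<and>
    g \<in> polyfun \<rat> V \<and> (\<forall>\<beta>\<in>upto_deg E t. \<forall>\<alpha>. L \<beta> \<alpha> \<in> polyfun \<rat> V) \<and> (\<exists>c. g c \<noteq> 0) \<and>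
    (\<forall>c. g c \<noteq> 0 \<longrightarrow>
      dual_basis (upto_deg E t) (pt_space E t g L c) (pt_elem t g L c) \<and>
      (\<forall>\<beta>\<in>upto_deg E t. \<forall>\<alpha>. lookup (pt_elem t g L c \<beta>) \<alpha> = L \<beta> \<alpha> c / g c) \<and>
      (\<forall>(\<beta>, \<alpha>)\<in>V. of_nat (mfact \<alpha>) * L \<beta> \<alpha> c = c (\<beta>, \<alpha>) * g c) \<and>
      (\<forall>k. pdiff k ` pt_space E t g L c \<subseteq> pt_space E t g L c) \<and>
      pt_space E t g L c \<in> U_reg E t) \<and>
    (\<forall>D\<in>Hilb_reg (hfun E) t. \<forall>bs F. basis_list D bs \<longrightarrow>
      F \<in> polyfun UNIV ({..<card (upto_deg E t)} \<times> UNIV) \<longrightarrow> F (entries bs) \<noteq> 0 \<longrightarrow>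
      (\<exists>c bs'. g c \<noteq> 0 \<and> basis_list (pt_space E t g L c) bs' \<and> F (entries bs') \<noteq> 0))"

lemma parametrizesD:
  assumes "parametrizes E t V g L"
  shows "finite V" "V \<subseteq> mu_index (upto_deg E t)" "card V = (\<Sum>s\<le>t. gamma_part E s)"
    "g \<in> polyfun \<rat> V" "\<And>\<beta> \<alpha>. \<beta> \<in> upto_deg E t \<Longrightarrow> L \<beta> \<alpha> \<in> polyfun \<rat> V" "\<exists>c. g c \<noteq> 0"
    "\<And>c. g c \<noteq> 0 \<Longrightarrow> dual_basis (upto_deg E t) (pt_space E t g L c) (pt_elem t g L c)"
    "\<And>c \<beta> \<alpha>. g c \<noteq> 0 \<Longrightarrow> \<beta> \<in> upto_deg E t \<Longrightarrow> lookup (pt_elem t g L c \<beta>) \<alpha> = L \<beta> \<alpha> c / g c"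
    "\<And>c \<beta> \<alpha>. g c \<noteq> 0 \<Longrightarrow> (\<beta>, \<alpha>) \<in> V \<Longrightarrow> of_nat (mfact \<alpha>) * L \<beta> \<alpha> c = c (\<beta>, \<alpha>) * g c"
    "\<And>c k. g c \<noteq> 0 \<Longrightarrow> pdiff k ` pt_space E t g L c \<subseteq> pt_space E t g L c"
    "\<And>c. g c \<noteq> 0 \<Longrightarrow> pt_space E t g L c \<in> U_reg E t"
    "\<And>D bs F. D \<in> Hilb_reg (hfun E) t \<Longrightarrow> basis_list D bs \<Longrightarrow>
      F \<in> polyfun UNIV ({..<card (upto_deg E t)} \<times> UNIV) \<Longrightarrow> F (entries bs) \<noteq> 0 \<Longrightarrow>
      \<exists>c bs'. g c \<noteq> 0 \<and> basis_list (pt_space E t g L c) bs' \<and> F (entries bs') \<noteq> 0"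
proof -
  note P = assms[unfolded parametrizes_def]
  show "finite V" using P by (elim conjE)
  show "V \<subseteq> mu_index (upto_deg E t)" using P by (elim conjE)
  show "card V = (\<Sum>s\<le>t. gamma_part E s)" using P by (elim conjE)
  show "g \<in> polyfun \<rat> V" using P by (elim conjE)
  show "\<exists>c. g c \<noteq> 0" using P by (elim conjE)
  have L: "\<forall>\<beta>\<in>upto_deg E t. \<forall>\<alpha>. L \<beta> \<alpha> \<in> polyfun \<rat> V" using P by (elim conjE)
  then show "L \<beta> \<alpha> \<in> polyfun \<rat> V" if "\<beta> \<in> upto_deg E t" for \<beta> \<alpha> using that by simp
  have pts: "\<forall>c. g c \<noteq> 0 \<longrightarrow>
      dual_basis (upto_deg E t) (pt_space E t g L c) (pt_elem t g L c) \<and>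
      (\<forall>\<beta>\<in>upto_deg E t. \<forall>\<alpha>. lookup (pt_elem t g L c \<beta>) \<alpha> = L \<beta> \<alpha> c / g c) \<and>
      (\<forall>(\<beta>, \<alpha>)\<in>V. of_nat (mfact \<alpha>) * L \<beta> \<alpha> c = c (\<beta>, \<alpha>) * g c) \<and>
      (\<forall>k. pdiff k ` pt_space E t g L c \<subseteq> pt_space E t g L c) \<and>
      pt_space E t g L c \<in> U_reg E t"
    using P by (elim conjE)
  show "dual_basis (upto_deg E t) (pt_space E t g L c) (pt_elem t g L c)"
    "pdiff k ` pt_space E t g L c \<subseteq> pt_space E t g L c" "pt_space E t g L c \<in> U_reg E t"
    if "g c \<noteq> 0" for c k
    using pts[rule_format, OF that] by simp_all
  show "lookup (pt_elem t g L c \<beta>) \<alpha> = L \<beta> \<alpha> c / g c" if "g c \<noteq> 0" "\<beta> \<in> upto_deg E t" for c \<beta> \<alpha>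
    using pts[rule_format, OF that(1)] that(2) by simp
  show "of_nat (mfact \<alpha>) * L \<beta> \<alpha> c = c (\<beta>, \<alpha>) * g c" if "g c \<noteq> 0" "(\<beta>, \<alpha>) \<in> V" for c \<beta> \<alpha>
    using pts[rule_format, OF that(1)] that(2) by blast
  have dense: "\<forall>D\<in>Hilb_reg (hfun E) t. \<forall>bs F. basis_list D bs \<longrightarrow>
      F \<in> polyfun UNIV ({..<card (upto_deg E t)} \<times> UNIV) \<longrightarrow> F (entries bs) \<noteq> 0 \<longrightarrow>
      (\<exists>c bs'. g c \<noteq> 0 \<and> basis_list (pt_space E t g L c) bs' \<and> F (entries bs') \<noteq> 0)"
    using P by (elim conjE)
  show "\<exists>c bs'. g c \<noteq> 0 \<and> basis_list (pt_space E t g L c) bs' \<and> F (entries bs') \<noteq> 0"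
    if "D \<in> Hilb_reg (hfun E) t" "basis_list D bs"
      "F \<in> polyfun UNIV ({..<card (upto_deg E t)} \<times> UNIV)" "F (entries bs) \<noteq> 0" for D bs F
    by (rule dense[rule_format]) (fact that)+
qed

lemma parametrizes_0:
  fixes E :: "'n::{finite,linorder} expo set"
  assumes "finite E" "closed_under_division E" "E \<noteq> {}"
  shows "parametrizes E 0 {} (\<lambda>_. 1) (\<lambda>\<beta> \<alpha> _. if \<alpha> = 0 then 1 else 0)"
proof -
  let ?g = "\<lambda>_ :: 'n expo \<times> 'n expo \<Rightarrow> complex. 1 :: complex"
  let ?L = "\<lambda>(\<beta> :: 'n expo) (\<alpha> :: 'n expo) (_ :: 'n expo \<times> 'n expo \<Rightarrow> complex). if \<alpha> = 0 then 1 else 0 :: complex"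
  have E0: "upto_deg E 0 = {0}" using assms by (intro upto_deg_0)
  have el: "pt_elem 0 ?g ?L c \<beta> = 1" for c \<beta>
    by (rule poly_mapping_eqI) (simp add: pt_elem_def lookup_from_coeffs mdeg_eq_0 lookup_one when_def)
  have sp: "pt_space E 0 ?g ?L c = polys_le 0" for c
    by (simp add: pt_space_def E0 el span_one)
  have pd: "pdiff k p = 0" if "p \<in> polys_le 0" for k and p :: "('n, complex) mpol"
    by (rule poly_mapping_eqI) (use that in \<open>simp add: lookup_pdiff polys_le_iff\<close>)
  have "dual_basis {0} (polys_le 0) (\<lambda>_. 1 :: ('n, complex) mpol)"
    unfolding dual_basis_def dual_fam_def separates_def
  proof (intro conjI ballI impI)
    fix x :: "('n, complex) mpol" assume x: "x \<in> polys_le 0" "\<forall>i\<in>{0}. ev x i = 0"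
    show "x = 0"
    proof (rule poly_mapping_eqI)
      fix \<alpha> show "lookup x \<alpha> = lookup 0 \<alpha>"
        using x mdeg_eq_0[of \<alpha>] by (cases "\<alpha> = 0") (auto simp: ev_eq_0 polys_le_iff)
    qed
  next
    show "pm.subspace (polys_le 0)" by (rule polys_le_subspace)
    show "linfun (\<lambda>p. ev p i)" for i :: "'n expo" by (rule linfun_ev)
  qed (auto simp: polys_le_def ev_def mfact_def)
  moreover have "L \<beta> \<alpha> \<in> polyfun \<rat> V" if "L = ?L" for L \<beta> \<alpha> V
    unfolding that by (cases "\<alpha> = 0") (auto intro: polyfun.const)
  moreover have "0 \<in> polys_le 0" by (simp add: polys_le_def)
  ultimately show ?thesis
    unfolding parametrizes_def sp el E0
    by (auto simp: gamma_part_def lookup_one U_reg_def span_one pd polyfun.const pm.subspace_0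
        intro: polyfun.const)
qed

text \<open>A basis at one point of the parameter space is a constant matrix times the scaled canonical
  basis there, and this matrix can be used at all other points.\<close>

lemma parametrizes_dense:
  assumes p: "parametrizes E t V g L" and D: "D \<in> Hilb_reg (hfun E) t" "basis_list D bs"
    and F: "F \<in> polyfun UNIV ({..<card (upto_deg E t)} \<times> UNIV)" "F (entries bs) \<noteq> 0"
    and \<delta>: "\<delta> \<in> polyfun UNIV V" "\<delta> c1 \<noteq> 0"
  shows "\<exists>c bs'. g c \<noteq> 0 \<and> \<delta> c \<noteq> 0 \<and> basis_list (pt_space E t g L c) bs' \<and> F (entries bs') \<noteq> 0"
proof -
  note P = parametrizesD[OF p]
  let ?n = "card (upto_deg E t)"
  obtain c0 bs0 where c0: "g c0 \<noteq> 0" "basis_list (pt_space E t g L c0) bs0" "F (entries bs0) \<noteq> 0"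
    using P(12)[OF D F] by blast
  have finE: "finite (upto_deg E t)" using dual_basisD(4)[OF P(7)[OF c0(1)]] .
  obtain es where es: "set es = upto_deg E t" "distinct es" using finite_distinct_list[OF finE] by blast
  have len: "length es = ?n" using es distinct_card by fastforce
  have esin: "es ! j \<in> upto_deg E t" if "j < ?n" for j using that len es by (metis nth_mem)
  define cb where "cb c = map (pt_elem t g L c) es" for c
  have lcb: "length (cb c) = ?n" for c by (simp add: cb_def len)
  have cb: "basis_list (pt_space E t g L c) (cb c)" if "g c \<noteq> 0" for c
    unfolding cb_def using dual_basisD(1-3)[OF P(7)[OF that]] es by (intro basis_list_dual) auto
  obtain M N where M: "bs0 = list_comb M (cb c0)" "left_inv ?n N M"
    using basis_list_change[OF cb[OF c0(1)] c0(2)] by (auto simp: lcb)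
  \<comment> \<open>Writing L in place of L / g keeps G polynomial in c. The missing factor g c is
    put into the matrix, which stays invertible where g c is nonzero.\<close>
  define G where "G c = F (\<lambda>(i, \<alpha>). \<Sum>j<?n. (M i j / g c0) * L (es ! j) \<alpha> c)" for c
  have G: "G \<in> polyfun UNIV V"
    unfolding G_def[abs_def] using F(1)
  proof (rule polyfun_compose)
    fix v :: "nat \<times> 'a expo"
    have "L (es ! j) \<alpha> \<in> polyfun UNIV V" if "j < ?n" for j \<alpha>
      using P(5)[OF esin[OF that]] polyfun_mono by blast
    then show "(\<lambda>c. (case v of (i, \<alpha>) \<Rightarrow> \<Sum>j<?n. M i j / g c0 * L (es ! j) \<alpha> c)) \<in> polyfun UNIV V"
      unfolding split_def by (intro polyfun_sum polyfun_cmult) auto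
  qed
  have Geq: "G c = F (entries (list_comb (\<lambda>i j. g c / g c0 * M i j) (cb c)))" if "g c \<noteq> 0" for c
    unfolding G_def
  proof (rule polyfun_cong[OF F(1)], clarify)
    fix i \<alpha> assume i: "i < ?n"
    have "(\<Sum>j<?n. M i j / g c0 * L (es ! j) \<alpha> c) = (\<Sum>j<?n. g c / g c0 * M i j * lookup (cb c ! j) \<alpha>)"
      using that by (intro sum.cong) (auto simp: cb_def len P(8)[OF that esin])
    then show "(\<Sum>j<?n. M i j / g c0 * L (es ! j) \<alpha> c) = entries (list_comb (\<lambda>i j. g c / g c0 * M i j) (cb c)) (i, \<alpha>)"
      using i by (simp add: entries_def lookup_list_comb lcb)
  qed
  have "G c0 \<noteq> 0" using Geq[OF c0(1)] c0 M(1) by simp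
  moreover have gU: "g \<in> polyfun UNIV V" using P(4) by (rule polyfun_mono) auto
  moreover have "(\<lambda>c. g c * \<delta> c) \<in> polyfun UNIV V" by (rule polyfun.mult[OF gU \<delta>(1)])
  moreover have "\<exists>c. g c \<noteq> 0 \<and> \<delta> c \<noteq> 0" 
    by (rule polyfun_nonzero_common[where F = g and G = \<delta>, OF gU \<delta>(1) c0(1) \<delta>(2)])
  then obtain c2 where "g c2 * \<delta> c2 \<noteq> 0" by (elim exE conjE) (simp add: no_zero_divisors)
  ultimately have "\<exists>c. G c \<noteq> 0 \<and> g c * \<delta> c \<noteq> 0"
    by (intro polyfun_nonzero_common[where F = G and G = "\<lambda>c. g c * \<delta> c" and ?c1.0 = c0 and ?c2.0 = c2, OF G])
  then obtain c where c: "G c \<noteq> 0" "g c * \<delta> c \<noteq> 0" by blast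
  then have gc: "g c \<noteq> 0" "\<delta> c \<noteq> 0" by auto
  have "left_inv ?n (\<lambda>i j. N i j / (g c / g c0)) (\<lambda>i j. g c / g c0 * M i j)"
    using M(2) gc c0(1) by (simp add: left_inv_def)
  then have "basis_list (pt_space E t g L c) (list_comb (\<lambda>i j. g c / g c0 * M i j) (cb c))"
    using basis_list_list_comb[OF cb[OF gc(1)]] by (simp add: lcb)
  then show ?thesis using Geq[OF gc(1)] c(1) gc by auto
qed

text \<open>A point of the incidence variety over the minimal locus deforms to points over parametrized
  spaces, because bases of the spaces of integrals extend to polynomial sections.\<close>

lemma parametrizes_lift:
  fixes E :: "'n::{finite,linorder} expo set"
  assumes E: "finite E" "closed_under_division E" "E \<noteq> {}"
    and p: "parametrizes E t V g L"
    and W: "(D, D') \<in> W_pairs (hfun E) (Suc t)" "D \<in> min_locus (Suc t) (Hilb_reg (hfun E) t)"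
    and F: "basis_list D' bs" "F \<in> polyfun UNIV ({..<card (upto_deg E (Suc t))} \<times> UNIV)" "F (entries bs) \<noteq> 0"
    and \<delta>: "\<delta> \<in> polyfun UNIV V" "\<delta> c1 \<noteq> 0"
  shows "\<exists>c D'' bs''. g c \<noteq> 0 \<and> \<delta> c \<noteq> 0 \<and> pt_space E t g L c \<in> min_locus (Suc t) (Hilb_reg (hfun E) t) \<and>
    pt_space E t g L c \<subseteq> D'' \<and> D'' \<subseteq> integrals (Suc t) (pt_space E t g L c) \<and>
    basis_list D'' bs'' \<and> length bs'' = card (upto_deg E (Suc t)) \<and> F (entries bs'') \<noteq> 0"
proof -
  note P = parametrizesD[OF p]
  let ?m = "card (upto_deg E t)" and ?n = "card (upto_deg E (Suc t))"
  let ?X = "Hilb_reg (hfun E) t :: ('n, complex) mpol set set"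
  have DD: "pm.subspace D" "D \<subseteq> polys_le t" "pm.dim D = ?m" "pm.subspace D'" "D' \<subseteq> polys_le (Suc t)" "pm.dim D' = ?n"
      "D \<subseteq> D'" "\<And>k. pdiff k ` D' \<subseteq> D"
    using W(1) E(1) by (auto simp: W_pairs_def Grass_def rsum_hfun)
  have DX: "D \<in> ?X" using W(2) by (simp add: min_locus_def)
  have D'int: "D' \<subseteq> integrals (Suc t) D" unfolding integrals_def using DD(5,8) by blast
  have fD: "fin_dim D'" using basis_list_fin_dim[OF F(1)] .
  obtain b0 where b0: "basis_list D b0" using basis_list_exists[OF DD(1) fin_dim_subset[OF fD DD(7)]] by blast
  have lb0: "length b0 = ?m" using basis_list_dim[OF b0] DD(3) by simp
  obtain l0 where l0: "basis_list D' (b0 @ l0)" using basis_list_extend[OF b0 DD(7,4) fD] by blast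
  have ll0: "?n = ?m + length l0" using basis_list_dim[OF l0] DD(6) lb0 by simp
  obtain M N where M: "bs = list_comb M (b0 @ l0)" "left_inv ?n N M"
    using basis_list_change[OF l0 F(1)] ll0 lb0 by auto
  obtain us as where us: "basis_list D' us" "dual_to us as" using dual_basis_exists[OF DD(4) fD] by blast
  obtain M' N' where M': "us = list_comb M' (b0 @ l0)"
    using basis_list_change[OF l0 us(1)] by blast
  have las: "length as = ?n" using us basis_list_dim[OF us(1)] DD(6) by (simp add: dual_to_def)
  have "pluecker us as = 1" using pluecker_dual_one[OF us(2)] .
  then have pl0: "pluecker (b0 @ l0) as \<noteq> 0"
    using pluecker_list_comb[of as "b0 @ l0" M'] M' las ll0 lb0 by auto
  obtain Q where Q: "Q \<in> polyfun UNIV ({..<?n} \<times> UNIV)"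
      "\<And>b. length b = ?n \<Longrightarrow> Q (entries b) = pluecker b as"
    using pluecker_polyfun[OF las] by blast
  define F2 where "F2 x = F (\<lambda>(i, a). \<Sum>j<?n. M i j * x (j, a))" for x
  have F2: "F2 \<in> polyfun UNIV ({..<?n} \<times> UNIV)"
    unfolding F2_def[abs_def] by (rule polyfun_change_basis[OF F(2)])
  have F2': "F2 (entries b) = F (entries (list_comb M b))" if "length b = ?n" for b
    unfolding F2_def using polyfun_entries_list_comb[of F b M] F(2) that by simp
  \<comment> \<open>F2 is F expressed in the basis adapted to D. The minor Q is included so that the
    deformed vectors remain independent and span a space of the right dimension.\<close>
  define F3 where "F3 x = F2 x * Q x" for x
  have F3: "F3 \<in> polyfun UNIV ({..<?m + length l0} \<times> UNIV)"
    unfolding F3_def[abs_def] using polyfun.mult[OF F2 Q(1)] ll0 by simp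
  have F30: "F3 (entries (b0 @ l0)) \<noteq> 0"
    using F(3) M(1) pl0 F2'[of "b0 @ l0"] Q(2)[of "b0 @ l0"] ll0 lb0 by (simp add: F3_def)
  have "set l0 \<subseteq> D'" using l0 pm.span_superset by (fastforce simp: basis_list_def)
  then have l0int: "set l0 \<subseteq> integrals (Suc t) D" using D'int by blast
  from integrals_section[OF b0 lb0 DD(2) l0int refl F3 F30] obtain F1 where
    F1: "F1 \<in> polyfun UNIV ({..<?m} \<times> UNIV)" "F1 (entries b0) \<noteq> 0" and
    sect: "\<forall>D' bs'. basis_list D' bs' \<and> length bs' = ?m \<and> D' \<subseteq> polys_le t \<and> F1 (entries bs') \<noteq> 0 \<longrightarrow>
      pm.dim (integrals (Suc t) D') \<le> pm.dim (integrals (Suc t) D) \<and>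
      (pm.dim (integrals (Suc t) D') = pm.dim (integrals (Suc t) D) \<longrightarrow>
        (\<exists>ls'. length ls' = length l0 \<and> set ls' \<subseteq> integrals (Suc t) D' \<and> F3 (entries (bs' @ ls')) \<noteq> 0))"
    by (elim exE conjE)
  from parametrizes_dense[OF p DX b0 F1 \<delta>] obtain c b where
    c: "g c \<noteq> 0" "\<delta> c \<noteq> 0" "basis_list (pt_space E t g L c) b" "F1 (entries b) \<noteq> 0"
    by (elim exE conjE)
  let ?D = "pt_space E t g L c"
  have DcX: "?D \<in> ?X" using P(11)[OF c(1)] U_reg_subset by blast
  then have "?D \<in> Grass ?m (polys_le t)" using Hilb_reg_subset[OF E] by blast
  then have Dc: "?D \<subseteq> polys_le t" "pm.dim ?D = ?m" by (auto simp: Grass_def)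
  have lb: "length b = ?m" using basis_list_dim[OF c(3)] Dc by simp
  have le: "pm.dim (integrals (Suc t) D) \<le> pm.dim (integrals (Suc t) D2)" if "D2 \<in> ?X" for D2
    using W(2) that by (auto simp: min_locus_def)
  have s: "pm.dim (integrals (Suc t) ?D) \<le> pm.dim (integrals (Suc t) D)"
      "pm.dim (integrals (Suc t) ?D) = pm.dim (integrals (Suc t) D) \<longrightarrow>
        (\<exists>ls'. length ls' = length l0 \<and> set ls' \<subseteq> integrals (Suc t) ?D \<and> F3 (entries (b @ ls')) \<noteq> 0)"
    using sect c(3,4) lb Dc(1) by blast+
  \<comment> \<open>The section bounds the dimension from above, and minimality of D bounds it from
    below.\<close>
  then have eq: "pm.dim (integrals (Suc t) ?D) = pm.dim (integrals (Suc t) D)"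
    using le[OF DcX] by simp
  then obtain ls where ls: "length ls = length l0" "set ls \<subseteq> integrals (Suc t) ?D" "F3 (entries (b @ ls)) \<noteq> 0"
    using s(2) by blast
  have len: "length (b @ ls) = ?n" using lb ls(1) ll0 by simp
  define D'' where "D'' = pm.span (set (b @ ls))"
  have "pluecker (b @ ls) as \<noteq> 0" using ls(3) Q(2)[OF len] by (auto simp: F3_def)
  then have b'': "basis_list D'' (b @ ls)" unfolding D''_def
    using pluecker_nonzero_basis las len by metis
  have bD: "set b \<subseteq> ?D" using c(3) pm.span_superset by (fastforce simp: basis_list_def)
  have "?D = pm.span (set b)" using c(3) by (simp add: basis_list_def)
  also have "\<dots> \<subseteq> D''" unfolding D''_def by (rule pm.span_mono) auto
  finally have "?D \<subseteq> D''" .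
  moreover have "?D \<subseteq> integrals (Suc t) ?D" using integrals_contains[OF Dc(1) P(10)[OF c(1)]] .
  then have "D'' \<subseteq> integrals (Suc t) ?D"
    unfolding D''_def using ls(2) bD basis_list_subspace[OF c(3)]
    by (intro pm.span_minimal integrals_subspace) auto
  moreover have "basis_list D'' (list_comb M (b @ ls))"
    using basis_list_list_comb[OF b''] M(2) len by simp
  moreover have "F (entries (list_comb M (b @ ls))) \<noteq> 0"
    using ls(3) F2'[OF len] by (auto simp: F3_def)
  moreover have "?D \<in> min_locus (Suc t) ?X" using DcX le eq by (auto simp: min_locus_def)
  moreover have "length (list_comb M (b @ ls)) = ?n" using len by simp
  ultimately show ?thesis using c(1,2) by blast
qed

section \<open>Degrees attained in E and the Pluecker chart of the next degree\<close>

lemma lower_degree_attained: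
  fixes E :: "'n::finite expo set"
  assumes "closed_under_division E" "\<beta> \<in> E" "s \<le> mdeg \<beta>"
  shows "\<exists>\<gamma>\<in>E. mdeg \<gamma> = s"
  using assms(2,3)
proof (induction "mdeg \<beta>" arbitrary: \<beta>)
  case 0
  then show ?case by auto
next
  case (Suc d)
  show ?case
  proof (cases "s = mdeg \<beta>")
    case False
    obtain k \<beta>' where b: "\<beta> = \<beta>' + unit_expo k" using expo_decompose[of \<beta>] Suc.hyps(2) by auto
    have "\<beta>' + unit_expo k \<in> upto_deg E (mdeg \<beta>)" using Suc.prems(1) b by (simp add: upto_deg_def)
    then have "\<beta>' \<in> E" using upto_deg_closed[OF assms(1)] by (auto simp: upto_deg_def)
    moreover have "d = mdeg \<beta>'" "s \<le> mdeg \<beta>'" using Suc.hyps(2) Suc.prems(2) False b by auto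
    ultimately show ?thesis using Suc.hyps(1) by blast
  qed (use Suc.prems in auto)
qed

text \<open>Dividing by one variable at a time shows that E has an element in every degree up to its
  top degree, hence at least t + 1 elements of degree at most t.\<close>

lemma less_card_upto_deg:
  fixes E :: "'n::finite expo set"
  assumes "finite E" "closed_under_division E" "E \<noteq> {}" "t \<le> top_deg E"
  shows "t < card (upto_deg E t)"
proof -
  have "top_deg E \<in> mdeg ` E" unfolding top_deg_def using assms by (intro Max_in) auto
  then obtain \<beta> where \<beta>: "\<beta> \<in> E" "mdeg \<beta> = top_deg E" by auto
  have "{..t} \<subseteq> mdeg ` upto_deg E t"
  proof
    fix s assume s: "s \<in> {..t}"
    then obtain \<gamma> where "\<gamma> \<in> E" "mdeg \<gamma> = s" using lower_degree_attained[OF assms(2) \<beta>(1), of s] \<beta>(2) assms(4) by auto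
    then show "s \<in> mdeg ` upto_deg E t" using s by (auto simp: upto_deg_def)
  qed
  then have "card {..t} \<le> card (mdeg ` upto_deg E t)"
    using finite_upto_deg[OF assms(1)] by (intro card_mono) auto
  also have "\<dots> \<le> card (upto_deg E t)" using finite_upto_deg[OF assms(1)] by (rule card_image_le)
  finally show ?thesis by simp
qed

lemma dual_fam_span_separates:
  assumes "dual_fam \<phi> u I (pm.span (u ` I))"
  shows "separates \<phi> I (pm.span (u ` I))"
  unfolding separates_def
proof (intro ballI impI)
  fix x assume x: "x \<in> pm.span (u ` I)" "\<forall>i\<in>I. \<phi> i x = 0"
  obtain f where f: "x = (\<Sum>i\<in>I. pscale (f i) (u i))"
    using span_image_sum[OF _ x(1)] assms by (auto simp: dual_fam_def)
  have "f i = 0" if "i \<in> I" for i using dual_fam_coeff[OF assms that, of f] f x(2) that by simp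
  then show "x = 0" unfolding f by (intro sum.neutral) simp
qed

text \<open>The factorials turn duality for \<open>ev\<close> into duality for plain
  coefficients.\<close>

lemma dual_basis_pluecker:
  assumes "dual_basis F D \<Lambda>" "set es = F" "distinct es"
  shows "basis_list D (map (\<lambda>\<beta>. pscale (of_nat (mfact \<beta>)) (\<Lambda> \<beta>)) es)"
    "dual_to (map (\<lambda>\<beta>. pscale (of_nat (mfact \<beta>)) (\<Lambda> \<beta>)) es) es"
proof -
  let ?u = "\<lambda>\<beta>. pscale (of_nat (mfact \<beta>)) (\<Lambda> \<beta>)"
  note D = dual_basisD[OF assms(1)]
  have l: "lookup (?u \<beta>) \<gamma> = (if \<beta> = \<gamma> then 1 else 0)" if "\<beta> \<in> F" "\<gamma> \<in> F" for \<beta> \<gamma>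
    using D(7)[OF that] by (auto simp: ev_def lookup_pscale split: if_splits)
  have "dual_fam (\<lambda>\<alpha> p. lookup p \<alpha>) ?u (set es) D"
    using D l assms(2) linfun_lookup by (auto simp: dual_fam_def intro: pm.subspace_scale)
  moreover have "separates (\<lambda>\<alpha> p. lookup p \<alpha>) (set es) D"
    using D(3) assms(2) by (simp add: separates_def ev_eq_0)
  ultimately show "basis_list D (map ?u es)"
    using basis_list_dual[OF D(1) _ assms(3)] by blast
  show "dual_to (map ?u es) es"
    using l assms nth_eq_iff_index_eq[OF assms(3)] by (auto simp: dual_to_def)
qed

lemma pluecker_dual_fam:
  assumes "basis_list D bs" "pluecker bs es \<noteq> 0" "length es = length bs" "distinct es"
  shows "\<exists>u. dual_fam (\<lambda>\<gamma> p. ev p \<gamma>) u (set es) D"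
proof -
  obtain M N where M: "left_inv (length bs) N M" "dual_to (list_comb M bs) es"
    using pluecker_nonzero_dual[OF assms(2,3)] by blast
  define us where "us = list_comb M bs"
  have us: "basis_list D us" "length us = length es"
    unfolding us_def using basis_list_list_comb[OF assms(1) M(1)] assms(3) by auto
  define idx where "idx \<alpha> = (SOME i. i < length es \<and> es ! i = \<alpha>)" for \<alpha>
  have idx: "idx \<alpha> < length es \<and> es ! idx \<alpha> = \<alpha>" if "\<alpha> \<in> set es" for \<alpha>
    unfolding idx_def by (rule someI_ex) (use that in \<open>auto simp: in_set_conv_nth\<close>)
  define u where "u \<alpha> = pscale (1 / of_nat (mfact \<alpha>)) (us ! idx \<alpha>)" for \<alpha>
  have "ev (u \<alpha>) \<gamma> = (if \<alpha> = \<gamma> then 1 else 0)" if "\<alpha> \<in> set es" "\<gamma> \<in> set es" for \<alpha> \<gamma>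
  proof -
    have "lookup (us ! idx \<alpha>) \<gamma> = (if idx \<alpha> = idx \<gamma> then 1 else 0)"
      using M(2) idx[OF that(1)] idx[OF that(2)] us(2) unfolding us_def[symmetric] dual_to_def by metis
    moreover have "idx \<alpha> = idx \<gamma> \<longleftrightarrow> \<alpha> = \<gamma>" using idx[OF that(1)] idx[OF that(2)] by metis
    ultimately show ?thesis by (simp add: u_def ev_def lookup_pscale)
  qed
  moreover have "u \<alpha> \<in> D" if "\<alpha> \<in> set es" for \<alpha>
    unfolding u_def using idx[OF that] basis_list_in[OF us(1)] us(2) basis_list_subspace[OF us(1)]
    by (auto intro: pm.subspace_scale)
  ultimately show ?thesis using linfun_ev by (intro exI[of _ u]) (auto simp: dual_fam_def)
qed

text \<open>The regular basis assumption enters here. A point of \<open>U_reg\<close> lies in the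
  projected closure with nonzero Pluecker coordinate at the exponents of E; this condition passes
  first to a pair over \<open>min_locus\<close>, then to one over a parametrized space, whose
  integrals therefore contain a family dual to these exponents.\<close>

lemma parametrizes_chart:
  fixes E :: "'n::{finite,linorder} expo set"
  assumes E: "finite E" "closed_under_division E" "E \<noteq> {}"
    and p: "parametrizes E t V g L" and U: "U_reg E (Suc t) \<noteq> {}"
  shows "\<exists>c u. g c \<noteq> 0 \<and> pt_space E t g L c \<in> min_locus (Suc t) (Hilb_reg (hfun E) t) \<and>
    dual_fam (\<lambda>\<gamma> p. ev p \<gamma>) u (upto_deg E (Suc t)) (integrals (Suc t) (pt_space E t g L c))"
proof -
  let ?E' = "upto_deg E (Suc t)"
  obtain D0' where D0': "D0' \<in> Hilb_reg (hfun E) (Suc t)" "D0' \<in> Hilb_B E (Suc t)"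
    using U by (auto simp: U_reg_def regular_for_def)
  define Wm where "Wm = {(D, D') \<in> W_pairs (hfun E) (Suc t). D \<in> min_locus (Suc t) (Hilb_reg (hfun E) t :: ('n, complex) mpol set set)}"
  obtain D0 where cl: "(D0, D0') \<in> zariski_Grass_prod (rsum (hfun E) t) (polys_le t) (rsum (hfun E) (Suc t)) (polys_le (Suc t))
      closure_of Wm"
    using D0'(1) unfolding Hilb_reg.simps Wm_def by auto
  obtain es where es: "set es = ?E'" "distinct es"
    using finite_distinct_list[OF finite_upto_deg[OF E(1)]] by blast
  have les: "length es = card ?E'" using es distinct_card by fastforce
  obtain \<Lambda> where d: "dual_basis ?E' D0' \<Lambda>" using Hilb_B_dual_basis[OF D0'(2) E(1)] by blast
  obtain us where us: "basis_list D0' us" "dual_to us es"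
    using dual_basis_pluecker[OF d es] by blast
  obtain Q where Q: "Q \<in> polyfun UNIV ({..<card ?E'} \<times> UNIV)" "\<And>b. length b = card ?E' \<Longrightarrow> Q (entries b) = pluecker b es"
    using pluecker_polyfun[OF les] by blast
  have "Q (entries us) \<noteq> 0"
    using Q(2)[of us] pluecker_dual_one[OF us(2)] us(2) les by (simp add: dual_to_def)
  then obtain D D' bs where W: "(D, D') \<in> Wm" "basis_list D' bs" "Q (entries bs) \<noteq> 0"
    using closure_prod_dense[OF cl polys_le_fin_dim polys_le_fin_dim us(1), of Q] Q(1) rsum_hfun[OF E(1)] by auto
  have W': "(D, D') \<in> W_pairs (hfun E) (Suc t)" "D \<in> min_locus (Suc t) (Hilb_reg (hfun E) t)"
    using W(1) by (auto simp: Wm_def)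
  have one: "(\<lambda>_. 1) \<in> polyfun UNIV V" by (rule polyfun.const) simp
  obtain c D'' bs'' where c: "g c \<noteq> 0" "pt_space E t g L c \<in> min_locus (Suc t) (Hilb_reg (hfun E) t)"
    "D'' \<subseteq> integrals (Suc t) (pt_space E t g L c)" "basis_list D'' bs''" "length bs'' = card ?E'" "Q (entries bs'') \<noteq> 0"
    using parametrizes_lift[OF E p W' W(2) Q(1) W(3) one] by auto
  have "pluecker bs'' es \<noteq> 0" using c(5,6) Q(2) by simp
  then obtain u where "dual_fam (\<lambda>\<gamma> p. ev p \<gamma>) u ?E' D''"
    using pluecker_dual_fam[OF c(4) _ _ es(2)] es(1) les c(5) by auto
  then have "dual_fam (\<lambda>\<gamma> p. ev p \<gamma>) u ?E' (integrals (Suc t) (pt_space E t g L c))"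
    using c(3) by (auto simp: dual_fam_def)
  then show ?thesis using c(1,2) by blast
qed

text \<open>The coefficients with exponents in \<open>A\<close> are coordinates on the space of integrals. Those in
  \<open>A - upto_deg E (Suc t)\<close> become the new parameters.\<close>

lemma parametrizes_coordinates:
  fixes E :: "'n::{finite,linorder} expo set"
  assumes E: "finite E" "closed_under_division E" "E \<noteq> {}"
    and p: "parametrizes E t V g L" and U: "U_reg E (Suc t) \<noteq> {}"
  shows "\<exists>A \<delta> N. upto_deg E (Suc t) \<subseteq> A \<and> A \<subseteq> border (upto_deg E t) \<and> finite A \<and> \<delta> \<in> polyfun \<rat> V \<and>
    (\<forall>a\<in>A. \<forall>\<alpha>. N a \<alpha> \<in> polyfun \<rat> V) \<and> (\<exists>c. g c \<noteq> 0 \<and> \<delta> c \<noteq> 0) \<and>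
    (\<forall>c. g c \<noteq> 0 \<longrightarrow> \<delta> c \<noteq> 0 \<longrightarrow>
      pt_space E t g L c \<in> min_locus (Suc t) (Hilb_reg (hfun E) t) \<and>
      pm.dim (integrals (Suc t) (pt_space E t g L c)) = card A \<and>
      (\<exists>w. dual_fam (\<lambda>\<alpha> p. lookup p \<alpha>) w A (integrals (Suc t) (pt_space E t g L c))) \<and>
      (\<forall>\<Lambda>\<in>integrals (Suc t) (pt_space E t g L c). \<forall>\<alpha>.
        \<delta> c * lookup \<Lambda> \<alpha> = (\<Sum>a\<in>A. N a \<alpha> c * lookup \<Lambda> a)))"
proof -
  let ?F = "upto_deg E t" and ?E' = "upto_deg E (Suc t)"
  let ?S = "pt_space E t g L" and ?X = "Hilb_reg (hfun E) t :: ('n, complex) mpol set set"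
  let ?\<phi> = "\<lambda>\<gamma> p :: ('n, complex) mpol. ev p \<gamma>"
  note P = parametrizesD[OF p]
  obtain c0 u0 where c0: "g c0 \<noteq> 0" "?S c0 \<in> min_locus (Suc t) ?X" "dual_fam ?\<phi> u0 ?E' (integrals (Suc t) (?S c0))"
    using parametrizes_chart[OF E p U] by blast
  have subZ: "pm.subspace (integrals (Suc t) (?S c))" if "g c \<noteq> 0" for c
    using dual_basisD(1)[OF P(7)[OF that]] by (rule integrals_subspace)
  have "\<exists>A u. ?E' \<subseteq> A \<and> A \<subseteq> border ?F \<and> dual_fam ?\<phi> u A (integrals (Suc t) (?S c0)) \<and>
      separates ?\<phi> A (integrals (Suc t) (?S c0))"
    by (rule dual_fam_extend[OF subZ[OF c0(1)] integrals_fin_dim linfun_ev border_separates[OF P(7)[OF c0(1)]]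
        c0(3) upto_deg_Suc_border[OF E(2)]])
  then obtain A u where A: "?E' \<subseteq> A" "A \<subseteq> border ?F" "dual_fam ?\<phi> u A (integrals (Suc t) (?S c0))"
      "separates ?\<phi> A (integrals (Suc t) (?S c0))"
    by blast
  have finA: "finite A" using A(3) by (simp add: dual_fam_def)
  have dim0: "pm.dim (integrals (Suc t) (?S c0)) = card A"
    using dual_fam_dim[OF A(3) subZ[OF c0(1)] A(4)] .
  have finF: "finite ?F" by (rule finite_upto_deg[OF E(1)])
  \<comment> \<open>Scaling by g c clears the denominators: the entries of this spanning family are
    the polynomials L.\<close>
  let ?v = "\<lambda>c \<beta>. pscale (g c) (pt_elem t g L c \<beta>)"
  have lv: "lookup (?v c \<beta>) \<alpha> = L \<beta> \<alpha> c" if "g c \<noteq> 0" "\<beta> \<in> ?F" for c \<beta> \<alpha>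
    using P(8)[OF that] that(1) by (simp add: lookup_pscale)
  have v_le: "?v c \<beta> \<in> polys_le t" if "g c \<noteq> 0" "\<beta> \<in> ?F" for c \<beta>
  proof -
    have "pt_elem t g L c \<beta> \<in> polys_le t"
      using dual_basisD(5)[OF P(7)[OF that(1)] that(2)] dual_basis_polys_le[OF P(7)[OF that(1)]] by blast
    then show ?thesis by (rule pm.subspace_scale[OF polys_le_subspace])
  qed
  have v_span: "pm.span (?v c ` ?F) = ?S c" if "g c \<noteq> 0" for c
  proof
    show "pm.span (?v c ` ?F) \<subseteq> ?S c"
      unfolding pt_space_def by (rule pm.span_minimal) (auto intro: pm.span_scale pm.span_base)
    have "pt_elem t g L c \<beta> \<in> pm.span (?v c ` ?F)" if "\<beta> \<in> ?F" for \<beta>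
    proof -
      have "pscale (1 / g c) (?v c \<beta>) \<in> pm.span (?v c ` ?F)"
        using that by (intro pm.span_scale pm.span_base) auto
      then show ?thesis using \<open>g c \<noteq> 0\<close> by simp
    qed
    then show "?S c \<subseteq> pm.span (?v c ` ?F)"
      unfolding pt_space_def by (intro pm.span_minimal) auto
  qed
  have "\<exists>\<delta>0 N0. \<delta>0 \<in> polyfun \<rat> (?F \<times> UNIV) \<and>
    (\<forall>\<alpha>\<in>A. \<forall>\<beta>. N0 \<alpha> \<beta> \<in> polyfun \<rat> (?F \<times> UNIV)) \<and> \<delta>0 (\<lambda>(i, \<alpha>). lookup (?v c0 i) \<alpha>) \<noteq> 0 \<and>
    (\<forall>v. (\<forall>i\<in>?F. v i \<in> polys_le t) \<longrightarrow> (\<forall>\<Lambda>\<in>integrals (Suc t) (pm.span (v ` ?F)). \<forall>\<beta>.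
      \<delta>0 (\<lambda>(i, \<alpha>). lookup (v i) \<alpha>) * lookup \<Lambda> \<beta> =
      (\<Sum>\<alpha>\<in>A. N0 \<alpha> \<beta> (\<lambda>(i, \<alpha>). lookup (v i) \<alpha>) * lookup \<Lambda> \<alpha>)))"
  proof (rule integrals_solve[OF finF v_le[OF c0(1)]])
    fix f i assume 0: "(\<Sum>i\<in>?F. pscale (f i) (?v c0 i)) = 0" and i: "i \<in> ?F"
    have "ev (\<Sum>i\<in>?F. pscale (f i * g c0) (pt_elem t g L c0 i)) i = f i * g c0"
      using dual_fam_coeff[OF dual_basisD(2)[OF P(7)[OF c0(1)]] i] .
    moreover have "(\<Sum>i\<in>?F. pscale (f i * g c0) (pt_elem t g L c0 i)) = 0" using 0 by simp
    ultimately show "f i = 0" using c0(1) by (simp add: ev_def)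
  next
    show "A \<subseteq> {\<alpha>. mdeg \<alpha> \<le> Suc t}"
      using A(2) by (auto simp: border_def upto_deg_def)
    show "separates (\<lambda>\<alpha> p. lookup p \<alpha>) A (integrals (Suc t) (pm.span (?v c0 ` ?F)))"
      unfolding v_span[OF c0(1)] using A(4) by (simp add: separates_def ev_eq_0)
  qed
  then obtain \<delta>0 N0 where \<delta>0: "\<delta>0 \<in> polyfun \<rat> (?F \<times> UNIV)"
    and N0: "\<forall>\<alpha>\<in>A. \<forall>\<beta>. N0 \<alpha> \<beta> \<in> polyfun \<rat> (?F \<times> UNIV)"
    and \<delta>0': "\<delta>0 (\<lambda>(i, \<alpha>). lookup (?v c0 i) \<alpha>) \<noteq> 0"
    and sol: "\<forall>v. (\<forall>i\<in>?F. v i \<in> polys_le t) \<longrightarrow> (\<forall>\<Lambda>\<in>integrals (Suc t) (pm.span (v ` ?F)). \<forall>\<beta>.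
      \<delta>0 (\<lambda>(i, \<alpha>). lookup (v i) \<alpha>) * lookup \<Lambda> \<beta> =
      (\<Sum>\<alpha>\<in>A. N0 \<alpha> \<beta> (\<lambda>(i, \<alpha>). lookup (v i) \<alpha>) * lookup \<Lambda> \<alpha>))"
    by (elim exE conjE)
  define x where "x c = (\<lambda>(\<beta>, \<alpha>). L \<beta> \<alpha> c)" for c
  define \<delta> where "\<delta> c = \<delta>0 (x c)" for c
  define N where "N a \<alpha> c = N0 a \<alpha> (x c)" for a \<alpha> c
  have x: "(\<lambda>c. x c v) \<in> polyfun \<rat> V" if "v \<in> ?F \<times> UNIV" for v
    using that P(5) by (auto simp: x_def)
  have x_eq: "H (x c) = H (\<lambda>(i, \<alpha>). lookup (?v c i) \<alpha>)" if "g c \<noteq> 0" "H \<in> polyfun \<rat> (?F \<times> UNIV)" for H c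
    by (rule polyfun_cong[OF that(2)]) (auto simp: x_def lv[OF that(1)])
  have sol': "\<delta> c * lookup \<Lambda> \<alpha> = (\<Sum>a\<in>A. N a \<alpha> c * lookup \<Lambda> a)"
    if "g c \<noteq> 0" "\<Lambda> \<in> integrals (Suc t) (?S c)" for c \<Lambda> \<alpha>
  proof -
    have "\<delta>0 (\<lambda>(i, \<alpha>). lookup (?v c i) \<alpha>) * lookup \<Lambda> \<alpha> =
      (\<Sum>a\<in>A. N0 a \<alpha> (\<lambda>(i, \<alpha>). lookup (?v c i) \<alpha>) * lookup \<Lambda> a)"
      by (rule sol[rule_format, of "?v c" \<Lambda> \<alpha>]) (simp_all only: v_le[OF that(1)] that(2) v_span[OF that(1)])
    moreover have "(\<Sum>a\<in>A. N a \<alpha> c * lookup \<Lambda> a) = (\<Sum>a\<in>A. N0 a \<alpha> (\<lambda>(i, \<alpha>). lookup (?v c i) \<alpha>) * lookup \<Lambda> a)"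
      by (rule sum.cong) (use x_eq[OF that(1)] N0 in \<open>auto simp: N_def\<close>)
    ultimately show ?thesis unfolding \<delta>_def x_eq[OF that(1) \<delta>0] by simp
  qed
  have good: "?S c \<in> min_locus (Suc t) ?X \<and> pm.dim (integrals (Suc t) (?S c)) = card A \<and>
      (\<exists>w. dual_fam (\<lambda>\<alpha> p. lookup p \<alpha>) w A (integrals (Suc t) (?S c)))"
    if c: "g c \<noteq> 0" "\<delta> c \<noteq> 0" for c
  proof -
    have "separates (\<lambda>\<alpha> p. lookup p \<alpha>) A (integrals (Suc t) (?S c))"
      unfolding separates_def
    proof (intro ballI impI)
      fix \<Lambda> assume L: "\<Lambda> \<in> integrals (Suc t) (?S c)" "\<forall>i\<in>A. lookup \<Lambda> i = 0"
      then have "\<delta> c * lookup \<Lambda> \<alpha> = 0" for \<alpha> using sol'[OF c(1) L(1), of \<alpha>] by simp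
      then show "\<Lambda> = 0" using c(2) by (intro poly_mapping_eqI) auto
    qed
    note dl = dual_fam_lookup_subset[OF subZ[OF c(1)] integrals_fin_dim finA this]
    have SX: "?S c \<in> ?X" using P(11)[OF c(1)] U_reg_subset by blast
    have min: "pm.dim (integrals (Suc t) (?S c0)) \<le> pm.dim (integrals (Suc t) D)" if "D \<in> ?X" for D
      using c0(2) that by (auto simp: min_locus_def)
    \<comment> \<open>Minimality at c0 bounds the dimension from below by |A|, and separation by A
      bounds it from above. So it is constant where g and \<delta> are nonzero.\<close>
    have dim: "pm.dim (integrals (Suc t) (?S c)) = card A" using dl(1) min[OF SX] dim0 by simp
    moreover have "?S c \<in> min_locus (Suc t) ?X" using SX min dim dim0 by (auto simp: min_locus_def)
    ultimately show ?thesis using dl(2) by blast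
  qed
  have \<delta>V: "\<delta> \<in> polyfun \<rat> V" unfolding \<delta>_def[abs_def] using polyfun_compose[OF \<delta>0 x] .
  have NV: "N a \<alpha> \<in> polyfun \<rat> V" if "a \<in> A" for a \<alpha>
    unfolding N_def[abs_def] by (rule polyfun_compose[OF N0[rule_format, OF that] x])
  have \<delta>c0: "\<delta> c0 \<noteq> 0" unfolding \<delta>_def x_eq[OF c0(1) \<delta>0] using \<delta>0' .
  show ?thesis
  proof (intro exI[of _ A] exI[of _ \<delta>] exI[of _ N] conjI)
    show "\<forall>a\<in>A. \<forall>\<alpha>. N a \<alpha> \<in> polyfun \<rat> V" using NV by simp
    show "\<exists>c. g c \<noteq> 0 \<and> \<delta> c \<noteq> 0" using c0(1) \<delta>c0 by (intro exI[of _ c0]) simp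
    show "\<forall>c. g c \<noteq> 0 \<longrightarrow> \<delta> c \<noteq> 0 \<longrightarrow> ?S c \<in> min_locus (Suc t) ?X \<and>
      pm.dim (integrals (Suc t) (?S c)) = card A \<and>
      (\<exists>w. dual_fam (\<lambda>\<alpha> p. lookup p \<alpha>) w A (integrals (Suc t) (?S c))) \<and>
      (\<forall>\<Lambda>\<in>integrals (Suc t) (?S c). \<forall>\<alpha>. \<delta> c * lookup \<Lambda> \<alpha> = (\<Sum>a\<in>A. N a \<alpha> c * lookup \<Lambda> a))"
    proof (intro allI impI)
      fix c assume c: "g c \<noteq> 0" "\<delta> c \<noteq> 0"
      show "?S c \<in> min_locus (Suc t) ?X \<and> pm.dim (integrals (Suc t) (?S c)) = card A \<and>
        (\<exists>w. dual_fam (\<lambda>\<alpha> p. lookup p \<alpha>) w A (integrals (Suc t) (?S c))) \<and>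
        (\<forall>\<Lambda>\<in>integrals (Suc t) (?S c). \<forall>\<alpha>. \<delta> c * lookup \<Lambda> \<alpha> = (\<Sum>a\<in>A. N a \<alpha> c * lookup \<Lambda> a))"
        using good[OF c] sol'[OF c(1)] by simp
    qed
  qed (fact A finA \<delta>V)+
qed

lemma lookup_pt_elem:
  "lookup (pt_elem t g L c \<beta>) \<alpha> = (if mdeg \<alpha> \<le> t then L \<beta> \<alpha> c / g c else 0)"
  for \<alpha> :: "'n::finite expo"
  by (simp add: pt_elem_def lookup_from_coeffs[OF finite_mdeg_le])

lemma pt_elem_in_space: "\<beta> \<in> upto_deg E t \<Longrightarrow> pt_elem t g L c \<beta> \<in> pt_space E t g L c"
  unfolding pt_space_def by (rule pm.span_base) auto

text \<open>The old dual basis elements are kept, and each one of degree t + 1 is the integral with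
  prescribed values at A. For density, lifting reaches a space over a parametrized one that may lie
  outside the chart of E; inside the fixed space of integrals it is moved into the chart, where its
  parameters can be read off.\<close>

lemma parametrizes_step:
  fixes E :: "'n::{finite,linorder} expo set"
  assumes E: "finite E" "closed_under_division E" "E \<noteq> {}" and t: "Suc t \<le> top_deg E"
    and p: "parametrizes E t V g L" and U: "U_reg E (Suc t) \<noteq> {}"
  shows "\<exists>V' g' L'. parametrizes E (Suc t) V' g' L'"
proof -
  let ?F = "upto_deg E t" and ?E' = "upto_deg E (Suc t)"
  let ?S = "pt_space E t g L" and ?X = "Hilb_reg (hfun E) t :: ('n, complex) mpol set set"
  let ?Z = "\<lambda>c. integrals (Suc t) (?S c)"
  note P = parametrizesD[OF p]
  have "\<exists>A \<delta> N. ?E' \<subseteq> A \<and> A \<subseteq> border ?F \<and> finite A \<and> \<delta> \<in> polyfun \<rat> V \<and>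
    (\<forall>a\<in>A. \<forall>\<alpha>. N a \<alpha> \<in> polyfun \<rat> V) \<and> (\<exists>c. g c \<noteq> 0 \<and> \<delta> c \<noteq> 0) \<and>
    (\<forall>c. g c \<noteq> 0 \<longrightarrow> \<delta> c \<noteq> 0 \<longrightarrow> ?S c \<in> min_locus (Suc t) ?X \<and> pm.dim (?Z c) = card A \<and>
      (\<exists>w. dual_fam (\<lambda>\<alpha> p. lookup p \<alpha>) w A (?Z c)) \<and>
      (\<forall>\<Lambda>\<in>?Z c. \<forall>\<alpha>. \<delta> c * lookup \<Lambda> \<alpha> = (\<Sum>a\<in>A. N a \<alpha> c * lookup \<Lambda> a)))"
    by (rule parametrizes_coordinates[OF E p U])
  then obtain A \<delta> N ci where A: "?E' \<subseteq> A" "A \<subseteq> border ?F" "finite A" and \<delta>V: "\<delta> \<in> polyfun \<rat> V"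
    and NV: "\<forall>a\<in>A. \<forall>\<alpha>. N a \<alpha> \<in> polyfun \<rat> V" and ci: "g ci \<noteq> 0" "\<delta> ci \<noteq> 0"
    and pts: "\<forall>c. g c \<noteq> 0 \<longrightarrow> \<delta> c \<noteq> 0 \<longrightarrow> ?S c \<in> min_locus (Suc t) ?X \<and> pm.dim (?Z c) = card A \<and>
      (\<exists>w. dual_fam (\<lambda>\<alpha> p. lookup p \<alpha>) w A (?Z c)) \<and>
      (\<forall>\<Lambda>\<in>?Z c. \<forall>\<alpha>. \<delta> c * lookup \<Lambda> \<alpha> = (\<Sum>a\<in>A. N a \<alpha> c * lookup \<Lambda> a))"
    by (elim exE conjE)
  have minS: "?S c \<in> min_locus (Suc t) ?X" if "g c \<noteq> 0" "\<delta> c \<noteq> 0" for c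
    using pts[rule_format, OF that] by (elim conjE)
  have dimZ: "pm.dim (?Z c) = card A" if "g c \<noteq> 0" "\<delta> c \<noteq> 0" for c
    using pts[rule_format, OF that] by (elim conjE)
  have wex: "\<exists>w. dual_fam (\<lambda>\<alpha> p. lookup p \<alpha>) w A (?Z c)" if "g c \<noteq> 0" "\<delta> c \<noteq> 0" for c
    using pts[rule_format, OF that] by (elim conjE)
  have sol: "\<delta> c * lookup \<Lambda> \<alpha> = (\<Sum>a\<in>A. N a \<alpha> c * lookup \<Lambda> a)"
    if "g c \<noteq> 0" "\<delta> c \<noteq> 0" "\<Lambda> \<in> ?Z c" for c \<Lambda> \<alpha>
    using pts[rule_format, OF that(1,2)] that(3) by blast
  have sepA: "x = y" if "g c \<noteq> 0" "\<delta> c \<noteq> 0" "x \<in> ?Z c" "y \<in> ?Z c" "\<And>a. a \<in> A \<Longrightarrow> lookup x a = lookup y a" for c x y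
  proof (rule poly_mapping_eqI)
    fix \<alpha>
    have "\<delta> c * lookup x \<alpha> = \<delta> c * lookup y \<alpha>"
      unfolding sol[OF that(1-3)] sol[OF that(1,2,4)] using that(5) by simp
    then show "lookup x \<alpha> = lookup y \<alpha>" using that(2) by simp
  qed
  have finF: "finite ?F" "finite ?E'" using finite_upto_deg[OF E(1)] by auto
  have FE: "?F \<subseteq> ?E'" by (rule upto_deg_Suc_subset)
  have new: "mdeg \<beta> = Suc t" if "\<beta> \<in> ?E' - ?F" for \<beta> using that by (auto simp: upto_deg_def)
  have "?F \<noteq> {}" using less_card_upto_deg[OF E, of t] t by auto
  then have F0: "0 \<in> ?F" using zero_in_upto_deg[OF E(2)] by blast

  \<comment> \<open>Prescribed coefficients at A: duality fixes them on \<open>?E'\<close>, the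
    others are the free parameters. Division by the factorial makes the parameter the coordinate
    \<mu> itself.\<close>
  define y where "y \<beta> a c = (if a \<in> ?E' then (if a = \<beta> then 1 / of_nat (mfact a) else 0)
      else c (\<beta>, a) / of_nat (mfact a))" for \<beta> a and c :: "'n expo \<times> 'n expo \<Rightarrow> complex"
  define V' where "V' = V \<union> (?E' - ?F) \<times> (A - ?E')"
  define g' where "g' c = g c * \<delta> c" for c
  \<comment> \<open>Both cases are brought over the common denominator g \<delta>: old elements have
    denominator g, while Cramer's rule gives new ones the denominator \<delta>.\<close>
  define L' where "L' \<beta> \<alpha> c = (if \<beta> \<in> ?F then L \<beta> \<alpha> c * \<delta> c else g c * (\<Sum>a\<in>A. N a \<alpha> c * y \<beta> a c))" for \<beta> \<alpha> c
  let ?S' = "pt_space E (Suc t) g' L'" and ?l = "pt_elem (Suc t) g' L'"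
  have VV': "V \<subseteq> V'" by (simp add: V'_def)
  have g'_iff: "g' c \<noteq> 0 \<longleftrightarrow> g c \<noteq> 0 \<and> \<delta> c \<noteq> 0" for c by (simp add: g'_def)

  have subZ: "pm.subspace (?Z c)" if "g c \<noteq> 0" for c
    using dual_basisD(1)[OF P(7)[OF that]] by (rule integrals_subspace)
  have SZ: "?S c \<subseteq> ?Z c" if "g c \<noteq> 0" for c
    using integrals_contains[OF dual_basis_polys_le[OF P(7)[OF that]] P(10)[OF that]] .
  have old: "?l c \<beta> = pt_elem t g L c \<beta>" if c: "g' c \<noteq> 0" and \<beta>: "\<beta> \<in> ?F" for c \<beta>
  proof (rule poly_mapping_eqI)
    fix \<alpha>
    have gc: "g c \<noteq> 0" "\<delta> c \<noteq> 0" using c by (auto simp: g'_iff)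
    show "lookup (?l c \<beta>) \<alpha> = lookup (pt_elem t g L c \<beta>) \<alpha>"
      using P(8)[OF gc(1) \<beta>, of \<alpha>] gc \<beta>
      by (auto simp: lookup_pt_elem L'_def g'_def split: if_splits)
  qed
  have newZ: "?l c \<beta> \<in> ?Z c \<and> (\<forall>a\<in>A. lookup (?l c \<beta>) a = y \<beta> a c) \<and>
      (\<forall>\<alpha>. lookup (?l c \<beta>) \<alpha> = L' \<beta> \<alpha> c / g' c)" if c: "g' c \<noteq> 0" and \<beta>: "\<beta> \<in> ?E' - ?F" for c \<beta>
  proof -
    have gc: "g c \<noteq> 0" "\<delta> c \<noteq> 0" using c by (auto simp: g'_iff)
    obtain w where w: "dual_fam (\<lambda>\<alpha> p. lookup p \<alpha>) w A (?Z c)" using wex[OF gc] by blast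
    define x where "x = (\<Sum>a\<in>A. pscale (y \<beta> a c) (w a))"
    have xZ: "x \<in> ?Z c"
      unfolding x_def using w by (intro pm.subspace_sum pm.subspace_scale subZ gc) (auto simp: dual_fam_def)
    have xA: "lookup x a = y \<beta> a c" if "a \<in> A" for a
      unfolding x_def using dual_fam_coeff[OF w that, of "\<lambda>a. y \<beta> a c"] .
    have "\<delta> c * lookup x \<alpha> = (\<Sum>a\<in>A. N a \<alpha> c * y \<beta> a c)" for \<alpha>
      unfolding sol[OF gc xZ] using xA by simp
    then have xL: "lookup x \<alpha> = L' \<beta> \<alpha> c / g' c" for \<alpha>
      using gc \<beta> by (simp add: L'_def g'_def field_simps)
    have "?l c \<beta> = x"
    proof (rule poly_mapping_eqI)
      fix \<alpha> show "lookup (?l c \<beta>) \<alpha> = lookup x \<alpha>"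
        using xZ xL[of \<alpha>] by (auto simp: lookup_pt_elem integrals_def polys_le_iff)
    qed
    then show ?thesis using xZ xA xL by simp
  qed
  have lL: "lookup (?l c \<beta>) \<alpha> = L' \<beta> \<alpha> c / g' c" if c: "g' c \<noteq> 0" and \<beta>: "\<beta> \<in> ?E'" for c \<beta> \<alpha>
  proof (cases "\<beta> \<in> ?F")
    case True
    then show ?thesis using old[OF c True] P(8)[of c \<beta> \<alpha>] c by (auto simp: L'_def g'_def)
  next
    case False
    then show ?thesis using newZ[OF c] \<beta> by blast
  qed
  have lZ: "?l c \<beta> \<in> ?Z c" if c: "g' c \<noteq> 0" and \<beta>: "\<beta> \<in> ?E'" for c \<beta>
  proof (cases "\<beta> \<in> ?F")
    case True
    then show ?thesis using old[OF c True] pt_elem_in_space[OF True, of g L c] SZ[of c] c by (auto simp: g'_iff)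
  next
    case False
    then show ?thesis using newZ[OF c] \<beta> by blast
  qed
  have ev': "ev (?l c \<beta>) \<gamma> = (if \<beta> = \<gamma> then 1 else 0)" if c: "g' c \<noteq> 0" and b: "\<beta> \<in> ?E'" "\<gamma> \<in> ?E'" for c \<beta> \<gamma>
  proof (cases "\<beta> \<in> ?F")
    case True
    have d: "dual_basis ?F (?S c) (pt_elem t g L c)" using P(7) c by (simp add: g'_iff)
    show ?thesis
    proof (cases "\<gamma> \<in> ?F")
      case True
      then show ?thesis using dual_basisD(7)[OF d \<open>\<beta> \<in> ?F\<close> True] old[OF c \<open>\<beta> \<in> ?F\<close>] by simp
    next
      case False
      then have "mdeg \<gamma> = Suc t" using new b by blast
      then show ?thesis using old[OF c True] True False by (auto simp: ev_def lookup_pt_elem)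
    qed
  next
    case False
    then have "lookup (?l c \<beta>) \<gamma> = y \<beta> \<gamma> c" using newZ[OF c, of \<beta>] b A(1) by blast
    then show ?thesis using b by (auto simp: ev_def y_def)
  qed
  have db: "dual_basis ?E' (?S' c) (?l c)" if c: "g' c \<noteq> 0" for c
  proof -
    have df: "dual_fam (\<lambda>\<gamma> p. ev p \<gamma>) (?l c) ?E' (pm.span (?l c ` ?E'))"
      using finF(2) linfun_ev ev'[OF c] by (auto simp: dual_fam_def intro: pm.span_base)
    have "?l c \<beta> \<in> polys_le (mdeg \<beta>)" if "\<beta> \<in> ?E'" for \<beta>
    proof (cases "\<beta> \<in> ?F")
      case True
      then show ?thesis using old[OF c True] dual_basisD(6)[OF P(7)] c by (auto simp: g'_iff)
    next
      case False
      then show ?thesis using new[of \<beta>] that by (simp add: polys_le_iff lookup_pt_elem)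
    qed
    then show ?thesis
      unfolding dual_basis_def pt_space_def using df dual_fam_span_separates[OF df] by simp
  qed
  have S'Z: "?S' c \<subseteq> ?Z c" if c: "g' c \<noteq> 0" for c
    unfolding pt_space_def[of E "Suc t"] using lZ[OF c] c
    by (intro pm.span_minimal subZ) (auto simp: g'_iff)
  have SS': "?S c \<subseteq> ?S' c" if c: "g' c \<noteq> 0" for c
  proof -
    have "pt_elem t g L c \<beta> \<in> ?S' c" if "\<beta> \<in> ?F" for \<beta>
      using old[OF c that] pt_elem_in_space[of \<beta> E "Suc t" g' L' c] FE that by auto
    then show ?thesis
      unfolding pt_space_def[of E t] using dual_basisD(1)[OF db[OF c]] by (intro pm.span_minimal) auto
  qed
  have pd: "pdiff k ` ?S' c \<subseteq> ?S c" if c: "g' c \<noteq> 0" for c k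
    using S'Z[OF c] by (auto simp: integrals_def)
  have S'le: "?S' c \<subseteq> polys_le (Suc t)" if c: "g' c \<noteq> 0" for c
    using dual_basis_polys_le[OF db[OF c]] .
  have X': "?S' c \<in> Hilb_reg (hfun E) (Suc t)" if c: "g' c \<noteq> 0" for c
  proof -
    have gc: "g c \<noteq> 0" "\<delta> c \<noteq> 0" using c by (auto simp: g'_iff)
    have "?S c \<in> ?X" using P(11)[OF gc(1)] U_reg_subset by blast
    then have G1: "?S c \<in> Grass (rsum (hfun E) t) (polys_le t)"
      using Hilb_reg_subset[OF E, of t] rsum_hfun[OF E(1)] by auto
    have G2: "?S' c \<in> Grass (rsum (hfun E) (Suc t)) (polys_le (Suc t))"
      using dual_basisD(1)[OF db[OF c]] S'le[OF c] dual_basis_dim[OF db[OF c]] rsum_hfun[OF E(1)]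
      by (simp add: Grass_def)
    have "(?S c, ?S' c) \<in> W_pairs (hfun E) (Suc t)"
      using G1 G2 SS'[OF c] pd[OF c] by (simp add: W_pairs_def)
    then have "(?S c, ?S' c) \<in> {(D, D') \<in> W_pairs (hfun E) (Suc t). D \<in> min_locus (Suc t) ?X}"
      using minS[OF gc] by simp
    moreover have "(?S c, ?S' c) \<in> topspace (zariski_Grass_prod (rsum (hfun E) t) (polys_le t) (rsum (hfun E) (Suc t)) (polys_le (Suc t)))"
      using G1 G2 by (simp add: topspace_zariski_Grass_prod_eq polys_le_fin_dim)
    ultimately have "(?S c, ?S' c) \<in> zariski_Grass_prod (rsum (hfun E) t) (polys_le t) (rsum (hfun E) (Suc t)) (polys_le (Suc t))
        closure_of {(D, D') \<in> W_pairs (hfun E) (Suc t). D \<in> min_locus (Suc t) ?X}"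
      unfolding in_closure_of by blast
    then show ?thesis unfolding Hilb_reg.simps by (metis (no_types, lifting) image_eqI snd_conv)
  qed
  \<comment> \<open>\<open>regular_for\<close> recovers the lower space by a degree bound. New basis
    elements cannot contribute to it, since their coefficients are values at exponents of degree t +
    1.\<close>
  have Sint: "?S' c \<inter> polys_le t = ?S c" if c: "g' c \<noteq> 0" for c
  proof
    have gc: "g c \<noteq> 0" using c by (simp add: g'_iff)
    show "?S c \<subseteq> ?S' c \<inter> polys_le t" using SS'[OF c] dual_basis_polys_le[OF P(7)[OF gc]] by blast
    show "?S' c \<inter> polys_le t \<subseteq> ?S c"
    proof
      fix x assume x: "x \<in> ?S' c \<inter> polys_le t"
      have "(\<Sum>\<beta>\<in>?E'. pscale (ev x \<beta>) (?l c \<beta>)) \<in> ?S c"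
      proof (rule pm.subspace_sum[OF dual_basisD(1)[OF P(7)[OF gc]]])
        fix \<beta> assume \<beta>: "\<beta> \<in> ?E'"
        show "pscale (ev x \<beta>) (?l c \<beta>) \<in> ?S c"
        proof (cases "\<beta> \<in> ?F")
          case True
          then show ?thesis using old[OF c True] pt_elem_in_space[OF True, of g L c]
            by (auto intro: pm.subspace_scale[OF dual_basisD(1)[OF P(7)[OF gc]]])
        next
          case False
          then have "ev x \<beta> = 0" using x new \<beta> by (auto simp: polys_le_iff ev_eq_0)
          then show ?thesis by (simp add: pm.subspace_0[OF dual_basisD(1)[OF P(7)[OF gc]]])
        qed
      qed
      then show "x \<in> ?S c" using dual_basis_expand[OF db[OF c], of x] x by simp
    qed
  qed
  have SHB: "?S c \<in> Hilb_B E t" if "g c \<noteq> 0" for c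
    by (rule dual_basis_Hilb_B[OF P(7)[OF that] P(10)[OF that] less_card_upto_deg[OF E]]) (use t in simp)
  have rk: "H_rank E (Suc t) (?S c) = rho_gen E (Suc t)" if c: "g' c \<noteq> 0" for c
    using H_rank_min_locus[OF E(1,2) \<open>?F \<noteq> {}\<close> SHB minS] c by (simp add: g'_iff)
  have st: "pdiff k ` ?S' c \<subseteq> ?S' c" if c: "g' c \<noteq> 0" for c k
    using pd[OF c, of k] SS'[OF c] by blast
  have U': "?S' c \<in> U_reg E (Suc t)" if c: "g' c \<noteq> 0" for c
  proof -
    have "?S' c \<in> Hilb_B E (Suc t)"
      by (rule dual_basis_Hilb_B[OF db[OF c] st[OF c] less_card_upto_deg[OF E t]])
    then show ?thesis
      using X'[OF c] rk[OF c] Sint[OF c] dual_basis_dim[OF db[OF c]]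
      by (simp add: U_reg_def regular_for_def)
  qed
  have c0: "g' ci \<noteq> 0" using ci by (simp add: g'_iff)

  have cardV': "card V' = (\<Sum>s\<le>Suc t. gamma_part E s)"
  proof -
    have "gamma_part E (Suc t) = Grass_dim (hfun E (Suc t)) (H_kernel E (Suc t) (?S ci))"
      by (rule gamma_part_eq[OF E(1) P(11)[OF ci(1)] rk[OF c0]])
    \<comment> \<open>The kernel has dimension |A| - r_t; subtracting h_(t+1) for the Grassmannian
      leaves |A| - r_(t+1).\<close>
    also have "\<dots> = hfun E (Suc t) * (card A - card ?E')"
      using H_kernel_dim[OF E(1,2) SHB[OF ci(1)] \<open>?F \<noteq> {}\<close>] dimZ[OF ci] card_upto_deg_Suc[OF E(1), of t]
      by (simp add: Grass_dim_def)
    also have "hfun E (Suc t) = card (?E' - ?F)"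
      using card_upto_deg_Suc[OF E(1), of t] card_Diff_subset[OF finF(1) FE] by simp
    also have "card A - card ?E' = card (A - ?E')" using card_Diff_subset[OF finF(2) A(1)] by simp
    finally have "gamma_part E (Suc t) = card ((?E' - ?F) \<times> (A - ?E'))" by (simp add: card_cartesian_product)
    \<comment> \<open>Old parameters belong to dual basis elements of degree at most t.\<close>
    moreover have "V \<inter> (?E' - ?F) \<times> (A - ?E') = {}" using P(2) by (auto simp: mu_index_def)
    ultimately show ?thesis
      unfolding V'_def using P(1,3) finF(2) A(3) by (simp add: card_Un_disjoint)
  qed
  have V'mu: "V' \<subseteq> mu_index ?E'"
  proof -
    have "V \<subseteq> mu_index ?E'" using P(2) FE unfolding mu_index_def by blast
    moreover have "(\<beta>, a) \<in> mu_index ?E'" if \<beta>: "\<beta> \<in> ?E' - ?F" and a: "a \<in> A - ?E'" for \<beta> a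
    proof -
      \<comment> \<open>Since 0 belongs to E, a free exponent is a genuine product \<sigma> + e_k,
        and |\<sigma>| \<le> t lies below the degree of \<beta>.\<close>
      have "a \<in> border ?F" "a \<noteq> 0" using a A(2) F0 FE by auto
      then obtain \<sigma> k where "\<sigma> \<in> ?F" "a = \<sigma> + unit_expo k" by (auto simp: border_def)
      moreover from this have "\<sigma> \<in> ?E'" "mdeg \<sigma> < mdeg \<beta>" using FE new[OF \<beta>] by (auto simp: upto_deg_def)
      ultimately show ?thesis using \<beta> unfolding mu_index_def by blast
    qed
    ultimately show ?thesis unfolding V'_def by blast
  qed
  have g'V: "g' \<in> polyfun \<rat> V'"
    unfolding g'_def[abs_def] using polyfun_mono[OF P(4) subset_refl VV'] polyfun_mono[OF \<delta>V subset_refl VV']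
    by (rule polyfun.mult)
  have L'V: "L' \<beta> \<alpha> \<in> polyfun \<rat> V'" if \<beta>: "\<beta> \<in> ?E'" for \<beta> \<alpha>
  proof (cases "\<beta> \<in> ?F")
    case True
    then have "L' \<beta> \<alpha> = (\<lambda>c. L \<beta> \<alpha> c * \<delta> c)" by (auto simp: L'_def)
    then show ?thesis
      using polyfun.mult[OF polyfun_mono[OF P(5)[OF True] subset_refl VV'] polyfun_mono[OF \<delta>V subset_refl VV']] by simp
  next
    case False
    have yV: "y \<beta> a \<in> polyfun \<rat> V'" if "a \<in> A" for a
    proof (cases "a \<in> ?E'")
      case True
      then have "y \<beta> a = (\<lambda>_. if a = \<beta> then 1 / of_nat (mfact a) else 0)" by (auto simp: y_def)
      then show ?thesis by (auto intro!: polyfun.const)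
    next
      case False
      then have "y \<beta> a = (\<lambda>c. (1 / of_nat (mfact a)) * c (\<beta>, a))" by (auto simp: y_def)
      moreover have "(\<beta>, a) \<in> V'" using \<beta> \<open>\<beta> \<notin> ?F\<close> that False by (simp add: V'_def)
      then have "(\<lambda>c. (1 / of_nat (mfact a)) * c (\<beta>, a)) \<in> polyfun \<rat> V'"
        by (intro polyfun_cmult polyfun.var) auto
      ultimately show ?thesis by simp
    qed
    have "L' \<beta> \<alpha> = (\<lambda>c. g c * (\<Sum>a\<in>A. N a \<alpha> c * y \<beta> a c))" using False by (auto simp: L'_def)
    moreover have "(\<lambda>c. g c * (\<Sum>a\<in>A. N a \<alpha> c * y \<beta> a c)) \<in> polyfun \<rat> V'"
      using polyfun_mono[OF P(4) subset_refl VV'] polyfun_mono[OF _ subset_refl VV'] NV yV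
      by (intro polyfun.mult polyfun_sum) auto
    ultimately show ?thesis by simp
  qed
  have coord: "of_nat (mfact \<alpha>) * L' \<beta> \<alpha> c = c (\<beta>, \<alpha>) * g' c" if c: "g' c \<noteq> 0" and v: "(\<beta>, \<alpha>) \<in> V'" for c \<beta> \<alpha>
  proof (cases "(\<beta>, \<alpha>) \<in> V")
    case True
    then have "\<beta> \<in> ?F" using P(2) by (auto simp: mu_index_def)
    then show ?thesis using P(9)[OF _ True, of c] c by (simp add: L'_def g'_def)
  next
    case False
    then have b: "\<beta> \<in> ?E' - ?F" "\<alpha> \<in> A - ?E'" using v by (auto simp: V'_def)
    have "lookup (?l c \<beta>) \<alpha> = L' \<beta> \<alpha> c / g' c" "lookup (?l c \<beta>) \<alpha> = y \<beta> \<alpha> c"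
      using newZ[OF c b(1)] b(2) by auto
    then show ?thesis using c b(2) by (simp add: y_def field_simps)
  qed

  have dense: "\<exists>c bs'. g' c \<noteq> 0 \<and> basis_list (?S' c) bs' \<and> F (entries bs') \<noteq> 0"
    if D0': "D0' \<in> Hilb_reg (hfun E) (Suc t)" "basis_list D0' bs0"
      and F: "F \<in> polyfun UNIV ({..<card ?E'} \<times> UNIV)" "F (entries bs0) \<noteq> 0" for D0' bs0 F
  proof -
    let ?n = "card ?E'"
    define Wm where "Wm = {(D, D') \<in> W_pairs (hfun E) (Suc t). D \<in> min_locus (Suc t) ?X}"
    obtain D0 where cl: "(D0, D0') \<in> zariski_Grass_prod (rsum (hfun E) t) (polys_le t) (rsum (hfun E) (Suc t)) (polys_le (Suc t))
        closure_of Wm"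
      using D0'(1) unfolding Hilb_reg.simps Wm_def by auto
    obtain D D' bs where W: "(D, D') \<in> Wm" "basis_list D' bs" "F (entries bs) \<noteq> 0"
      using closure_prod_dense[OF cl polys_le_fin_dim polys_le_fin_dim D0'(2), of F] F rsum_hfun[OF E(1)] by auto
    have W': "(D, D') \<in> W_pairs (hfun E) (Suc t)" "D \<in> min_locus (Suc t) ?X"
      using W(1) by (auto simp: Wm_def)
    have \<delta>U: "\<delta> \<in> polyfun UNIV V" using \<delta>V by (rule polyfun_mono) auto
    have "\<exists>c D'' bs''. g c \<noteq> 0 \<and> \<delta> c \<noteq> 0 \<and> ?S c \<in> min_locus (Suc t) ?X \<and> ?S c \<subseteq> D'' \<and> D'' \<subseteq> ?Z c \<and>
        basis_list D'' bs'' \<and> length bs'' = ?n \<and> F (entries bs'') \<noteq> 0"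
      by (rule parametrizes_lift[OF E p W' W(2) F(1) W(3) \<delta>U ci(2)])
    then obtain c D'' bs'' where gc: "g c \<noteq> 0" "\<delta> c \<noteq> 0" and D'': "?S c \<subseteq> D''" "D'' \<subseteq> ?Z c"
      and bs'': "basis_list D'' bs''" "length bs'' = ?n" "F (entries bs'') \<noteq> 0"
      by (elim exE conjE)
    have c: "g' c \<noteq> 0" using gc by (simp add: g'_iff)
    obtain es where es: "set es = ?F" "distinct es" using finite_distinct_list[OF finF(1)] by blast
    obtain ns where ns: "set ns = ?E' - ?F" "distinct ns" using finite_distinct_list[of "?E' - ?F"] finF by auto
    have es': "set (es @ ns) = ?E'" "distinct (es @ ns)" using es ns FE by auto
    have len: "length (es @ ns) = ?n" using distinct_card[OF es'(2)] es'(1) by simp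
    let ?m = "\<lambda>\<beta>. pscale (of_nat (mfact \<beta>)) (?l c \<beta>)"
    define b where "b = map ?m es"
    define ls1 where "ls1 = map ?m ns"
    have b1: "basis_list (?S' c) (b @ ls1)" "dual_to (b @ ls1) (es @ ns)"
      using dual_basis_pluecker[OF db[OF c] es'] by (simp_all add: b_def ls1_def)
    have bS: "basis_list (?S c) b"
    proof -
      have "b = map (\<lambda>\<beta>. pscale (of_nat (mfact \<beta>)) (pt_elem t g L c \<beta>)) es"
        unfolding b_def using old[OF c] es(1) by simp
      then show ?thesis using dual_basis_pluecker(1)[OF P(7)[OF gc(1)] es] by simp
    qed
    obtain ls0 where b0: "basis_list D'' (b @ ls0)"
      using basis_list_extend[OF bS D''(1) basis_list_subspace[OF bs''(1)] basis_list_fin_dim[OF bs''(1)]] by blast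
    have l0: "length (b @ ls0) = ?n" using basis_list_dim[OF b0] basis_list_dim[OF bs''(1)] bs''(2) by simp
    have l1: "length (b @ ls1) = ?n" using len by (simp add: b_def ls1_def)
    have l01: "length ls0 = length ls1" using l0 l1 by simp
    obtain M Ni where M: "bs'' = list_comb M (b @ ls0)" "left_inv ?n Ni M"
      using basis_list_change[OF b0 bs''(1)] unfolding l0 by blast
    define F2 where "F2 x = F (\<lambda>(i, a). \<Sum>j<?n. M i j * x (j, a))" for x
    have F2: "F2 \<in> polyfun UNIV ({..<?n} \<times> UNIV)"
      unfolding F2_def[abs_def] by (rule polyfun_change_basis[OF F(1)])
    have F2': "F2 (entries b) = F (entries (list_comb M b))" if "length b = ?n" for b
      unfolding F2_def using polyfun_entries_list_comb[of F b M] F(1) that by simp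
    obtain Q where Q: "Q \<in> polyfun UNIV ({..<?n} \<times> UNIV)"
        "\<And>b. length b = ?n \<Longrightarrow> Q (entries b) = pluecker b (es @ ns)"
      using pluecker_polyfun[OF len] by blast
    have "F2 (entries (b @ ls0)) \<noteq> 0" using F2'[OF l0] M(1) bs''(3) by simp
    moreover have "Q (entries (b @ ls1)) \<noteq> 0" using Q(2)[OF l1] pluecker_dual_one[OF b1(2)] by simp
    \<comment> \<open>The line joins the lifted space, where F does not vanish, to the parametrized
      one, which lies in the chart. Both bases begin with the same b, so every list on the line
      contains a basis of \<open>?S c\<close>, and its vectors stay in the space of
      integrals.\<close>
    ultimately have "\<exists>s. F2 (\<lambda>v. entries (b @ ls0) v + s * (entries (b @ ls1) v - entries (b @ ls0) v)) \<noteq> 0 \<and>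
        Q (\<lambda>v. entries (b @ ls0) v + s * (entries (b @ ls1) v - entries (b @ ls0) v)) \<noteq> 0"
      by (rule polyfun_nonzero_line[where F = F2 and G = Q, OF F2 Q(1)])
    then obtain s where s: "F2 (\<lambda>v. entries (b @ ls0) v + s * (entries (b @ ls1) v - entries (b @ ls0) v)) \<noteq> 0"
        "Q (\<lambda>v. entries (b @ ls0) v + s * (entries (b @ ls1) v - entries (b @ ls0) v)) \<noteq> 0"
      by (elim exE conjE)
    define ls where "ls = map (\<lambda>i. ls0 ! i + pscale s (ls1 ! i - ls0 ! i)) [0..<length ls0]"
    have lls: "length (b @ ls) = ?n" using l0 by (simp add: ls_def)
    have line: "entries (b @ ls) (i, a) = entries (b @ ls0) (i, a) + s * (entries (b @ ls1) (i, a) - entries (b @ ls0) (i, a))"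
      if "i < ?n" for i a
      using that l0 by (auto simp: entries_def nth_append ls_def lookup_add lookup_minus lookup_pscale)
    have "F2 (entries (b @ ls)) \<noteq> 0"
      using s(1) polyfun_cong[OF F2, of "entries (b @ ls)" "\<lambda>v. entries (b @ ls0) v + s * (entries (b @ ls1) v - entries (b @ ls0) v)"] line
      by fastforce
    then have Fls: "F (entries (list_comb M (b @ ls))) \<noteq> 0" using F2'[OF lls] by simp
    have "Q (entries (b @ ls)) \<noteq> 0"
      using s(2) polyfun_cong[OF Q(1), of "entries (b @ ls)" "\<lambda>v. entries (b @ ls0) v + s * (entries (b @ ls1) v - entries (b @ ls0) v)"] line
      by fastforce
    then have pl: "pluecker (b @ ls) (es @ ns) \<noteq> 0" using Q(2)[OF lls] by simp
    define D3 where "D3 = pm.span (set (b @ ls))"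
    have b3: "basis_list D3 (b @ ls)"
      unfolding D3_def by (rule pluecker_nonzero_basis[OF pl]) (use lls len in simp)
    have sub3: "pm.subspace D3" using basis_list_subspace[OF b3] .
    have SD3: "?S c \<subseteq> D3"
    proof -
      have "?S c = pm.span (set b)" using bS by (simp add: basis_list_def)
      also have "\<dots> \<subseteq> D3" unfolding D3_def by (rule pm.span_mono) auto
      finally show ?thesis .
    qed
    have D3Z: "D3 \<subseteq> ?Z c"
    proof -
      have z0: "x \<in> ?Z c" if "x \<in> set (b @ ls0)" for x
        using that b0 D''(2) pm.span_base[of x "set (b @ ls0)"] by (auto simp: basis_list_def)
      have z1: "x \<in> ?Z c" if "x \<in> set (b @ ls1)" for x
        using that b1(1) S'Z[OF c] pm.span_base[of x "set (b @ ls1)"] by (auto simp: basis_list_def)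
      have "x \<in> ?Z c" if x: "x \<in> set ls" for x
      proof -
        obtain i where i: "i < length ls0" "x = ls0 ! i + pscale s (ls1 ! i - ls0 ! i)"
          using x by (auto simp: ls_def)
        have "ls0 ! i \<in> ?Z c" "ls1 ! i \<in> ?Z c" using z0[of "ls0 ! i"] z1[of "ls1 ! i"] i(1) l01 by auto
        then show ?thesis
          unfolding i(2) by (intro pm.subspace_add pm.subspace_scale pm.subspace_diff subZ gc)
      qed
      then show ?thesis unfolding D3_def using z0 by (intro pm.span_minimal subZ gc) auto
    qed
    obtain u where "dual_fam (\<lambda>\<gamma> p. ev p \<gamma>) u (set (es @ ns)) D3"
      using pluecker_dual_fam[OF b3 pl _ es'(2)] lls len by auto
    then have u: "dual_fam (\<lambda>\<gamma> p. ev p \<gamma>) u ?E' D3" unfolding es'(1) .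
    \<comment> \<open>The parameters of \<open>D3\<close>: old ones are kept, so the lower space and
      the integrals do not change, and the new ones are the values of its dual basis.\<close>
    define c' where "c' v = (if v \<in> V then c v else of_nat (mfact (snd v)) * lookup (u (fst v)) (snd v))" for v
    have Veq: "H c' = H c" if "H \<in> polyfun \<rat> V" for H
      by (rule polyfun_cong[OF that]) (simp add: c'_def)
    have gc': "g c' = g c" "\<delta> c' = \<delta> c" using Veq P(4) \<delta>V by auto
    have c'0: "g' c' \<noteq> 0" using c gc' by (simp add: g'_def)
    have el': "pt_elem t g L c' \<beta> = pt_elem t g L c \<beta>" if "\<beta> \<in> ?F" for \<beta>
      by (rule poly_mapping_eqI) (simp add: lookup_pt_elem gc' Veq[OF P(5)[OF that]])
    then have S_eq: "?S c' = ?S c" by (simp add: pt_space_def)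
    have mem: "?l c' \<beta> \<in> D3" if \<beta>: "\<beta> \<in> ?E'" for \<beta>
    proof (cases "\<beta> \<in> ?F")
      case True
      then show ?thesis using old[OF c'0 True] el'[OF True] pt_elem_in_space[OF True, of g L c] SD3 by auto
    next
      case False
      have nz: "?l c' \<beta> \<in> ?Z c" "\<forall>a\<in>A. lookup (?l c' \<beta>) a = y \<beta> a c'"
        using newZ[OF c'0, of \<beta>] \<beta> False unfolding S_eq by auto
      have u\<beta>: "u \<beta> \<in> D3" using u \<beta> by (simp add: dual_fam_def)
      \<comment> \<open>Both are integrals over the same space with equal coefficients at A, fixed
        by duality on \<open>?E'\<close> and by the choice of c' elsewhere.\<close>
      have "?l c' \<beta> = u \<beta>"
      proof (rule sepA[OF gc nz(1)])
        show "u \<beta> \<in> ?Z c" using u\<beta> D3Z by blast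
        fix a assume a: "a \<in> A"
        show "lookup (?l c' \<beta>) a = lookup (u \<beta>) a"
        proof (cases "a \<in> ?E'")
          case True
          then have "ev (u \<beta>) a = (if \<beta> = a then 1 else 0)" using u \<beta> by (simp add: dual_fam_def)
          then show ?thesis using nz(2) a True by (auto simp: y_def ev_def field_simps split: if_splits)
        next
          case F: False
          have "(\<beta>, a) \<notin> V" using P(2) False by (auto simp: mu_index_def)
          then show ?thesis using nz(2) a F by (simp add: y_def c'_def)
        qed
      qed
      then show ?thesis using u\<beta> by simp
    qed
    have "?S' c' \<subseteq> D3"
      unfolding pt_space_def[of E "Suc t"] using mem sub3 by (intro pm.span_minimal) auto
    moreover have "D3 \<subseteq> ?S' c'"
    proof
      fix x assume x: "x \<in> D3"
      have sep: "separates (\<lambda>\<gamma> p. ev p \<gamma>) ?E' D3"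
        by (rule dual_fam_separates[OF u sub3 basis_list_fin_dim[OF b3]])
           (use basis_list_dim[OF b3] lls in simp)
      have "dual_fam (\<lambda>\<gamma> p. ev p \<gamma>) (?l c') ?E' D3"
        using finF(2) linfun_ev mem ev'[OF c'0] by (auto simp: dual_fam_def)
      from dual_fam_span[OF this sub3 sep] show "x \<in> ?S' c'" using x by (simp add: pt_space_def)
    qed
    ultimately have "?S' c' = D3" by blast
    moreover have "basis_list D3 (list_comb M (b @ ls))"
      using basis_list_list_comb[OF b3] M(2) lls by simp
    ultimately show ?thesis using Fls c'0 by (intro exI[of _ c'] exI[of _ "list_comb M (b @ ls)"]) simp
  qed

  have "parametrizes E (Suc t) V' g' L'"
    unfolding parametrizes_def
  proof (intro conjI)
    show "finite V'" using P(1) finF A(3) by (simp add: V'_def)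
    show "V' \<subseteq> mu_index ?E'" by (rule V'mu)
    show "card V' = (\<Sum>s\<le>Suc t. gamma_part E s)" by (rule cardV')
    show "g' \<in> polyfun \<rat> V'" by (rule g'V)
    show "\<forall>\<beta>\<in>?E'. \<forall>\<alpha>. L' \<beta> \<alpha> \<in> polyfun \<rat> V'" using L'V by blast
    show "\<exists>c. g' c \<noteq> 0" using c0 by blast
    show "\<forall>c. g' c \<noteq> 0 \<longrightarrow> dual_basis ?E' (?S' c) (?l c) \<and>
      (\<forall>\<beta>\<in>?E'. \<forall>\<alpha>. lookup (?l c \<beta>) \<alpha> = L' \<beta> \<alpha> c / g' c) \<and>
      (\<forall>(\<beta>, \<alpha>)\<in>V'. of_nat (mfact \<alpha>) * L' \<beta> \<alpha> c = c (\<beta>, \<alpha>) * g' c) \<and>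
      (\<forall>k. pdiff k ` ?S' c \<subseteq> ?S' c) \<and> ?S' c \<in> U_reg E (Suc t)"
    proof (intro allI impI)
      fix c assume c: "g' c \<noteq> 0"
      have "\<forall>(\<beta>, \<alpha>)\<in>V'. of_nat (mfact \<alpha>) * L' \<beta> \<alpha> c = c (\<beta>, \<alpha>) * g' c" using coord[OF c] by blast
      then show "dual_basis ?E' (?S' c) (?l c) \<and>
        (\<forall>\<beta>\<in>?E'. \<forall>\<alpha>. lookup (?l c \<beta>) \<alpha> = L' \<beta> \<alpha> c / g' c) \<and>
        (\<forall>(\<beta>, \<alpha>)\<in>V'. of_nat (mfact \<alpha>) * L' \<beta> \<alpha> c = c (\<beta>, \<alpha>) * g' c) \<and>
        (\<forall>k. pdiff k ` ?S' c \<subseteq> ?S' c) \<and> ?S' c \<in> U_reg E (Suc t)"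
        using db[OF c] lL[OF c] st[OF c] U'[OF c] by simp
    qed
    show "\<forall>D\<in>Hilb_reg (hfun E) (Suc t). \<forall>bs F. basis_list D bs \<longrightarrow>
      F \<in> polyfun UNIV ({..<card ?E'} \<times> UNIV) \<longrightarrow> F (entries bs) \<noteq> 0 \<longrightarrow>
      (\<exists>c bs'. g' c \<noteq> 0 \<and> basis_list (?S' c) bs' \<and> F (entries bs') \<noteq> 0)"
    proof (intro ballI allI impI)
      fix D :: "('n, complex) mpol set" and bs :: "('n, complex) mpol list" and F :: "(nat \<times> 'n expo \<Rightarrow> complex) \<Rightarrow> complex"
      assume "D \<in> Hilb_reg (hfun E) (Suc t)" "basis_list D bs"
        "F \<in> polyfun UNIV ({..<card ?E'} \<times> UNIV)" "F (entries bs) \<noteq> 0"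
      then show "\<exists>c bs'. g' c \<noteq> 0 \<and> basis_list (?S' c) bs' \<and> F (entries bs') \<noteq> 0" by (rule dense)
    qed
  qed
  then show ?thesis by blast
qed

section \<open>Induction over the degree and passage to formal rational functions\<close>

lemma parametrizes_exists:
  fixes E :: "'n::{finite,linorder} expo set"
  assumes E: "finite E" "closed_under_division E" "E \<noteq> {}" and r: "regular_basis E"
  shows "t \<le> top_deg E \<Longrightarrow> \<exists>V g L. parametrizes E t V g L"
proof (induction t)
  case 0
  show ?case using parametrizes_0[OF E] by blast
next
  case (Suc t)
  then obtain V g L where p: "parametrizes E t V g L" by auto
  have "U_reg E (Suc t) \<noteq> {}" using r Suc.prems unfolding regular_basis_def by auto
  then show ?case by (rule parametrizes_step[OF E Suc.prems p])
qed

lemma upto_top_deg: "finite E \<Longrightarrow> upto_deg E (top_deg E) = E"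
  by (auto simp: upto_deg_def top_deg_def)

text \<open>Dual basis elements have degree at most t < r, so the coordinates with |\<alpha>| < r
  determine all their coefficients.\<close>

lemma Hilb_B_eqI:
  fixes E :: "'n::{finite,linorder} expo set"
  assumes E: "finite E" and D: "D \<in> Hilb_B E t" "D' \<in> Hilb_B E t" and t: "t < r"
    and eq: "\<And>\<beta> \<alpha>. \<beta> \<in> upto_deg E t \<Longrightarrow> mdeg \<alpha> < r \<Longrightarrow> mu_coord (upto_deg E t) D \<beta> \<alpha> = mu_coord (upto_deg E t) D' \<beta> \<alpha>"
  shows "D = D'"
proof -
  obtain \<Lambda> where d: "dual_basis (upto_deg E t) D \<Lambda>" using Hilb_B_dual_basis[OF D(1) E] by blast
  obtain \<Lambda>' where d': "dual_basis (upto_deg E t) D' \<Lambda>'" using Hilb_B_dual_basis[OF D(2) E] by blast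
  have "\<Lambda> \<beta> = \<Lambda>' \<beta>" if \<beta>: "\<beta> \<in> upto_deg E t" for \<beta>
  proof (rule ev_eqI)
    fix \<alpha>
    show "ev (\<Lambda> \<beta>) \<alpha> = ev (\<Lambda>' \<beta>) \<alpha>"
    proof (cases "mdeg \<alpha> < r")
      case True
      then show ?thesis using eq[OF \<beta> True] mu_coord_eq[OF d \<beta>] mu_coord_eq[OF d' \<beta>] by simp
    next
      case False
      then have "t < mdeg \<alpha>" using t by simp
      then have "lookup (\<Lambda> \<beta>) \<alpha> = 0" "lookup (\<Lambda>' \<beta>) \<alpha> = 0"
        using dual_basis_polys_le[OF d] dual_basis_polys_le[OF d'] dual_basisD(5)[OF d \<beta>] dual_basisD(5)[OF d' \<beta>]
        by (auto simp: polys_le_iff subset_iff)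
      then show ?thesis by (simp add: ev_def)
    qed
  qed
  then have "\<Lambda> ` upto_deg E t = \<Lambda>' ` upto_deg E t" by (rule image_cong[OF refl])
  then show ?thesis using dual_basis_span[OF d] dual_basis_span[OF d'] by simp
qed

theorem proposition4p4:
  fixes E :: "('n::{finite,linorder}) expo set"
  assumes "finite E" and "E \<noteq> {}"
    and "monomial ` E \<subseteq> polys_le (card E - 1)"
    and "closed_under_division E"
    and "regular_basis E"
  shows "\<exists>mubar (num :: 'n expo \<Rightarrow> 'n expo \<Rightarrow> ('n expo \<times> 'n expo, rat) mpol)
            (den :: 'n expo \<Rightarrow> 'n expo \<Rightarrow> ('n expo \<times> 'n expo, rat) mpol).
    mubar \<subseteq> mu_index E \<and> card mubar = gamma_total E \<and>
    (\<forall>\<beta>\<in>E. \<forall>\<alpha>. mdeg \<alpha> < card E \<longrightarrow>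
       den \<beta> \<alpha> \<noteq> 0 \<and> mvars (num \<beta> \<alpha>) \<subseteq> mubar \<and> mvars (den \<beta> \<alpha>) \<subseteq> mubar) \<and>
    (let r = card E; t = top_deg E;
         q = (\<lambda>c \<beta> \<alpha>. rat_eval c (num \<beta> \<alpha>) / rat_eval c (den \<beta> \<alpha>));
         dom = {c \<in> mubar \<rightarrow>\<^sub>E UNIV. \<forall>\<beta>\<in>E. \<forall>\<alpha>. mdeg \<alpha> < r \<longrightarrow> rat_eval c (den \<beta> \<alpha>) \<noteq> 0};
         is_Phi = (\<lambda>c D. D \<in> Hilb_B E t \<and>
                     (\<forall>\<beta>\<in>E. \<forall>\<alpha>. mdeg \<alpha> < r \<longrightarrow> mu_coord E D \<beta> \<alpha> = q c \<beta> \<alpha>));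
         image = {D. \<exists>c\<in>dom. is_Phi c D}
     in (\<forall>c\<in>dom. \<exists>!D. is_Phi c D) \<and>
        (\<forall>c\<in>dom. \<forall>(\<beta>, \<alpha>)\<in>mubar. q c \<beta> \<alpha> = c (\<beta>, \<alpha>)) \<and>
        image \<subseteq> Hilb_reg (hfun E) t \<and>
        Hilb_reg (hfun E) t \<subseteq> zariski_Grass r (polys_le t) closure_of image)"
proof -
  let ?t = "top_deg E" and ?r = "card E"
  note E = \<open>finite E\<close> \<open>closed_under_division E\<close> \<open>E \<noteq> {}\<close>
  have top: "upto_deg E ?t = E" by (rule upto_top_deg[OF E(1)])
  have tr: "?t < ?r" using less_card_upto_deg[OF E, of ?t] by (simp add: top)
  obtain V g L where p: "parametrizes E ?t V g L"
    using parametrizes_exists[OF E assms(5), of ?t] by blast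
  note P = parametrizesD[OF p, unfolded top]
  let ?S = "pt_space E ?t g L"
  obtain dg where dg: "mvars dg \<subseteq> V" "\<And>c. rat_eval c dg = g c"
    using polyfun_rat_eval[OF P(4)] by blast
  \<comment> \<open>The factorial turns the coefficient L into a numerator for the coordinate \<mu>;
    the single polynomial \<open>dg\<close> serves as denominator throughout.\<close>
  have "\<exists>f. mvars f \<subseteq> V \<and> (\<forall>c. rat_eval c f = of_nat (mfact \<alpha>) * L \<beta> \<alpha> c)" if "\<beta> \<in> E" for \<beta> \<alpha>
    by (rule polyfun_rat_eval) (intro polyfun_cmult P(5)[OF that], simp)
  then obtain num where num: "\<And>\<beta> \<alpha>. \<beta> \<in> E \<Longrightarrow> mvars (num \<beta> \<alpha>) \<subseteq> V"
    "\<And>\<beta> \<alpha> c. \<beta> \<in> E \<Longrightarrow> rat_eval c (num \<beta> \<alpha>) = of_nat (mfact \<alpha>) * L \<beta> \<alpha> c"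
    by metis
  have dg0: "dg \<noteq> 0"
  proof
    assume "dg = 0"
    then have "g c = 0" for c using dg(2)[of c] by (simp add: rat_eval_hom_eval)
    then show False using P(6) by blast
  qed
  define dom where "dom = {c \<in> V \<rightarrow>\<^sub>E UNIV. \<forall>\<beta>\<in>E. \<forall>\<alpha> :: 'n expo. mdeg \<alpha> < ?r \<longrightarrow> rat_eval c dg \<noteq> 0}"
  define q where "q = (\<lambda>c \<beta> \<alpha>. rat_eval c (num \<beta> \<alpha>) / rat_eval c dg)"
  define Phi where "Phi = (\<lambda>c D. D \<in> Hilb_B E ?t \<and>
    (\<forall>\<beta>\<in>E. \<forall>\<alpha>. mdeg \<alpha> < ?r \<longrightarrow> mu_coord E D \<beta> \<alpha> = q c \<beta> \<alpha>))"
  have dom: "c \<in> dom \<longleftrightarrow> c \<in> V \<rightarrow>\<^sub>E UNIV \<and> g c \<noteq> 0" for c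
  proof -
    have "\<exists>\<alpha> :: 'n expo. mdeg \<alpha> < ?r" using tr by (intro exI[of _ 0]) simp
    moreover obtain \<beta> where "\<beta> \<in> E" using E(3) by blast
    ultimately show ?thesis unfolding dom_def dg(2) by blast
  qed
  have SHB: "?S c \<in> Hilb_B E ?t" if "g c \<noteq> 0" for c
    by (rule dual_basis_Hilb_B) (use P(7,10)[OF that] tr in \<open>simp_all add: top\<close>)
  have PhiS: "Phi c (?S c)" if c: "g c \<noteq> 0" for c
    unfolding Phi_def
  proof (intro conjI ballI allI impI SHB[OF c])
    fix \<beta> \<alpha> assume \<beta>: "\<beta> \<in> E"
    show "mu_coord E (?S c) \<beta> \<alpha> = q c \<beta> \<alpha>"
      using mu_coord_eq[OF P(7)[OF c] \<beta>, of \<alpha>] P(8)[OF c \<beta>, of \<alpha>] by (simp add: q_def dg(2) num(2)[OF \<beta>] ev_def)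
  qed
  have Phi_unique: "D = ?S c" if c: "g c \<noteq> 0" and D: "Phi c D" for c D
  proof (rule Hilb_B_eqI[OF E(1) _ SHB[OF c] tr])
    show "D \<in> Hilb_B E ?t" using D by (simp add: Phi_def)
    fix \<beta> \<alpha> :: "'n expo"
    assume "\<beta> \<in> upto_deg E ?t" "mdeg \<alpha> < ?r"
    then show "mu_coord (upto_deg E ?t) D \<beta> \<alpha> = mu_coord (upto_deg E ?t) (?S c) \<beta> \<alpha>"
      using D PhiS[OF c] by (simp add: Phi_def top)
  qed
  define image where "image = {D. \<exists>c\<in>dom. Phi c D}"
  have image: "image = ?S ` dom"
    unfolding image_def using PhiS Phi_unique dom by blast
  have reg: "?S c \<in> Hilb_reg (hfun E) ?t" if "g c \<noteq> 0" for c
    using P(11)[OF that] U_reg_subset by blast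
  have "Hilb_reg (hfun E) ?t \<subseteq> zariski_Grass ?r (polys_le ?t) closure_of image"
  proof (rule poly_dense_closure[OF polys_le_fin_dim])
    show sub: "Hilb_reg (hfun E) ?t \<subseteq> Grass ?r (polys_le ?t :: ('n, complex) mpol set)"
      using Hilb_reg_subset[OF E, of ?t] by (simp add: top)
    show "image \<subseteq> Grass ?r (polys_le ?t)" unfolding image using reg sub dom by blast
    show "poly_dense ?r (Hilb_reg (hfun E) ?t) image"
      unfolding poly_dense_def
    proof (intro ballI allI impI)
      fix D :: "('n, complex) mpol set" and bs :: "('n, complex) mpol list"
        and F :: "(nat \<times> 'n expo \<Rightarrow> complex) \<Rightarrow> complex"
      assume "D \<in> Hilb_reg (hfun E) ?t" "basis_list D bs" "F \<in> polyfun UNIV ({..<?r} \<times> UNIV)" "F (entries bs) \<noteq> 0"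
      then have "\<exists>c bs'. g c \<noteq> 0 \<and> basis_list (?S c) bs' \<and> F (entries bs') \<noteq> 0" by (rule P(12))
      then obtain c bs' where c: "g c \<noteq> 0" "basis_list (?S c) bs'" "F (entries bs') \<noteq> 0"
        by (elim exE conjE)
      \<comment> \<open>Points of the domain are extensional functions on V. Restricting c leaves
        the parametrized space unchanged, since g and L only involve variables in V.\<close>
      define c' where "c' = restrict c V"
      have eq: "H c' = H c" if "H \<in> polyfun \<rat> V" for H
        by (rule polyfun_cong[OF that]) (simp add: c'_def)
      have "pt_elem ?t g L c' \<beta> = pt_elem ?t g L c \<beta>" if "\<beta> \<in> E" for \<beta>
        by (rule poly_mapping_eqI) (simp add: lookup_pt_elem eq[OF P(4)] eq[OF P(5)[OF that]])
      then have "?S c' = ?S c" by (simp add: pt_space_def top)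
      moreover have "c' \<in> dom" unfolding dom using c(1) eq[OF P(4)] by (simp add: c'_def)
      ultimately have "?S c \<in> image" unfolding image by (metis imageI)
      then show "\<exists>D'\<in>image. \<exists>bs'. basis_list D' bs' \<and> F (entries bs') \<noteq> 0" using c(2,3) by blast
    qed
  qed
  moreover have "image \<subseteq> Hilb_reg (hfun E) ?t" unfolding image using reg dom by blast
  moreover have "\<forall>c\<in>dom. \<forall>(\<beta>, \<alpha>)\<in>V. q c \<beta> \<alpha> = c (\<beta>, \<alpha>)"
  proof (intro ballI, clarify)
    fix c \<beta> \<alpha> assume c: "c \<in> dom" and v: "(\<beta>, \<alpha>) \<in> V"
    then have "\<beta> \<in> E" using P(2) by (auto simp: mu_index_def)
    then show "q c \<beta> \<alpha> = c (\<beta>, \<alpha>)" using P(9)[OF _ v, of c] c by (simp add: q_def dg(2) num(2) dom)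
  qed
  moreover have "\<forall>c\<in>dom. \<exists>!D. Phi c D" using PhiS Phi_unique dom by blast
  moreover have "V \<subseteq> mu_index E" "card V = gamma_total E" using P(2,3) by (simp_all add: gamma_total_def)
  moreover have "\<forall>\<beta>\<in>E. \<forall>\<alpha>. mdeg \<alpha> < ?r \<longrightarrow> dg \<noteq> 0 \<and> mvars (num \<beta> \<alpha>) \<subseteq> V \<and> mvars dg \<subseteq> V"
    using dg0 dg(1) num(1) by blast
  ultimately show ?thesis
    unfolding image_def Phi_def dom_def q_def Let_def
    by (intro exI[of _ V] exI[of _ num] exI[of _ "\<lambda>_ _. dg"]) (intro conjI)
qed

end
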